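(* Let $\Gamma$ be an oriented simply laced Dynkin graph (a graph without loops or multiple edges, each edge oriented) and $\mathcal{U}^+(\mathfrak{g})$ the associated Khovanov–Lauda–Rouquier category over $\mathbb{Z}$. The assignments $$\mathbf{d}(x)=x^2,\quad \mathbf{d}(\psi_{ii})=-x_1\psi_{ii}-\psi_{ii}x_2,\quad \mathbf{d}(\psi_{ij})=x_1\psi_{ij}\ (i,j\text{ adjacent}),\quad \mathbf{d}(\psi_{ij})=0\ (i\neq j\text{ not adjacent}),$$ $$\mathbf{z}(x)=\mathrm{id},\qquad \mathbf{z}(\psi_{ij})=0\ \text{for all }i,j,$$ together with $\mathbf{h}(f)=\deg(f)f$ for homogeneous $f$, extended by the monoidal Leibniz rule, give a well-defined action of $\mathfrak{sl}_2$ on $\mathcal{U}^+(\mathfrak{g})$ by derivations, with $\mathfrak{sl}_2$-triple $(\mathbf{d},\mathbf{h},-\mathbf{z})$. The divided power operators $\mathbf{d}^{(k)}$ and $\mathbf{z}^{(k)}$ are well-defined in the integral form for all $k\ge0$, making $\mathcal{U}^+(\mathfrak{g})$ into a divided powers $\mathfrak{sl}_2$-algebra.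
   Context: Conventions: $f\circ g$ (or $fg$) places $f$ above $g$; in a tensor product of objects $x_k$ is the dot on the $k$-th factor from the left and $\psi_k$ the crossing of factors $k,k+1$. Thus $x_1\psi_{ij}$ has a dot on the upper left end of the crossing and $\psi_{ii}x_2$ a dot on the lower right end. For vertices put $i\cdot i=2$, $i\cdot j=-1$ if $i,j$ are adjacent, $i\cdot j=0$ otherwise. $\mathcal{U}^+(\mathfrak{g})$ is the graded $\mathbb{Z}$-linear strict monoidal category with generating objects $\mathcal{E}_i$ ($i$ a vertex) and generating morphisms: dot $x:\mathcal{E}_i\to\mathcal{E}_i$ (degree $2$), crossing $\psi_{ij}:\mathcal{E}_i\mathcal{E}_j\to\mathcal{E}_j\mathcal{E}_i$ (degree $-i\cdot j$). Relations: on $\mathcal{E}_i\mathcal{E}_i$, $x_1\psi-\psi x_2=\mathrm{id}=\psi x_1-x_2\psi$; for $i\ne j$, $x_1\psi_{ij}=\psi_{ij}x_2$ and $x_2\psi_{ij}=\psi_{ij}x_1$; $\psi_{ji}\psi_{ij}$ equals $0$ if $i=j$, $\mathrm{id}$ if $i\ne j$ are not adjacent, and, for $i,j$ adjacent, (dot on the strand coloured by the tail of the edge) $-$ (dot on the strand coloured by the head of the edge); on $\mathcal{E}_i\mathcal{E}_j\mathcal{E}_k$, $\psi_1\psi_2\psi_1=\psi_2\psi_1\psi_2$ unless $i=k$ is adjacent to $j$, in which case $\psi_1\psi_2\psi_1-\psi_2\psi_1\psi_2=\varepsilon\,\mathrm{id}$ with $\varepsilon=+1$ if the edge is oriented $i\to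 j$ and $-1$ if $j\to i$. Action by derivations: $\mathbf{x}(f\circ g)=\mathbf{x}(f)\circ g+f\circ\mathbf{x}(g)$ and $\mathbf{x}(f\otimes g)=\mathbf{x}(f)\otimes g+f\otimes\mathbf{x}(g)$ for $\mathbf{x}\in\{\mathbf{d},\mathbf{h},\mathbf{z}\}$, with $[\mathbf{h},\mathbf{d}]=2\mathbf{d}$, $[\mathbf{h},\mathbf{z}]=-2\mathbf{z}$, $\mathbf{z}\mathbf{d}-\mathbf{d}\mathbf{z}=\mathbf{h}$. Divided powers are defined integrally if there are operators $\mathbf{x}^{(k)}$ on the morphism spaces with $k!\,\mathbf{x}^{(k)}=\mathbf{x}^k$ and $\mathbf{x}^{(k)}\mathbf{x}^{(l)}=\binom{k+l}{k}\mathbf{x}^{(k+l)}$; a divided powers $\mathfrak{sl}_2$-algebra is one for which this holds for $\mathbf{d}$ and $\mathbf{z}$. *)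

theory Defs
  imports Main
begin

section \<open>\<open>\<int>\<close>-linear strict monoidal categories with homogeneous morphisms\<close>

text \<open>
  Morphism spaces of different source or target are disjoint, so composition, tensor product
  and operators on morphisms need not be indexed by objects. The set \<open>homog C u v n\<close> consists of
  the morphisms from \<open>u\<close> to \<open>v\<close> that are homogeneous of degree \<open>n\<close> (including the zero morphism).
\<close>

record ('o, 'm) moncat =
  obj :: "'o set"
  unit :: "'o"
  tensor_obj :: "'o \<Rightarrow> 'o \<Rightarrow> 'o"
  hom :: "'o \<Rightarrow> 'o \<Rightarrow> 'm set"
  homog :: "'o \<Rightarrow> 'o \<Rightarrow> int \<Rightarrow> 'm set"
  ident :: "'o \<Rightarrow> 'm"
  comp :: "'m \<Rightarrow> 'm \<Rightarrow> 'm" (infixr \<open>\<odot>\<index>\<close> 70)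
  tensor :: "'m \<Rightarrow> 'm \<Rightarrow> 'm" (infixr \<open>\<otimes>\<index>\<close> 75)
  zero :: "'o \<Rightarrow> 'o \<Rightarrow> 'm"
  add :: "'m \<Rightarrow> 'm \<Rightarrow> 'm" (infixl \<open>\<oplus>\<index>\<close> 65)
  scale :: "int \<Rightarrow> 'm \<Rightarrow> 'm" (infixr \<open>\<cdot>\<index>\<close> 68)

locale linear_monoidal_category =
  fixes C :: "('o, 'm) moncat" (structure)
  assumes unit_obj: "unit C \<in> obj C"
    and tensor_obj_closed: "u \<in> obj C \<Longrightarrow> v \<in> obj C \<Longrightarrow> tensor_obj C u v \<in> obj C"
    and tensor_obj_assoc: "u \<in> obj C \<Longrightarrow> v \<in> obj C \<Longrightarrow> w \<in> obj C
      \<Longrightarrow> tensor_obj C (tensor_obj C u v) w = tensor_obj C u (tensor_obj C v w)"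
    and tensor_obj_unit: "u \<in> obj C \<Longrightarrow> tensor_obj C (unit C) u = u"
      "u \<in> obj C \<Longrightarrow> tensor_obj C u (unit C) = u"
    and hom_obj: "f \<in> hom C u v \<Longrightarrow> u \<in> obj C \<and> v \<in> obj C"
    and hom_disjoint: "f \<in> hom C u v \<Longrightarrow> f \<in> hom C u' v' \<Longrightarrow> u = u' \<and> v = v'"
    and homog_hom: "homog C u v n \<subseteq> hom C u v"
    and ident_hom: "u \<in> obj C \<Longrightarrow> ident C u \<in> hom C u u"
    and comp_hom: "f \<in> hom C v w \<Longrightarrow> g \<in> hom C u v \<Longrightarrow> f \<odot> g \<in> hom C u w"
    and tensor_hom: "f \<in> hom C u v \<Longrightarrow> g \<in> hom C u' v'
      \<Longrightarrow> f \<otimes> g \<in> hom C (tensor_obj C u u') (tensor_obj C v v')"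
    and zero_hom: "u \<in> obj C \<Longrightarrow> v \<in> obj C \<Longrightarrow> zero C u v \<in> hom C u v"
    and add_hom: "f \<in> hom C u v \<Longrightarrow> g \<in> hom C u v \<Longrightarrow> f \<oplus> g \<in> hom C u v"
    and scale_hom: "f \<in> hom C u v \<Longrightarrow> c \<cdot> f \<in> hom C u v"
    and add_assoc: "f \<in> hom C u v \<Longrightarrow> g \<in> hom C u v \<Longrightarrow> k \<in> hom C u v
      \<Longrightarrow> (f \<oplus> g) \<oplus> k = f \<oplus> (g \<oplus> k)"
    and add_comm: "f \<in> hom C u v \<Longrightarrow> g \<in> hom C u v \<Longrightarrow> f \<oplus> g = g \<oplus> f"
    and add_zero: "f \<in> hom C u v \<Longrightarrow> f \<oplus> zero C u v = f"
    and add_inverse: "f \<in> hom C u v \<Longrightarrow> f \<oplus> (- 1) \<cdot> f = zero C u v"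
    and scale_one: "f \<in> hom C u v \<Longrightarrow> 1 \<cdot> f = f"
    and scale_scale: "f \<in> hom C u v \<Longrightarrow> a \<cdot> b \<cdot> f = (a * b) \<cdot> f"
    and scale_left: "f \<in> hom C u v \<Longrightarrow> (a + b) \<cdot> f = a \<cdot> f \<oplus> b \<cdot> f"
    and scale_right: "f \<in> hom C u v \<Longrightarrow> g \<in> hom C u v \<Longrightarrow> a \<cdot> (f \<oplus> g) = a \<cdot> f \<oplus> a \<cdot> g"
    and comp_assoc: "f \<in> hom C w x \<Longrightarrow> g \<in> hom C v w \<Longrightarrow> k \<in> hom C u v
      \<Longrightarrow> (f \<odot> g) \<odot> k = f \<odot> (g \<odot> k)"
    and comp_ident: "f \<in> hom C u v \<Longrightarrow> ident C v \<odot> f = f"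
      "f \<in> hom C u v \<Longrightarrow> f \<odot> ident C u = f"
    and comp_add: "f \<in> hom C v w \<Longrightarrow> f' \<in> hom C v w \<Longrightarrow> g \<in> hom C u v
      \<Longrightarrow> (f \<oplus> f') \<odot> g = f \<odot> g \<oplus> f' \<odot> g"
      "f \<in> hom C v w \<Longrightarrow> g \<in> hom C u v \<Longrightarrow> g' \<in> hom C u v
      \<Longrightarrow> f \<odot> (g \<oplus> g') = f \<odot> g \<oplus> f \<odot> g'"
    and comp_scale: "f \<in> hom C v w \<Longrightarrow> g \<in> hom C u v \<Longrightarrow> (c \<cdot> f) \<odot> g = c \<cdot> (f \<odot> g)"
      "f \<in> hom C v w \<Longrightarrow> g \<in> hom C u v \<Longrightarrow> f \<odot> (c \<cdot> g) = c \<cdot> (f \<odot> g)"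
    and tensor_assoc: "f \<in> hom C u u' \<Longrightarrow> g \<in> hom C v v' \<Longrightarrow> k \<in> hom C w w'
      \<Longrightarrow> (f \<otimes> g) \<otimes> k = f \<otimes> (g \<otimes> k)"
    and tensor_unit: "f \<in> hom C u v \<Longrightarrow> ident C (unit C) \<otimes> f = f"
      "f \<in> hom C u v \<Longrightarrow> f \<otimes> ident C (unit C) = f"
    and tensor_ident: "u \<in> obj C \<Longrightarrow> v \<in> obj C
      \<Longrightarrow> ident C u \<otimes> ident C v = ident C (tensor_obj C u v)"
    and interchange: "f \<in> hom C v w \<Longrightarrow> g \<in> hom C u v \<Longrightarrow> f' \<in> hom C v' w' \<Longrightarrow> g' \<in> hom C u' v'
      \<Longrightarrow> (f \<odot> g) \<otimes> (f' \<odot> g') = (f \<otimes> f') \<odot> (g \<otimes> g')"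
    and tensor_add: "f \<in> hom C u v \<Longrightarrow> f' \<in> hom C u v \<Longrightarrow> g \<in> hom C u' v'
      \<Longrightarrow> (f \<oplus> f') \<otimes> g = f \<otimes> g \<oplus> f' \<otimes> g"
      "f \<in> hom C u v \<Longrightarrow> g \<in> hom C u' v' \<Longrightarrow> g' \<in> hom C u' v'
      \<Longrightarrow> f \<otimes> (g \<oplus> g') = f \<otimes> g \<oplus> f \<otimes> g'"
    and tensor_scale: "f \<in> hom C u v \<Longrightarrow> g \<in> hom C u' v' \<Longrightarrow> (c \<cdot> f) \<otimes> g = c \<cdot> (f \<otimes> g)"
      "f \<in> hom C u v \<Longrightarrow> g \<in> hom C u' v' \<Longrightarrow> f \<otimes> (c \<cdot> g) = c \<cdot> (f \<otimes> g)"


section \<open>Derivations, actions of \<open>\<ss>\<ll>\<^sub>2\<close> and divided powers\<close>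

definition mor :: "('o, 'm) moncat \<Rightarrow> 'm set" where
  "mor C = (\<Union>u \<in> obj C. \<Union>v \<in> obj C. hom C u v)"

definition linear_operator :: "('o, 'm) moncat \<Rightarrow> ('m \<Rightarrow> 'm) \<Rightarrow> bool" where
  "linear_operator C D \<longleftrightarrow> (\<forall>u \<in> obj C. \<forall>v \<in> obj C. \<forall>f \<in> hom C u v.
     D f \<in> hom C u v \<and>
     (\<forall>g \<in> hom C u v. D (f \<oplus>\<^bsub>C\<^esub> g) = D f \<oplus>\<^bsub>C\<^esub> D g) \<and>
     (\<forall>c. D (c \<cdot>\<^bsub>C\<^esub> f) = c \<cdot>\<^bsub>C\<^esub> D f))"

definition derivation :: "('o, 'm) moncat \<Rightarrow> ('m \<Rightarrow> 'm) \<Rightarrow> bool" where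
  "derivation C D \<longleftrightarrow> linear_operator C D \<and>
     (\<forall>u \<in> obj C. \<forall>v \<in> obj C. \<forall>w \<in> obj C. \<forall>f \<in> hom C v w. \<forall>g \<in> hom C u v.
        D (f \<odot>\<^bsub>C\<^esub> g) = D f \<odot>\<^bsub>C\<^esub> g \<oplus>\<^bsub>C\<^esub> f \<odot>\<^bsub>C\<^esub> D g) \<and>
     (\<forall>f \<in> mor C. \<forall>g \<in> mor C. D (f \<otimes>\<^bsub>C\<^esub> g) = D f \<otimes>\<^bsub>C\<^esub> g \<oplus>\<^bsub>C\<^esub> f \<otimes>\<^bsub>C\<^esub> D g)"

text \<open>
  The relations \<open>[e, f] = h\<close>, \<open>[h, e] = 2 e\<close>, \<open>[h, f] = - 2 f\<close>, evaluated at every morphism.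
\<close>

definition sl2_triple :: "('o, 'm) moncat \<Rightarrow> ('m \<Rightarrow> 'm) \<Rightarrow> ('m \<Rightarrow> 'm) \<Rightarrow> ('m \<Rightarrow> 'm) \<Rightarrow> bool" where
  "sl2_triple C e h f \<longleftrightarrow> (\<forall>m \<in> mor C.
     e (f m) \<oplus>\<^bsub>C\<^esub> (- 1) \<cdot>\<^bsub>C\<^esub> f (e m) = h m \<and>
     h (e m) \<oplus>\<^bsub>C\<^esub> (- 1) \<cdot>\<^bsub>C\<^esub> e (h m) = 2 \<cdot>\<^bsub>C\<^esub> e m \<and>
     h (f m) \<oplus>\<^bsub>C\<^esub> (- 1) \<cdot>\<^bsub>C\<^esub> f (h m) = (- 2) \<cdot>\<^bsub>C\<^esub> f m)"

definition sl2_action_by_derivations ::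
  "('o, 'm) moncat \<Rightarrow> ('m \<Rightarrow> 'm) \<Rightarrow> ('m \<Rightarrow> 'm) \<Rightarrow> ('m \<Rightarrow> 'm) \<Rightarrow> bool" where
  "sl2_action_by_derivations C e h f \<longleftrightarrow>
     derivation C e \<and> derivation C h \<and> derivation C f \<and> sl2_triple C e h f"

definition divided_powers_of :: "('o, 'm) moncat \<Rightarrow> ('m \<Rightarrow> 'm) \<Rightarrow> (nat \<Rightarrow> 'm \<Rightarrow> 'm) \<Rightarrow> bool" where
  "divided_powers_of C D P \<longleftrightarrow>
     (\<forall>k. linear_operator C (P k)) \<and>
     (\<forall>k. \<forall>m \<in> mor C. fact k \<cdot>\<^bsub>C\<^esub> P k m = (D ^^ k) m) \<and>
     (\<forall>k l. \<forall>m \<in> mor C. P k (P l m) = int ((k + l) choose k) \<cdot>\<^bsub>C\<^esub> P (k + l) m)"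

definition divided_powers_integral :: "('o, 'm) moncat \<Rightarrow> ('m \<Rightarrow> 'm) \<Rightarrow> bool" where
  "divided_powers_integral C D \<longleftrightarrow> (\<exists>P. divided_powers_of C D P)"

text \<open>
  The operators \<open>d\<close>, \<open>h\<close>, \<open>z\<close> act by derivations with \<open>\<ss>\<ll>\<^sub>2\<close>-triple \<open>(d, h, - z)\<close>, and \<open>d\<close> and \<open>z\<close>
  have integral divided powers.
\<close>

definition divided_powers_sl2_algebra ::
  "('o, 'm) moncat \<Rightarrow> ('m \<Rightarrow> 'm) \<Rightarrow> ('m \<Rightarrow> 'm) \<Rightarrow> ('m \<Rightarrow> 'm) \<Rightarrow> bool" where
  "divided_powers_sl2_algebra C d h z \<longleftrightarrow>
     sl2_action_by_derivations C d h (\<lambda>m. (- 1) \<cdot>\<^bsub>C\<^esub> z m) \<and>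
     divided_powers_integral C d \<and> divided_powers_integral C z"


section \<open>The Khovanov-Lauda-Rouquier category\<close>

text \<open>
  A graph on the vertex set \<open>V\<close>, where \<open>(i, j) \<in> E\<close> is the edge between \<open>i\<close> and \<open>j\<close> with tail \<open>i\<close> and
  head \<open>j\<close>. The graph may be infinite.
\<close>

definition oriented_simply_laced_graph :: "'v set \<Rightarrow> ('v \<times> 'v) set \<Rightarrow> bool" where
  "oriented_simply_laced_graph V E \<longleftrightarrow>
     E \<subseteq> V \<times> V \<and> (\<forall>i j. (i, j) \<in> E \<longrightarrow> i \<noteq> j \<and> (j, i) \<notin> E)"

definition adjacent :: "('v \<times> 'v) set \<Rightarrow> 'v \<Rightarrow> 'v \<Rightarrow> bool" where
  "adjacent E i j \<longleftrightarrow> (i, j) \<in> E \<or> (j, i) \<in> E"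

definition pairing :: "('v \<times> 'v) set \<Rightarrow> 'v \<Rightarrow> 'v \<Rightarrow> int" where
  "pairing E i j = (if i = j then 2 else if adjacent E i j then - 1 else 0)"

text \<open>
  Objects are words in the vertices. Morphisms are formal expressions in the generators modulo
  the smallest congruence that contains the defining relations and the axioms of a \<open>\<int>\<close>-linear
  strict monoidal category. \<open>Comp f g\<close> is \<open>f\<close> above \<open>g\<close>.
\<close>

datatype 'v diagram =
    Ident "'v list"
  | Dot 'v
  | Cross 'v 'v
  | Null "'v list" "'v list"
  | Plus "'v diagram" "'v diagram"    (infixl \<open>\<boxplus>\<close> 65)
  | Scale int "'v diagram"            (infixr \<open>\<bullet>\<close> 68)
  | Comp "'v diagram" "'v diagram"    (infixr \<open>\<boxdot>\<close> 70)
  | Tensor "'v diagram" "'v diagram"  (infixr \<open>\<boxtimes>\<close> 75)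

abbreviation Minus :: "'v diagram \<Rightarrow> 'v diagram \<Rightarrow> 'v diagram" (infixl \<open>\<boxminus>\<close> 65) where
  "s \<boxminus> t \<equiv> s \<boxplus> (- 1) \<bullet> t"

inductive arrow :: "'v set \<Rightarrow> 'v list \<Rightarrow> 'v list \<Rightarrow> 'v diagram \<Rightarrow> bool" for V where
  "u \<in> lists V \<Longrightarrow> arrow V u u (Ident u)"
| "i \<in> V \<Longrightarrow> arrow V [i] [i] (Dot i)"
| "i \<in> V \<Longrightarrow> j \<in> V \<Longrightarrow> arrow V [i, j] [j, i] (Cross i j)"
| "u \<in> lists V \<Longrightarrow> v \<in> lists V \<Longrightarrow> arrow V u v (Null u v)"
| "arrow V u v s \<Longrightarrow> arrow V u v t \<Longrightarrow> arrow V u v (s \<boxplus> t)"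
| "arrow V u v s \<Longrightarrow> arrow V u v (c \<bullet> s)"
| "arrow V v w s \<Longrightarrow> arrow V u v t \<Longrightarrow> arrow V u w (s \<boxdot> t)"
| "arrow V u v s \<Longrightarrow> arrow V u' v' t \<Longrightarrow> arrow V (u @ u') (v @ v') (s \<boxtimes> t)"

inductive has_degree :: "('v \<times> 'v) set \<Rightarrow> int \<Rightarrow> 'v diagram \<Rightarrow> bool" for E where
  "has_degree E 0 (Ident u)"
| "has_degree E 2 (Dot i)"
| "has_degree E (- pairing E i j) (Cross i j)"
| "has_degree E n (Null u v)"
| "has_degree E n s \<Longrightarrow> has_degree E n t \<Longrightarrow> has_degree E n (s \<boxplus> t)"
| "has_degree E n s \<Longrightarrow> has_degree E n (c \<bullet> s)"
| "has_degree E m s \<Longrightarrow> has_degree E n t \<Longrightarrow> has_degree E (m + n) (s \<boxdot> t)"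
| "has_degree E m s \<Longrightarrow> has_degree E n t \<Longrightarrow> has_degree E (m + n) (s \<boxtimes> t)"

text \<open>The dot on the left and on the right factor of the object \<open>[i, j]\<close>.\<close>

abbreviation dot_left :: "'v \<Rightarrow> 'v \<Rightarrow> 'v diagram" where
  "dot_left i j \<equiv> Dot i \<boxtimes> Ident [j]"

abbreviation dot_right :: "'v \<Rightarrow> 'v \<Rightarrow> 'v diagram" where
  "dot_right i j \<equiv> Ident [i] \<boxtimes> Dot j"

text \<open>The composites \<open>\<psi>\<^sub>1 \<psi>\<^sub>2 \<psi>\<^sub>1\<close> and \<open>\<psi>\<^sub>2 \<psi>\<^sub>1 \<psi>\<^sub>2\<close> from \<open>[i, j, k]\<close> to \<open>[k, j, i]\<close>.\<close>

abbreviation braid_121 :: "'v \<Rightarrow> 'v \<Rightarrow> 'v \<Rightarrow> 'v diagram" where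
  "braid_121 i j k \<equiv>
     (Cross j k \<boxtimes> Ident [i]) \<boxdot> (Ident [j] \<boxtimes> Cross i k) \<boxdot> (Cross i j \<boxtimes> Ident [k])"

abbreviation braid_212 :: "'v \<Rightarrow> 'v \<Rightarrow> 'v \<Rightarrow> 'v diagram" where
  "braid_212 i j k \<equiv>
     (Ident [k] \<boxtimes> Cross i j) \<boxdot> (Cross i k \<boxtimes> Ident [j]) \<boxdot> (Ident [i] \<boxtimes> Cross j k)"

inductive klr_relation :: "('v \<times> 'v) set \<Rightarrow> 'v diagram \<Rightarrow> 'v diagram \<Rightarrow> bool" for E where
  dot_same_1: "klr_relation E
     (dot_left i i \<boxdot> Cross i i \<boxminus> Cross i i \<boxdot> dot_right i i) (Ident [i, i])"
| dot_same_2: "klr_relation E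
     (Cross i i \<boxdot> dot_left i i \<boxminus> dot_right i i \<boxdot> Cross i i) (Ident [i, i])"
| dot_slide_1: "i \<noteq> j \<Longrightarrow> klr_relation E
     (dot_left j i \<boxdot> Cross i j) (Cross i j \<boxdot> dot_right i j)"
| dot_slide_2: "i \<noteq> j \<Longrightarrow> klr_relation E
     (dot_right j i \<boxdot> Cross i j) (Cross i j \<boxdot> dot_left i j)"
| double_same: "klr_relation E (Cross i i \<boxdot> Cross i i) (Null [i, i] [i, i])"
| double_distant: "i \<noteq> j \<Longrightarrow> \<not> adjacent E i j \<Longrightarrow> klr_relation E
     (Cross j i \<boxdot> Cross i j) (Ident [i, j])"
| double_tail_head: "(i, j) \<in> E \<Longrightarrow> klr_relation E
     (Cross j i \<boxdot> Cross i j) (dot_left i j \<boxminus> dot_right i j)"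
| double_head_tail: "(j, i) \<in> E \<Longrightarrow> klr_relation E
     (Cross j i \<boxdot> Cross i j) (dot_right i j \<boxminus> dot_left i j)"
| braid: "\<not> (i = k \<and> adjacent E i j) \<Longrightarrow> klr_relation E (braid_121 i j k) (braid_212 i j k)"
| braid_tail_head: "(i, j) \<in> E \<Longrightarrow> klr_relation E
     (braid_121 i j i \<boxminus> braid_212 i j i) (Ident [i, j, i])"
| braid_head_tail: "(j, i) \<in> E \<Longrightarrow> klr_relation E
     (braid_121 i j i \<boxminus> braid_212 i j i) ((- 1) \<bullet> Ident [i, j, i])"

inductive klr_eq :: "'v set \<Rightarrow> ('v \<times> 'v) set \<Rightarrow> 'v list \<Rightarrow> 'v list \<Rightarrow> 'v diagram \<Rightarrow> 'v diagram \<Rightarrow> bool"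
  for V E where
  relation: "klr_relation E s t \<Longrightarrow> arrow V u v s \<Longrightarrow> arrow V u v t \<Longrightarrow> klr_eq V E u v s t"
  \<comment> \<open>congruence\<close>
| refl: "arrow V u v s \<Longrightarrow> klr_eq V E u v s s"
| sym: "klr_eq V E u v s t \<Longrightarrow> klr_eq V E u v t s"
| trans: "klr_eq V E u v r s \<Longrightarrow> klr_eq V E u v s t \<Longrightarrow> klr_eq V E u v r t"
| Plus_cong: "klr_eq V E u v s s' \<Longrightarrow> klr_eq V E u v t t' \<Longrightarrow> klr_eq V E u v (s \<boxplus> t) (s' \<boxplus> t')"
| Scale_cong: "klr_eq V E u v s s' \<Longrightarrow> klr_eq V E u v (c \<bullet> s) (c \<bullet> s')"
| Comp_cong: "klr_eq V E v w s s' \<Longrightarrow> klr_eq V E u v t t' \<Longrightarrow> klr_eq V E u w (s \<boxdot> t) (s' \<boxdot> t')"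
| Tensor_cong: "klr_eq V E u v s s' \<Longrightarrow> klr_eq V E u' v' t t'
    \<Longrightarrow> klr_eq V E (u @ u') (v @ v') (s \<boxtimes> t) (s' \<boxtimes> t')"
  \<comment> \<open>morphism spaces are \<open>\<int>\<close>-modules\<close>
| Plus_assoc: "arrow V u v r \<Longrightarrow> arrow V u v s \<Longrightarrow> arrow V u v t
    \<Longrightarrow> klr_eq V E u v ((r \<boxplus> s) \<boxplus> t) (r \<boxplus> (s \<boxplus> t))"
| Plus_comm: "arrow V u v s \<Longrightarrow> arrow V u v t \<Longrightarrow> klr_eq V E u v (s \<boxplus> t) (t \<boxplus> s)"
| Plus_Null: "arrow V u v s \<Longrightarrow> klr_eq V E u v (s \<boxplus> Null u v) s"
| Plus_inverse: "arrow V u v s \<Longrightarrow> klr_eq V E u v (s \<boxminus> s) (Null u v)"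
| Scale_one: "arrow V u v s \<Longrightarrow> klr_eq V E u v (1 \<bullet> s) s"
| Scale_Scale: "arrow V u v s \<Longrightarrow> klr_eq V E u v (a \<bullet> b \<bullet> s) ((a * b) \<bullet> s)"
| Scale_left: "arrow V u v s \<Longrightarrow> klr_eq V E u v ((a + b) \<bullet> s) (a \<bullet> s \<boxplus> b \<bullet> s)"
| Scale_right: "arrow V u v s \<Longrightarrow> arrow V u v t
    \<Longrightarrow> klr_eq V E u v (a \<bullet> (s \<boxplus> t)) (a \<bullet> s \<boxplus> a \<bullet> t)"
  \<comment> \<open>category with bilinear composition\<close>
| Comp_assoc: "arrow V w x r \<Longrightarrow> arrow V v w s \<Longrightarrow> arrow V u v t
    \<Longrightarrow> klr_eq V E u x ((r \<boxdot> s) \<boxdot> t) (r \<boxdot> (s \<boxdot> t))"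
| Comp_Ident_left: "arrow V u v s \<Longrightarrow> klr_eq V E u v (Ident v \<boxdot> s) s"
| Comp_Ident_right: "arrow V u v s \<Longrightarrow> klr_eq V E u v (s \<boxdot> Ident u) s"
| Comp_Plus_left: "arrow V v w r \<Longrightarrow> arrow V v w s \<Longrightarrow> arrow V u v t
    \<Longrightarrow> klr_eq V E u w ((r \<boxplus> s) \<boxdot> t) (r \<boxdot> t \<boxplus> s \<boxdot> t)"
| Comp_Plus_right: "arrow V v w r \<Longrightarrow> arrow V u v s \<Longrightarrow> arrow V u v t
    \<Longrightarrow> klr_eq V E u w (r \<boxdot> (s \<boxplus> t)) (r \<boxdot> s \<boxplus> r \<boxdot> t)"
| Comp_Scale_left: "arrow V v w s \<Longrightarrow> arrow V u v t
    \<Longrightarrow> klr_eq V E u w ((c \<bullet> s) \<boxdot> t) (c \<bullet> (s \<boxdot> t))"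
| Comp_Scale_right: "arrow V v w s \<Longrightarrow> arrow V u v t
    \<Longrightarrow> klr_eq V E u w (s \<boxdot> (c \<bullet> t)) (c \<bullet> (s \<boxdot> t))"
  \<comment> \<open>strict monoidal structure with bilinear tensor product\<close>
| Tensor_assoc: "arrow V u u' r \<Longrightarrow> arrow V v v' s \<Longrightarrow> arrow V w w' t
    \<Longrightarrow> klr_eq V E (u @ v @ w) (u' @ v' @ w') ((r \<boxtimes> s) \<boxtimes> t) (r \<boxtimes> (s \<boxtimes> t))"
| Tensor_unit_left: "arrow V u v s \<Longrightarrow> klr_eq V E u v (Ident [] \<boxtimes> s) s"
| Tensor_unit_right: "arrow V u v s \<Longrightarrow> klr_eq V E u v (s \<boxtimes> Ident []) s"
| Tensor_Ident: "u \<in> lists V \<Longrightarrow> v \<in> lists V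
    \<Longrightarrow> klr_eq V E (u @ v) (u @ v) (Ident u \<boxtimes> Ident v) (Ident (u @ v))"
| Interchange: "arrow V v w s \<Longrightarrow> arrow V u v t \<Longrightarrow> arrow V v' w' s' \<Longrightarrow> arrow V u' v' t'
    \<Longrightarrow> klr_eq V E (u @ u') (w @ w') ((s \<boxdot> t) \<boxtimes> (s' \<boxdot> t')) ((s \<boxtimes> s') \<boxdot> (t \<boxtimes> t'))"
| Tensor_Plus_left: "arrow V u v r \<Longrightarrow> arrow V u v s \<Longrightarrow> arrow V u' v' t
    \<Longrightarrow> klr_eq V E (u @ u') (v @ v') ((r \<boxplus> s) \<boxtimes> t) (r \<boxtimes> t \<boxplus> s \<boxtimes> t)"
| Tensor_Plus_right: "arrow V u v r \<Longrightarrow> arrow V u' v' s \<Longrightarrow> arrow V u' v' t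
    \<Longrightarrow> klr_eq V E (u @ u') (v @ v') (r \<boxtimes> (s \<boxplus> t)) (r \<boxtimes> s \<boxplus> r \<boxtimes> t)"
| Tensor_Scale_left: "arrow V u v s \<Longrightarrow> arrow V u' v' t
    \<Longrightarrow> klr_eq V E (u @ u') (v @ v') ((c \<bullet> s) \<boxtimes> t) (c \<bullet> (s \<boxtimes> t))"
| Tensor_Scale_right: "arrow V u v s \<Longrightarrow> arrow V u' v' t
    \<Longrightarrow> klr_eq V E (u @ u') (v @ v') (s \<boxtimes> (c \<bullet> t)) (c \<bullet> (s \<boxtimes> t))"

definition klr_rel :: "'v set \<Rightarrow> ('v \<times> 'v) set \<Rightarrow> ('v diagram \<times> 'v diagram) set" where
  "klr_rel V E = {(s, t). \<exists>u v. klr_eq V E u v s t}"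

definition klr_class :: "'v set \<Rightarrow> ('v \<times> 'v) set \<Rightarrow> 'v diagram \<Rightarrow> 'v diagram set" where
  "klr_class V E t = klr_rel V E `` {t}"

definition KLR :: "'v set \<Rightarrow> ('v \<times> 'v) set \<Rightarrow> ('v list, 'v diagram set) moncat" where
  "KLR V E = \<lparr>
     obj = lists V,
     unit = [],
     tensor_obj = (@),
     hom = (\<lambda>u v. {t. arrow V u v t} // klr_rel V E),
     homog = (\<lambda>u v n. {t. arrow V u v t \<and> has_degree E n t} // klr_rel V E),
     ident = (\<lambda>u. klr_class V E (Ident u)),
     comp = (\<lambda>f g. \<Union>s \<in> f. \<Union>t \<in> g. klr_class V E (s \<boxdot> t)),
     tensor = (\<lambda>f g. \<Union>s \<in> f. \<Union>t \<in> g. klr_class V E (s \<boxtimes> t)),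
     zero = (\<lambda>u v. klr_class V E (Null u v)),
     add = (\<lambda>f g. \<Union>s \<in> f. \<Union>t \<in> g. klr_class V E (s \<boxplus> t)),
     scale = (\<lambda>c f. \<Union>s \<in> f. klr_class V E (c \<bullet> s)) \<rparr>"

definition klr_dot :: "'v set \<Rightarrow> ('v \<times> 'v) set \<Rightarrow> 'v \<Rightarrow> 'v diagram set" where
  "klr_dot V E i = klr_class V E (Dot i)"

definition klr_cross :: "'v set \<Rightarrow> ('v \<times> 'v) set \<Rightarrow> 'v \<Rightarrow> 'v \<Rightarrow> 'v diagram set" where
  "klr_cross V E i j = klr_class V E (Cross i j)"

text \<open>The dots \<open>x\<^sub>1\<close> and \<open>x\<^sub>2\<close> on the object \<open>[i, j]\<close>.\<close>

definition klr_dot1 :: "'v set \<Rightarrow> ('v \<times> 'v) set \<Rightarrow> 'v \<Rightarrow> 'v \<Rightarrow> 'v diagram set" where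
  "klr_dot1 V E i j = klr_dot V E i \<otimes>\<^bsub>KLR V E\<^esub> ident (KLR V E) [j]"

definition klr_dot2 :: "'v set \<Rightarrow> ('v \<times> 'v) set \<Rightarrow> 'v \<Rightarrow> 'v \<Rightarrow> 'v diagram set" where
  "klr_dot2 V E i j = ident (KLR V E) [i] \<otimes>\<^bsub>KLR V E\<^esub> klr_dot V E j"

definition d_on_generators ::
  "'v set \<Rightarrow> ('v \<times> 'v) set \<Rightarrow> ('v diagram set \<Rightarrow> 'v diagram set) \<Rightarrow> bool" where
  "d_on_generators V E d \<longleftrightarrow>
     (let U = KLR V E; x = klr_dot V E; x1 = klr_dot1 V E; x2 = klr_dot2 V E; \<psi> = klr_cross V E in
       (\<forall>i \<in> V. d (x i) = x i \<odot>\<^bsub>U\<^esub> x i) \<and>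
       (\<forall>i \<in> V. d (\<psi> i i) =
          (- 1) \<cdot>\<^bsub>U\<^esub> (x1 i i \<odot>\<^bsub>U\<^esub> \<psi> i i) \<oplus>\<^bsub>U\<^esub> (- 1) \<cdot>\<^bsub>U\<^esub> (\<psi> i i \<odot>\<^bsub>U\<^esub> x2 i i)) \<and>
       (\<forall>i \<in> V. \<forall>j \<in> V. adjacent E i j \<longrightarrow> d (\<psi> i j) = x1 j i \<odot>\<^bsub>U\<^esub> \<psi> i j) \<and>
       (\<forall>i \<in> V. \<forall>j \<in> V. i \<noteq> j \<and> \<not> adjacent E i j \<longrightarrow> d (\<psi> i j) = zero U [i, j] [j, i]))"

definition z_on_generators ::
  "'v set \<Rightarrow> ('v \<times> 'v) set \<Rightarrow> ('v diagram set \<Rightarrow> 'v diagram set) \<Rightarrow> bool" where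
  "z_on_generators V E z \<longleftrightarrow>
     (\<forall>i \<in> V. z (klr_dot V E i) = ident (KLR V E) [i]) \<and>
     (\<forall>i \<in> V. \<forall>j \<in> V. z (klr_cross V E i j) = zero (KLR V E) [i, j] [j, i])"

definition degree_operator :: "('o, 'm) moncat \<Rightarrow> ('m \<Rightarrow> 'm) \<Rightarrow> bool" where
  "degree_operator C h \<longleftrightarrow> linear_operator C h \<and>
     (\<forall>u \<in> obj C. \<forall>v \<in> obj C. \<forall>n. \<forall>f \<in> homog C u v n. h f = n \<cdot>\<^bsub>C\<^esub> f)"


section \<open>The quotient is a linear strict monoidal category\<close>

primrec src :: "'v diagram \<Rightarrow> 'v list" where
  "src (Ident u) = u"
| "src (Dot i) = [i]"
| "src (Cross i j) = [i, j]"
| "src (Null u v) = u"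
| "src (s \<boxplus> t) = src s"
| "src (c \<bullet> s) = src s"
| "src (s \<boxdot> t) = src t"
| "src (s \<boxtimes> t) = src s @ src t"

primrec tgt :: "'v diagram \<Rightarrow> 'v list" where
  "tgt (Ident u) = u"
| "tgt (Dot i) = [i]"
| "tgt (Cross i j) = [j, i]"
| "tgt (Null u v) = v"
| "tgt (s \<boxplus> t) = tgt s"
| "tgt (c \<bullet> s) = tgt s"
| "tgt (s \<boxdot> t) = tgt s"
| "tgt (s \<boxtimes> t) = tgt s @ tgt t"

primrec typed :: "'v set \<Rightarrow> 'v diagram \<Rightarrow> bool" where
  "typed V (Ident u) \<longleftrightarrow> u \<in> lists V"
| "typed V (Dot i) \<longleftrightarrow> i \<in> V"
| "typed V (Cross i j) \<longleftrightarrow> i \<in> V \<and> j \<in> V"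
| "typed V (Null u v) \<longleftrightarrow> u \<in> lists V \<and> v \<in> lists V"
| "typed V (s \<boxplus> t) \<longleftrightarrow> typed V s \<and> typed V t \<and> src s = src t \<and> tgt s = tgt t"
| "typed V (c \<bullet> s) \<longleftrightarrow> typed V s"
| "typed V (s \<boxdot> t) \<longleftrightarrow> typed V s \<and> typed V t \<and> src s = tgt t"
| "typed V (s \<boxtimes> t) \<longleftrightarrow> typed V s \<and> typed V t"

lemma arrow_if_typed: "typed V t \<Longrightarrow> arrow V (src t) (tgt t) t"
proof (induction t)
  case (Plus s t)
  then show ?case by (auto intro!: arrow.intros(5))
next
  case (Comp s t)
  then show ?case by (auto intro!: arrow.intros(7))
qed (auto intro: arrow.intros)

lemma arrow_iff: "arrow V u v t \<longleftrightarrow> typed V t \<and> src t = u \<and> tgt t = v"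
proof
  assume "arrow V u v t"
  then show "typed V t \<and> src t = u \<and> tgt t = v" by induction auto
qed (use arrow_if_typed in auto)

lemma typed_lists [simp]: "typed V t \<Longrightarrow> src t \<in> lists V" "typed V t \<Longrightarrow> tgt t \<in> lists V"
  by (induction t) auto

lemma klr_eq_typed:
  assumes "klr_eq V E u v s t"
  shows "typed V s \<and> typed V t \<and> src s = u \<and> src t = u \<and> tgt s = v \<and> tgt t = v"
  using assms by induction (auto simp: arrow_iff)

lemma klr_eq_refl: "typed V s \<Longrightarrow> klr_eq V E (src s) (tgt s) s s"
  by (auto intro: klr_eq.refl simp: arrow_iff)

lemma klr_class_elem:
  assumes "typed V s"
  shows "t \<in> klr_class V E s \<longleftrightarrow> klr_eq V E (src s) (tgt s) s t"
  unfolding klr_class_def klr_rel_def by (auto dest: klr_eq_typed)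

lemma klr_class_eqI:
  assumes "klr_eq V E u v s t"
  shows "klr_class V E s = klr_class V E t"
proof -
  have "klr_eq V E u v s r \<longleftrightarrow> klr_eq V E u v t r" for r
    using klr_eq.trans[OF assms] klr_eq.trans[OF klr_eq.sym[OF assms]] by blast
  then show ?thesis
    using klr_eq_typed[OF assms] by (auto simp: klr_class_elem)
qed

lemma klr_class_eqD:
  assumes "klr_class V E s = klr_class V E t" "typed V s" "typed V t"
  shows "klr_eq V E (src s) (tgt s) s t"
  using assms klr_class_elem[of V s t E] klr_class_elem[of V t t E] klr_eq_refl[of V t E] by simp

lemma hom_KLR:
  "f \<in> hom (KLR V E) u v \<longleftrightarrow> (\<exists>t. typed V t \<and> src t = u \<and> tgt t = v \<and> f = klr_class V E t)"
  unfolding KLR_def klr_class_def quotient_def arrow_iff by auto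

lemma KLR_simps [simp]:
  "obj (KLR V E) = lists V" "unit (KLR V E) = []" "tensor_obj (KLR V E) u v = u @ v"
  "ident (KLR V E) u = klr_class V E (Ident u)" "zero (KLR V E) u v = klr_class V E (Null u v)"
  unfolding KLR_def by auto

lemma UN_klr_class:
  assumes "typed V s" "\<And>s'. klr_eq V E (src s) (tgt s) s s' \<Longrightarrow> F s' = F s"
  shows "(\<Union>s' \<in> klr_class V E s. F s') = F s"
proof -
  have "(\<Union>s' \<in> klr_class V E s. F s') = (\<Union>s' \<in> klr_class V E s. F s)"
    using assms(2) by (intro SUP_cong HOL.refl) (simp only: klr_class_elem[OF assms(1)])
  also have "\<dots> = F s"
    using klr_eq_refl[OF assms(1)] klr_class_elem[OF assms(1)] by blast
  finally show ?thesis .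
qed

lemma UN2_klr_class:
  assumes "typed V s" "typed V t"
    and "\<And>s' t'. klr_eq V E (src s) (tgt s) s s' \<Longrightarrow> klr_eq V E (src t) (tgt t) t t' \<Longrightarrow> F s' t' = F s t"
  shows "(\<Union>s' \<in> klr_class V E s. \<Union>t' \<in> klr_class V E t. F s' t') = F s t"
proof -
  have "(\<Union>t' \<in> klr_class V E t. F s' t') = F s t" if "klr_eq V E (src s) (tgt s) s s'" for s'
  proof -
    have "(\<Union>t' \<in> klr_class V E t. F s' t') = F s' t"
      by (rule UN_klr_class[OF assms(2)])
        (simp add: assms(3)[OF that] assms(3)[OF that klr_eq_refl[OF assms(2)]])
    then show ?thesis
      by (simp add: assms(3)[OF that klr_eq_refl[OF assms(2)]])
  qed
  then show ?thesis
    using klr_eq_refl[OF assms(1)] by (subst UN_klr_class[OF assms(1)]) simp_all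
qed

lemma KLR_comp [simp]:
  assumes "typed V s" "typed V t" "src s = tgt t"
  shows "klr_class V E s \<odot>\<^bsub>KLR V E\<^esub> klr_class V E t = klr_class V E (s \<boxdot> t)"
  unfolding KLR_def moncat.simps
  by (rule UN2_klr_class[OF assms(1,2)])
    (rule klr_class_eqI[symmetric], rule klr_eq.Comp_cong, assumption, simp add: assms(3))

lemma KLR_tensor [simp]:
  assumes "typed V s" "typed V t"
  shows "klr_class V E s \<otimes>\<^bsub>KLR V E\<^esub> klr_class V E t = klr_class V E (s \<boxtimes> t)"
  unfolding KLR_def moncat.simps
  by (rule UN2_klr_class[OF assms]) (rule klr_class_eqI[symmetric], rule klr_eq.Tensor_cong)

lemma KLR_add [simp]:
  assumes "typed V s" "typed V t" "src s = src t" "tgt s = tgt t"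
  shows "klr_class V E s \<oplus>\<^bsub>KLR V E\<^esub> klr_class V E t = klr_class V E (s \<boxplus> t)"
  unfolding KLR_def moncat.simps
  by (rule UN2_klr_class[OF assms(1,2)])
    (rule klr_class_eqI[symmetric], rule klr_eq.Plus_cong, assumption, simp add: assms(3,4))

lemma KLR_scale [simp]:
  assumes "typed V s"
  shows "c \<cdot>\<^bsub>KLR V E\<^esub> klr_class V E s = klr_class V E (c \<bullet> s)"
  unfolding KLR_def moncat.simps
  by (rule UN_klr_class[OF assms]) (rule klr_class_eqI[symmetric], rule klr_eq.Scale_cong)

lemma klr_class_hom [simp]:
  assumes "typed V t"
  shows "klr_class V E t \<in> hom (KLR V E) u v \<longleftrightarrow> src t = u \<and> tgt t = v"
  using assms by (auto simp: hom_KLR dest!: klr_class_eqD dest: klr_eq_typed)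

lemma hom_KLR_E:
  assumes "f \<in> hom (KLR V E) u v"
  obtains t where "typed V t" "src t = u" "tgt t = v" "f = klr_class V E t"
  using assms unfolding hom_KLR by auto

lemmas klr_axioms = klr_eq.Plus_assoc klr_eq.Plus_comm klr_eq.Plus_Null klr_eq.Plus_inverse
  klr_eq.Scale_one klr_eq.Scale_Scale klr_eq.Scale_left klr_eq.Scale_right
  klr_eq.Comp_assoc klr_eq.Comp_Ident_left klr_eq.Comp_Ident_right
  klr_eq.Comp_Plus_left klr_eq.Comp_Plus_right klr_eq.Comp_Scale_left klr_eq.Comp_Scale_right
  klr_eq.Tensor_assoc klr_eq.Tensor_unit_left klr_eq.Tensor_unit_right klr_eq.Tensor_Ident
  klr_eq.Interchange klr_eq.Tensor_Plus_left klr_eq.Tensor_Plus_right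
  klr_eq.Tensor_Scale_left klr_eq.Tensor_Scale_right

theorem linear_monoidal_category_KLR: "linear_monoidal_category (KLR V E)"
proof
  fix f u v u' v' assume "f \<in> hom (KLR V E) u v" "f \<in> hom (KLR V E) u' v'"
  then show "u = u' \<and> v = v'"
    by (elim hom_KLR_E) (auto dest!: klr_class_eqD klr_eq_typed)
next
  fix u v n show "homog (KLR V E) u v n \<subseteq> hom (KLR V E) u v"
    unfolding KLR_def quotient_def by auto
next
  fix u v assume "u \<in> obj (KLR V E)" "v \<in> obj (KLR V E)"
  then show "ident (KLR V E) u \<otimes>\<^bsub>KLR V E\<^esub> ident (KLR V E) v =
      ident (KLR V E) (tensor_obj (KLR V E) u v)"
    using klr_class_eqI[OF klr_eq.Tensor_Ident, of u V v E] by simp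
qed (clarsimp elim!: hom_KLR_E; (simp; fail)?; rule klr_axioms[THEN klr_class_eqI]; simp add: arrow_iff)+

end

theory Submission
  imports Defs
begin

text \<open>
  An operator \<open>d\<close> together with divided powers \<open>d\<^sup>(\<^sup>k\<^sup>)\<close> is the same as its exponential
  \<open>exp (t d) = \<Sum>k. t\<^sup>k d\<^sup>(\<^sup>k\<^sup>)\<close>, and \<open>d\<close> satisfies both Leibniz rules when the exponential is
  compatible with composition and tensor product. So the exponentials of \<open>d\<close> and \<open>z\<close> are constructed
  directly, as monoidal functors from \<open>KLR V E\<close> to the category of formal power series in \<open>t\<close> with
  coefficients in \<open>KLR V E\<close>; the divided powers are their coefficients, and no factorial is ever divided by.

  A functor out of a category given by generators and relations is a choice of images of the generators
  that satisfies the relations (\<open>ev_cong\<close>). Put \<open>g = 1 - t x\<close> and \<open>q = 1 / (1 - t x)\<close>. The prescribed values of \<open>d\<close>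
  integrate to \<open>x \<mapsto> x q\<close>, to \<open>\<psi>\<^sub>i\<^sub>j \<mapsto> q\<^sub>1 \<psi>\<^sub>i\<^sub>j\<close> for adjacent colours, to \<open>\<psi>\<^sub>i\<^sub>i \<mapsto> g\<^sub>1 \<psi>\<^sub>i\<^sub>i g\<^sub>2\<close>, and leave the other
  crossings fixed; those of \<open>z\<close> integrate to \<open>x \<mapsto> x + t\<close> with all crossings fixed. That the first images
  satisfy the relations is \<open>klr_model_deformed\<close>, the computational heart of the proof: everything slides
  through crossings of distinct colours, and for equal colours \<open>\<psi> g\<^sub>2 = g\<^sub>1 \<psi> + t\<close>. For the second images it is
  \<open>klr_model_translated\<close>.

  The law \<open>d\<^sup>(\<^sup>k\<^sup>) d\<^sup>(\<^sup>l\<^sup>) = (k + l choose k) d\<^sup>(\<^sup>k\<^sup>+\<^sup>l\<^sup>)\<close> says that the exponentials for \<open>s\<close> and \<open>t\<close> compose to the one for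
  \<open>s + t\<close>. The set of morphisms that satisfy it is closed under composition and tensor product because the
  substitution of \<open>s + t\<close> for \<open>t\<close> is multiplicative (\<open>cau2_spread\<close>), so the law is checked on generators only.

  Finally \<open>h\<close> is defined as the commutator \<open>z d - d z\<close>. It is a derivation that multiplies each generator by
  its degree, so it multiplies every homogeneous morphism by its degree. Derivations that agree on the
  generators are equal (\<open>derivation_KLR_eqI\<close>); this gives the uniqueness of \<open>d\<close> and \<open>z\<close> and reduces the relations
  of \<open>\<ss>\<ll>\<^sub>2\<close> to generators. The operator \<open>h\<close> is unique because every morphism is a sum of homogeneous ones.
\<close>


section \<open>Formal power series with coefficients in abelian groups\<close>

text \<open>
  An abelian group carried by a set, with its action of the integers. Morphism spaces of a
  category are of this kind. The zero element is written \<open>0 \<star> b\<close>, for any \<open>b\<close> in the group, so that no separate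
  constant depends on the source and target of a morphism.
\<close>

locale int_module =
  fixes A :: "'m set" and addm :: "'m \<Rightarrow> 'm \<Rightarrow> 'm" (infixl \<open>\<uplus>\<close> 65)
    and smul :: "int \<Rightarrow> 'm \<Rightarrow> 'm" (infixr \<open>\<star>\<close> 68)
  assumes plus_closed: "a \<in> A \<Longrightarrow> b \<in> A \<Longrightarrow> a \<uplus> b \<in> A"
    and smul_closed: "a \<in> A \<Longrightarrow> m \<star> a \<in> A"
    and plus_assoc: "a \<in> A \<Longrightarrow> b \<in> A \<Longrightarrow> c \<in> A \<Longrightarrow> (a \<uplus> b) \<uplus> c = a \<uplus> (b \<uplus> c)"
    and plus_comm: "a \<in> A \<Longrightarrow> b \<in> A \<Longrightarrow> a \<uplus> b = b \<uplus> a"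
    and plus_zero: "a \<in> A \<Longrightarrow> b \<in> A \<Longrightarrow> a \<uplus> 0 \<star> b = a"
    and smul_one: "a \<in> A \<Longrightarrow> 1 \<star> a = a"
    and smul_smul: "a \<in> A \<Longrightarrow> m \<star> n \<star> a = (m * n) \<star> a"
    and smul_left: "a \<in> A \<Longrightarrow> (m + n) \<star> a = m \<star> a \<uplus> n \<star> a"
    and smul_right: "a \<in> A \<Longrightarrow> b \<in> A \<Longrightarrow> m \<star> (a \<uplus> b) = m \<star> a \<uplus> m \<star> b"
begin

lemma plus_left_comm: "a \<in> A \<Longrightarrow> b \<in> A \<Longrightarrow> c \<in> A \<Longrightarrow> a \<uplus> (b \<uplus> c) = b \<uplus> (a \<uplus> c)"
  by (metis plus_assoc plus_comm)

lemma zero_unique: "a \<in> A \<Longrightarrow> b \<in> A \<Longrightarrow> 0 \<star> a = 0 \<star> b"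
  by (metis plus_comm plus_zero smul_closed)

lemma zero_plus: "a \<in> A \<Longrightarrow> b \<in> A \<Longrightarrow> 0 \<star> b \<uplus> a = a"
  by (metis plus_comm plus_zero smul_closed)

end

definition sequences :: "'m set \<Rightarrow> (nat \<Rightarrow> 'm) set" where
  "sequences A = {f. \<forall>k. f k \<in> A}"

abbreviation (input) pointwise_plus :: "('m \<Rightarrow> 'm \<Rightarrow> 'm) \<Rightarrow> (nat \<Rightarrow> 'm) \<Rightarrow> (nat \<Rightarrow> 'm) \<Rightarrow> nat \<Rightarrow> 'm" where
  "pointwise_plus addm f g \<equiv> (\<lambda>k. addm (f k) (g k))"

abbreviation (input) pointwise_smul :: "(int \<Rightarrow> 'm \<Rightarrow> 'm) \<Rightarrow> int \<Rightarrow> (nat \<Rightarrow> 'm) \<Rightarrow> nat \<Rightarrow> 'm" where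
  "pointwise_smul smul c f \<equiv> (\<lambda>k. smul c (f k))"

text \<open>
  A power series is the sequence of its coefficients. The operation below multiplies it by the
  variable; the coefficient \<open>smul 0 (f 0)\<close> is the zero of the group of \<open>f\<close>.
\<close>

definition t_times :: "(int \<Rightarrow> 'm \<Rightarrow> 'm) \<Rightarrow> (nat \<Rightarrow> 'm) \<Rightarrow> nat \<Rightarrow> 'm" where
  "t_times smul f = (\<lambda>k. case k of 0 \<Rightarrow> smul 0 (f 0) | Suc k \<Rightarrow> f k)"

definition const_series :: "(int \<Rightarrow> 'm \<Rightarrow> 'm) \<Rightarrow> 'm \<Rightarrow> nat \<Rightarrow> 'm" where
  "const_series smul a = (\<lambda>k. case k of 0 \<Rightarrow> a | Suc _ \<Rightarrow> smul 0 a)"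

abbreviation (input) tail :: "(nat \<Rightarrow> 'm) \<Rightarrow> nat \<Rightarrow> 'm" where
  "tail f \<equiv> (\<lambda>k. f (Suc k))"

text \<open>
  The coefficients of the Cauchy product \<open>f g\<close>, computed from \<open>f g = (tail f) g t + f\<^sub>0 g\<close>. This recursion
  uses a binary addition only, so it makes sense in every abelian group with a carrier set.
\<close>

primrec cauchy :: "('m \<Rightarrow> 'm \<Rightarrow> 'm) \<Rightarrow> ('m \<Rightarrow> 'm \<Rightarrow> 'm) \<Rightarrow> (nat \<Rightarrow> 'm) \<Rightarrow> (nat \<Rightarrow> 'm) \<Rightarrow> nat \<Rightarrow> 'm" where
  "cauchy addm op f g 0 = op (f 0) (g 0)"
| "cauchy addm op f g (Suc n) = addm (cauchy addm op (tail f) g n) (op (f 0) (g (Suc n)))"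

lemma t_times_const_series_simps [simp]:
  "t_times smul f 0 = smul 0 (f 0)" "t_times smul f (Suc k) = f k"
  "const_series smul a 0 = a" "const_series smul a (Suc k) = smul 0 a"
  by (auto simp: t_times_def const_series_def)

lemma sequencesI: "(\<And>k. f k \<in> A) \<Longrightarrow> f \<in> sequences A"
  and sequencesD: "f \<in> sequences A \<Longrightarrow> f k \<in> A"
  by (auto simp: sequences_def)

lemma sequences_tail [simp]: "f \<in> sequences A \<Longrightarrow> tail f \<in> sequences A"
  by (auto simp: sequences_def)

context int_module begin

lemma int_module_sequences: "int_module (sequences A) (pointwise_plus addm) (pointwise_smul smul)"
proof
  fix f g assume "f \<in> sequences A" "g \<in> sequences A"
  then show "pointwise_plus addm f g = pointwise_plus addm g f"
    by (simp add: fun_eq_iff sequencesD plus_comm)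
qed (simp_all add: sequences_def fun_eq_iff plus_closed smul_closed plus_assoc plus_zero smul_one
  smul_smul smul_left smul_right)

lemma t_times_closed: "f \<in> sequences A \<Longrightarrow> t_times smul f \<in> sequences A"
  by (auto simp: sequences_def t_times_def smul_closed split: nat.split)

lemma const_series_closed: "a \<in> A \<Longrightarrow> const_series smul a \<in> sequences A"
  by (auto simp: sequences_def const_series_def smul_closed split: nat.split)

lemma sequence_split:
  assumes "f \<in> sequences A"
  shows "f = pointwise_plus addm (const_series smul (f 0)) (t_times smul (tail f))"
proof
  fix k show "f k = pointwise_plus addm (const_series smul (f 0)) (t_times smul (tail f)) k"
    using sequencesD[OF assms] by (cases k) (auto simp: plus_zero zero_plus)
qed

end

text \<open>
  Additive and compatible with multiplication by the variable.
\<close>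

definition t_linear where
  "t_linear addm smul A B L \<longleftrightarrow>
     (\<forall>f \<in> sequences A. L f \<in> sequences B \<and> L (t_times smul f) = t_times smul (L f) \<and>
       (\<forall>g \<in> sequences A. L (pointwise_plus addm f g) = pointwise_plus addm (L f) (L g)))"

lemma t_linear_comp:
  "t_linear addm smul A B L \<Longrightarrow> t_linear addm smul B D M \<Longrightarrow> t_linear addm smul A D (\<lambda>f. M (L f))"
  by (auto simp: t_linear_def)

lemma t_linear_closed: "t_linear addm smul A B L \<Longrightarrow> f \<in> sequences A \<Longrightarrow> L f \<in> sequences B"
  by (auto simp: t_linear_def)

text \<open>
  Since \<open>f = f\<^sub>0 + t (tail f)\<close>, the coefficient \<open>n + 1\<close> of \<open>L f\<close> is determined by \<open>L f\<^sub>0\<close> and by the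
  coefficient \<open>n\<close> of \<open>L (tail f)\<close>. This principle reduces multilinear identities for power
  series to constant series.
\<close>

lemma t_linear_eqI:
  assumes A: "int_module A addm smul" and L: "t_linear addm smul A B L" and M: "t_linear addm smul A B M"
    and const: "\<And>a. a \<in> A \<Longrightarrow> L (const_series smul a) = M (const_series smul a)"
    and f: "f \<in> sequences A" and B: "int_module B addm smul"
  shows "L f = M f"
proof -
  interpret A: int_module A addm smul by (rule A)
  interpret B: int_module B addm smul by (rule B)
  have split: "K f n = addm (K (const_series smul (f 0)) n) (t_times smul (K (tail f)) n)"
    if K: "t_linear addm smul A B K" and f: "f \<in> sequences A" for K f n
  proof -
    have "K (pointwise_plus addm (const_series smul (f 0)) (t_times smul (tail f))) =
        pointwise_plus addm (K (const_series smul (f 0))) (t_times smul (K (tail f)))"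
      using K A.const_series_closed[OF sequencesD[OF f]] A.t_times_closed[OF sequences_tail[OF f]]
        sequences_tail[OF f]
      unfolding t_linear_def by metis
    then show ?thesis
      unfolding A.sequence_split[OF f, symmetric] by simp
  qed
  have "L f n = M f n" for n
    using f
  proof (induction n arbitrary: f)
    case (0 f)
    have "L (tail f) 0 \<in> B" "M (tail f) 0 \<in> B"
      by (rule sequencesD[OF t_linear_closed[OF L sequences_tail[OF 0]]], rule sequencesD[OF t_linear_closed[OF M sequences_tail[OF 0]]])
    then show ?case
      unfolding split[OF L 0] split[OF M 0]
      by (simp add: const[OF sequencesD[OF 0]] B.zero_unique[of "L (tail f) 0" "M (tail f) 0"])
  next
    case (Suc n f)
    show ?case
      unfolding split[OF L Suc.prems] split[OF M Suc.prems]
      by (simp add: const[OF sequencesD[OF Suc.prems]] Suc.IH[OF sequences_tail[OF Suc.prems]])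
  qed
  then show ?thesis by (simp add: fun_eq_iff)
qed

locale bilinear_operation =
  A: int_module A addm smul + B: int_module B addm smul + H: int_module H addm smul
  for A B H :: "'m set" and addm (infixl \<open>\<uplus>\<close> 65) and smul (infixr \<open>\<star>\<close> 68) +
  fixes op :: "'m \<Rightarrow> 'm \<Rightarrow> 'm"
  assumes op_closed: "a \<in> A \<Longrightarrow> b \<in> B \<Longrightarrow> op a b \<in> H"
    and op_plus_left: "a \<in> A \<Longrightarrow> a' \<in> A \<Longrightarrow> b \<in> B \<Longrightarrow> op (a \<uplus> a') b = op a b \<uplus> op a' b"
    and op_plus_right: "a \<in> A \<Longrightarrow> b \<in> B \<Longrightarrow> b' \<in> B \<Longrightarrow> op a (b \<uplus> b') = op a b \<uplus> op a b'"
    and op_smul_left: "a \<in> A \<Longrightarrow> b \<in> B \<Longrightarrow> op (m \<star> a) b = m \<star> op a b"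
    and op_smul_right: "a \<in> A \<Longrightarrow> b \<in> B \<Longrightarrow> op a (m \<star> b) = m \<star> op a b"
begin

abbreviation "cau \<equiv> cauchy addm op"

lemma cauchy_closed:
  assumes "f \<in> sequences A" "g \<in> sequences B"
  shows "cau f g n \<in> H"
  using assms
  by (induction n arbitrary: f) (auto simp: op_closed H.plus_closed sequencesD)

lemma cauchy_plus_left:
  assumes "f \<in> sequences A" "f' \<in> sequences A" "g \<in> sequences B"
  shows "cau (pointwise_plus addm f f') g n = cau f g n \<uplus> cau f' g n"
  using assms
proof (induction n arbitrary: f f')
  case 0
  then show ?case by (simp add: op_plus_left sequencesD)
next
  case (Suc n)
  then show ?case using Suc
    by (simp add: op_plus_left op_closed sequencesD cauchy_closed H.plus_closed H.plus_assoc H.plus_left_comm)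
qed

lemma cauchy_plus_right:
  assumes "f \<in> sequences A" "g \<in> sequences B" "g' \<in> sequences B"
  shows "cau f (pointwise_plus addm g g') n = cau f g n \<uplus> cau f g' n"
  using assms
proof (induction n arbitrary: f)
  case 0
  then show ?case by (simp add: op_plus_right sequencesD)
next
  case (Suc n)
  then show ?case
    by (simp add: op_plus_right op_closed sequencesD cauchy_closed H.plus_closed H.plus_assoc H.plus_left_comm)
qed

lemma cauchy_smul_left:
  assumes "f \<in> sequences A" "g \<in> sequences B"
  shows "cau (pointwise_smul smul c f) g n = c \<star> cau f g n"
  using assms
proof (induction n arbitrary: f)
  case 0
  then show ?case by (simp add: op_smul_left sequencesD)
next
  case (Suc n)
  then show ?case using Suc
    by (simp add: op_smul_left op_closed sequencesD cauchy_closed H.smul_right)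
qed

lemma cauchy_smul_right:
  assumes "f \<in> sequences A" "g \<in> sequences B"
  shows "cau f (pointwise_smul smul c g) n = c \<star> cau f g n"
  using assms
  by (induction n arbitrary: f)
    (simp_all add: op_smul_right op_closed sequencesD cauchy_closed H.smul_right)

lemma bilinear_operation_cauchy:
  "bilinear_operation (sequences A) (sequences B) (sequences H)
     (pointwise_plus addm) (pointwise_smul smul) cau"
  using A.int_module_sequences B.int_module_sequences H.int_module_sequences
  by (auto simp: bilinear_operation_def bilinear_operation_axioms_def fun_eq_iff
      cauchy_plus_left cauchy_plus_right cauchy_smul_left cauchy_smul_right intro!: sequencesI cauchy_closed)

lemma cauchy_t_times_left:
  assumes "f \<in> sequences A" "g \<in> sequences B"
  shows "cau (t_times smul f) g = t_times smul (cau f g)"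
proof
  fix n
  have "tail (t_times smul f) = f" by (auto simp: fun_eq_iff)
  then show "cau (t_times smul f) g n = t_times smul (cau f g) n"
    using assms
    by (cases n) (simp_all add: op_smul_left sequencesD H.plus_zero op_closed cauchy_closed)
qed

lemma cauchy_t_times_right:
  assumes "f \<in> sequences A" "g \<in> sequences B"
  shows "cau f (t_times smul g) = t_times smul (cau f g)"
proof
  fix n show "cau f (t_times smul g) n = t_times smul (cau f g) n"
    using assms
  proof (induction n arbitrary: f)
    case 0
    then show ?case by (simp add: op_smul_right sequencesD)
  next
    case (Suc n)
    have "cau f (t_times smul g) (Suc n) = t_times smul (cau (tail f) g) n \<uplus> op (f 0) (g n)"
      using Suc by simp
    with Suc.prems show ?case
      by (cases n) (simp_all add: op_closed sequencesD H.zero_plus)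
  qed
qed

lemma cauchy_constant_left:
  assumes "a \<in> A" "g \<in> sequences B"
  shows "cau (const_series smul a) g = (\<lambda>k. op a (g k))"
proof
  have z: "cau (\<lambda>k. 0 \<star> a) g n = 0 \<star> op a (g 0)" for n
  proof (induction n)
    case 0
    then show ?case using assms by (simp add: op_smul_left sequencesD)
  next
    case (Suc n)
    moreover have "tail (\<lambda>k. 0 \<star> a) = (\<lambda>k. 0 \<star> a)" by (auto simp: fun_eq_iff)
    ultimately show ?case using assms
      by (simp add: op_smul_left sequencesD H.plus_zero op_closed H.smul_closed)
  qed
  fix n
  have "tail (const_series smul a) = (\<lambda>k. 0 \<star> a)" by (auto simp: fun_eq_iff)
  then show "cau (const_series smul a) g n = op a (g n)"
    using assms by (cases n) (simp_all add: z op_closed sequencesD H.zero_plus)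
qed

lemma cauchy_constant_right:
  assumes "f \<in> sequences A" "b \<in> B"
  shows "cau f (const_series smul b) = (\<lambda>k. op (f k) b)"
proof
  fix n show "cau f (const_series smul b) n = op (f n) b"
    using assms
  proof (induction n arbitrary: f)
    case 0
    then show ?case by simp
  next
    case (Suc n)
    then show ?case by (simp add: op_smul_right op_closed sequencesD H.plus_zero)
  qed
qed

lemma cauchy_constant:
  assumes "a \<in> A" "b \<in> B"
  shows "cau (const_series smul a) (const_series smul b) = const_series smul (op a b)"
  using assms
  by (simp add: cauchy_constant_left B.const_series_closed)
    (simp add: const_series_def fun_eq_iff op_smul_right split: nat.split)

lemma t_linear_left: "g \<in> sequences B \<Longrightarrow> t_linear addm smul A H (\<lambda>f. cau f g)"
  by (auto simp: t_linear_def cauchy_t_times_left fun_eq_iff cauchy_plus_left intro!: sequencesI cauchy_closed)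

lemma t_linear_right: "f \<in> sequences A \<Longrightarrow> t_linear addm smul B H (\<lambda>g. cau f g)"
  by (auto simp: t_linear_def cauchy_t_times_right fun_eq_iff cauchy_plus_right intro!: sequencesI cauchy_closed)

lemma cauchy_sequences: "f \<in> sequences A \<Longrightarrow> g \<in> sequences B \<Longrightarrow> cau f g \<in> sequences H"
  by (rule sequencesI) (rule cauchy_closed)

end

lemma cauchy_assoc:
  assumes 1: "bilinear_operation A B AB addm smul o1" and 2: "bilinear_operation AB D H addm smul o2"
    and 3: "bilinear_operation B D BD addm smul o3" and 4: "bilinear_operation A BD H addm smul o4"
    and assoc: "\<And>a b d. a \<in> A \<Longrightarrow> b \<in> B \<Longrightarrow> d \<in> D \<Longrightarrow> o2 (o1 a b) d = o4 a (o3 b d)"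
    and f: "f \<in> sequences A" and g: "g \<in> sequences B" and h: "h \<in> sequences D"
  shows "cauchy addm o2 (cauchy addm o1 f g) h = cauchy addm o4 f (cauchy addm o3 g h)"
proof -
  interpret o1: bilinear_operation A B AB addm smul o1 by (rule 1)
  interpret o2: bilinear_operation AB D H addm smul o2 by (rule 2)
  interpret o3: bilinear_operation B D BD addm smul o3 by (rule 3)
  interpret o4: bilinear_operation A BD H addm smul o4 by (rule 4)
  let ?c = "const_series smul"
  have ccc: "cauchy addm o2 (cauchy addm o1 (?c a) (?c b)) (?c d) =
      cauchy addm o4 (?c a) (cauchy addm o3 (?c b) (?c d))"
    if "a \<in> A" "b \<in> B" "d \<in> D" for a b d
    using that by (simp add: o1.cauchy_constant o2.cauchy_constant o3.cauchy_constant o4.cauchy_constant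
      o1.op_closed o3.op_closed assoc)
  have cc: "cauchy addm o2 (cauchy addm o1 (?c a) (?c b)) h =
      cauchy addm o4 (?c a) (cauchy addm o3 (?c b) h)"
    if "a \<in> A" "b \<in> B" for a b
    using that ccc
    by (intro t_linear_eqI[OF o2.B.int_module_axioms o2.t_linear_right
      t_linear_comp[OF o3.t_linear_right o4.t_linear_right] _ h o2.H.int_module_axioms]
      o1.cauchy_sequences o1.A.const_series_closed o1.B.const_series_closed)
  have c: "cauchy addm o2 (cauchy addm o1 (?c a) g) h =
      cauchy addm o4 (?c a) (cauchy addm o3 g h)"
    if "a \<in> A" for a
    using that cc h
    by (intro t_linear_eqI[OF o1.B.int_module_axioms t_linear_comp[OF o1.t_linear_right o2.t_linear_left]
      t_linear_comp[OF o3.t_linear_left o4.t_linear_right] _ g o2.H.int_module_axioms]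
      o1.A.const_series_closed)
  show ?thesis
    using c h g
    by (intro t_linear_eqI[OF o1.A.int_module_axioms t_linear_comp[OF o1.t_linear_left o2.t_linear_left]
      o4.t_linear_left _ f o2.H.int_module_axioms] o3.cauchy_sequences)
qed

text \<open>
  Both sides are linear over power series in each argument, so the arguments are replaced by
  constants one after another.
\<close>

lemma cauchy_interchange:
  assumes p: "bilinear_operation A B AB addm smul p" and p': "bilinear_operation A' B' AB' addm smul p"
    and q: "bilinear_operation AB AB' H addm smul q"
    and r: "bilinear_operation A A' AA addm smul q" and r': "bilinear_operation B B' BB addm smul q"
    and s: "bilinear_operation AA BB H addm smul p"
    and ic: "\<And>a b a' b'. a \<in> A \<Longrightarrow> b \<in> B \<Longrightarrow> a' \<in> A' \<Longrightarrow> b' \<in> B' \<Longrightarrow> q (p a b) (p a' b') = p (q a a') (q b b')"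
    and f: "f \<in> sequences A" and g: "g \<in> sequences B" and f': "f' \<in> sequences A'" and g': "g' \<in> sequences B'"
  shows "cauchy addm q (cauchy addm p f g) (cauchy addm p f' g') =
    cauchy addm p (cauchy addm q f f') (cauchy addm q g g')"
proof -
  interpret p: bilinear_operation A B AB addm smul p by (rule p)
  interpret p': bilinear_operation A' B' AB' addm smul p by (rule p')
  interpret q: bilinear_operation AB AB' H addm smul q by (rule q)
  interpret r: bilinear_operation A A' AA addm smul q by (rule r)
  interpret r': bilinear_operation B B' BB addm smul q by (rule r')
  interpret s: bilinear_operation AA BB H addm smul p by (rule s)
  let ?c = "const_series smul" and ?p = "cauchy addm p" and ?q = "cauchy addm q"
  have 4: "?q (?p (?c a) (?c b)) (?p (?c a') (?c b')) = ?p (?q (?c a) (?c a')) (?q (?c b) (?c b'))"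
    if "a \<in> A" "b \<in> B" "a' \<in> A'" "b' \<in> B'" for a b a' b'
    using that by (simp add: p.cauchy_constant p'.cauchy_constant q.cauchy_constant r.cauchy_constant
      r'.cauchy_constant s.cauchy_constant p.op_closed p'.op_closed r.op_closed r'.op_closed ic)
  note closed = p.A.const_series_closed p.B.const_series_closed p'.A.const_series_closed p'.B.const_series_closed
    p.cauchy_sequences p'.cauchy_sequences r.cauchy_sequences r'.cauchy_sequences f g f' g'
  have 3: "?q (?p (?c a) (?c b)) (?p (?c a') g') = ?p (?q (?c a) (?c a')) (?q (?c b) g')"
    if "a \<in> A" "b \<in> B" "a' \<in> A'" for a b a'
    using that 4
    by (intro t_linear_eqI[OF p'.B.int_module_axioms t_linear_comp[OF p'.t_linear_right q.t_linear_right]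
      t_linear_comp[OF r'.t_linear_right s.t_linear_right] _ g' q.H.int_module_axioms] closed)
  have 2: "?q (?p (?c a) (?c b)) (?p f' g') = ?p (?q (?c a) f') (?q (?c b) g')"
    if "a \<in> A" "b \<in> B" for a b
    using that 3
    by (intro t_linear_eqI[OF p'.A.int_module_axioms t_linear_comp[OF p'.t_linear_left q.t_linear_right]
      t_linear_comp[OF r.t_linear_right s.t_linear_left] _ f' q.H.int_module_axioms] closed)
  have 1: "?q (?p (?c a) g) (?p f' g') = ?p (?q (?c a) f') (?q g g')"
    if "a \<in> A" for a
    using that 2
    by (intro t_linear_eqI[OF p.B.int_module_axioms t_linear_comp[OF p.t_linear_right q.t_linear_left]
      t_linear_comp[OF r'.t_linear_left s.t_linear_right] _ g q.H.int_module_axioms] closed)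
  show ?thesis
    using 1
    by (intro t_linear_eqI[OF p.A.int_module_axioms t_linear_comp[OF p.t_linear_left q.t_linear_left]
      t_linear_comp[OF r.t_linear_left s.t_linear_left] _ f q.H.int_module_axioms] closed)
qed

context linear_monoidal_category begin

lemma scale_zero: "f \<in> hom C u v \<Longrightarrow> 0 \<cdot> f = zero C u v"
  using scale_left[of f u v 1 "-1"] add_inverse[of f u v] scale_one[of f u v] by simp

lemma int_module_hom: "int_module (hom C u v) (add C) (scale C)"
proof
  fix a b assume "a \<in> hom C u v" "b \<in> hom C u v"
  then show "a \<oplus> 0 \<cdot> b = a"
    by (simp add: scale_zero add_zero)
qed (auto intro: add_hom scale_hom add_assoc add_comm scale_one scale_scale scale_left scale_right)

lemma bilinear_comp: "bilinear_operation (hom C v w) (hom C u v) (hom C u w) (add C) (scale C) (comp C)"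
  by (intro bilinear_operation.intro int_module_hom, unfold_locales)
    (auto intro: comp_hom comp_add comp_scale)

lemma bilinear_tensor: "bilinear_operation (hom C u v) (hom C u' v')
    (hom C (tensor_obj C u u') (tensor_obj C v v')) (add C) (scale C) (tensor C)"
  by (intro bilinear_operation.intro int_module_hom, unfold_locales)
    (auto intro: tensor_hom tensor_add tensor_scale)

end

section \<open>The category of power series over a linear monoidal category\<close>

definition series :: "('o, 'm) moncat \<Rightarrow> ('o, nat \<Rightarrow> 'm) moncat" where
  "series C = \<lparr>
     obj = obj C,
     unit = unit C,
     tensor_obj = tensor_obj C,
     hom = (\<lambda>u v. sequences (hom C u v)),
     homog = (\<lambda>u v n. sequences (homog C u v n)),
     ident = (\<lambda>u. const_series (scale C) (ident C u)),
     comp = cauchy (add C) (comp C),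
     tensor = cauchy (add C) (tensor C),
     zero = (\<lambda>u v k. zero C u v),
     add = pointwise_plus (add C),
     scale = pointwise_smul (scale C) \<rparr>"

lemma series_simps:
  "obj (series C) = obj C" "unit (series C) = unit C" "tensor_obj (series C) = tensor_obj C"
  "hom (series C) u v = sequences (hom C u v)" "ident (series C) u = const_series (scale C) (ident C u)"
  "homog (series C) u v n = sequences (homog C u v n)"
  "comp (series C) = cauchy (add C) (comp C)" "tensor (series C) = cauchy (add C) (tensor C)"
  "zero (series C) u v = (\<lambda>k. zero C u v)"
  "add (series C) = pointwise_plus (add C)" "scale (series C) = pointwise_smul (scale C)"
  by (simp_all add: series_def)

text \<open>
  The axioms for power series follow from those for coefficients: the bilinear ones by the laws of the
  Cauchy product, associativity and interchange by reduction to constant series.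
\<close>

theorem (in linear_monoidal_category) linear_monoidal_category_series:
  "linear_monoidal_category (series C)"
proof (unfold_locales, unfold series_simps)
  fix u v u' v' f assume "f \<in> sequences (hom C u v)"
  then show "u \<in> obj C \<and> v \<in> obj C" using hom_obj unfolding sequences_def by blast
  assume "f \<in> sequences (hom C u' v')" "f \<in> sequences (hom C u v)"
  then show "u = u' \<and> v = v'" using hom_disjoint unfolding sequences_def by blast
next
  fix u v n show "sequences (homog C u v n) \<subseteq> sequences (hom C u v)"
    using homog_hom unfolding sequences_def by blast
next
  fix f g k u v w x assume "f \<in> sequences (hom C w x)" "g \<in> sequences (hom C v w)" "k \<in> sequences (hom C u v)"
  then show "cauchy (add C) (comp C) (cauchy (add C) (comp C) f g) k =
      cauchy (add C) (comp C) f (cauchy (add C) (comp C) g k)"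
    by (intro cauchy_assoc[OF bilinear_comp bilinear_comp bilinear_comp bilinear_comp]) (auto intro: comp_assoc)
next
  fix f g k u v w u' v' w'
  assume fgk: "f \<in> sequences (hom C u u')" "g \<in> sequences (hom C v v')" "k \<in> sequences (hom C w w')"
  then have o: "u \<in> obj C" "v \<in> obj C" "w \<in> obj C" "u' \<in> obj C" "v' \<in> obj C" "w' \<in> obj C"
    using hom_obj unfolding sequences_def by blast+
  show "cauchy (add C) (tensor C) (cauchy (add C) (tensor C) f g) k =
      cauchy (add C) (tensor C) f (cauchy (add C) (tensor C) g k)"
    using fgk bilinear_tensor[of "tensor_obj C u v" "tensor_obj C u' v'" w w']
    by (intro cauchy_assoc[OF bilinear_tensor[of u u' v v'] _ bilinear_tensor[of v v' w w'] bilinear_tensor])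
      (auto intro: tensor_assoc simp: tensor_obj_assoc o)
next
  fix f g f' g' u v w u' v' w'
  assume "f \<in> sequences (hom C v w)" "g \<in> sequences (hom C u v)"
    "f' \<in> sequences (hom C v' w')" "g' \<in> sequences (hom C u' v')"
  then show "cauchy (add C) (tensor C) (cauchy (add C) (comp C) f g) (cauchy (add C) (comp C) f' g') =
      cauchy (add C) (comp C) (cauchy (add C) (tensor C) f f') (cauchy (add C) (tensor C) g g')"
    by (intro cauchy_interchange[OF bilinear_comp bilinear_comp bilinear_tensor bilinear_tensor bilinear_tensor
      bilinear_comp]) (auto intro: interchange)
next
  fix u v f assume f: "f \<in> sequences (hom C u v)"
  then have o: "u \<in> obj C" "v \<in> obj C"
    using hom_obj unfolding sequences_def by blast+
  show "cauchy (add C) (comp C) (const_series (scale C) (ident C v)) f = f"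
    using f o by (subst bilinear_operation.cauchy_constant_left[OF bilinear_comp[of v v u]])
      (auto simp: fun_eq_iff ident_hom sequences_def intro: comp_ident)
  show "cauchy (add C) (comp C) f (const_series (scale C) (ident C u)) = f"
    using f o by (subst bilinear_operation.cauchy_constant_right[OF bilinear_comp[of u v u]])
      (auto simp: fun_eq_iff ident_hom sequences_def intro: comp_ident)
  show "cauchy (add C) (tensor C) (const_series (scale C) (ident C (unit C))) f = f"
    using f o by (subst bilinear_operation.cauchy_constant_left[OF bilinear_tensor[of "unit C" "unit C" u v]])
      (auto simp: fun_eq_iff ident_hom unit_obj sequences_def intro: tensor_unit)
  show "cauchy (add C) (tensor C) f (const_series (scale C) (ident C (unit C))) = f"
    using f o by (subst bilinear_operation.cauchy_constant_right[OF bilinear_tensor[of u v "unit C" "unit C"]])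
      (auto simp: fun_eq_iff ident_hom unit_obj sequences_def intro: tensor_unit)
  fix c show "pointwise_smul (scale C) c f \<in> sequences (hom C u v)"
    using f by (auto simp: sequences_def scale_hom)
  show "pointwise_plus (add C) f (\<lambda>k. zero C u v) = f"
    using f by (auto simp: fun_eq_iff sequences_def intro: add_zero)
  show "pointwise_plus (add C) f (pointwise_smul (scale C) (- 1) f) = (\<lambda>k. zero C u v)"
    using f by (auto simp: fun_eq_iff sequences_def intro: add_inverse)
next
  fix u v assume o: "u \<in> obj C" "v \<in> obj C"
  then show "cauchy (add C) (tensor C) (const_series (scale C) (ident C u)) (const_series (scale C) (ident C v)) =
    const_series (scale C) (ident C (tensor_obj C u v))"
    by (subst bilinear_operation.cauchy_constant[OF bilinear_tensor[of u u v v]]) (auto simp: ident_hom tensor_ident)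
next
  fix f g u v w assume "f \<in> sequences (hom C v w)" "g \<in> sequences (hom C u v)"
  note fg = this
  show "cauchy (add C) (comp C) f g \<in> sequences (hom C u w)"
    using fg by (intro bilinear_operation.cauchy_sequences[OF bilinear_comp])
  fix c show "cauchy (add C) (comp C) (pointwise_smul (scale C) c f) g =
      pointwise_smul (scale C) c (cauchy (add C) (comp C) f g)"
    "cauchy (add C) (comp C) f (pointwise_smul (scale C) c g) =
      pointwise_smul (scale C) c (cauchy (add C) (comp C) f g)"
    using fg bilinear_operation.cauchy_smul_left[OF bilinear_comp] bilinear_operation.cauchy_smul_right[OF bilinear_comp]
    by (auto simp: fun_eq_iff)
  fix f' assume "f' \<in> sequences (hom C v w)"
  then show "cauchy (add C) (comp C) (pointwise_plus (add C) f f') g =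
      pointwise_plus (add C) (cauchy (add C) (comp C) f g) (cauchy (add C) (comp C) f' g)"
    using fg bilinear_operation.cauchy_plus_left[OF bilinear_comp] by (auto simp: fun_eq_iff)
next
  fix f g g' u v w assume "f \<in> sequences (hom C v w)" "g \<in> sequences (hom C u v)" "g' \<in> sequences (hom C u v)"
  then show "cauchy (add C) (comp C) f (pointwise_plus (add C) g g') =
      pointwise_plus (add C) (cauchy (add C) (comp C) f g) (cauchy (add C) (comp C) f g')"
    using bilinear_operation.cauchy_plus_right[OF bilinear_comp] by (auto simp: fun_eq_iff)
next
  fix f g u v u' v' assume "f \<in> sequences (hom C u v)" "g \<in> sequences (hom C u' v')"
  note fg = this
  show "cauchy (add C) (tensor C) f g \<in> sequences (hom C (tensor_obj C u u') (tensor_obj C v v'))"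
    using fg by (intro bilinear_operation.cauchy_sequences[OF bilinear_tensor])
  fix c show "cauchy (add C) (tensor C) (pointwise_smul (scale C) c f) g =
      pointwise_smul (scale C) c (cauchy (add C) (tensor C) f g)"
    "cauchy (add C) (tensor C) f (pointwise_smul (scale C) c g) =
      pointwise_smul (scale C) c (cauchy (add C) (tensor C) f g)"
    using fg bilinear_operation.cauchy_smul_left[OF bilinear_tensor] bilinear_operation.cauchy_smul_right[OF bilinear_tensor]
    by (auto simp: fun_eq_iff)
  fix f' assume "f' \<in> sequences (hom C u v)"
  then show "cauchy (add C) (tensor C) (pointwise_plus (add C) f f') g =
      pointwise_plus (add C) (cauchy (add C) (tensor C) f g) (cauchy (add C) (tensor C) f' g)"
    using fg bilinear_operation.cauchy_plus_left[OF bilinear_tensor] by (auto simp: fun_eq_iff)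
next
  fix f g g' u v u' v' assume "f \<in> sequences (hom C u v)" "g \<in> sequences (hom C u' v')" "g' \<in> sequences (hom C u' v')"
  then show "cauchy (add C) (tensor C) f (pointwise_plus (add C) g g') =
      pointwise_plus (add C) (cauchy (add C) (tensor C) f g) (cauchy (add C) (tensor C) f g')"
    using bilinear_operation.cauchy_plus_right[OF bilinear_tensor] by (auto simp: fun_eq_iff)
qed (auto simp: sequences_def fun_eq_iff unit_obj tensor_obj_closed tensor_obj_assoc tensor_obj_unit
  ident_hom zero_hom add_hom scale_hom const_series_def
  intro: add_assoc add_comm scale_one scale_scale scale_left scale_right split: nat.split)

section \<open>Calculating with sources and targets\<close>

text \<open>
  The axioms are stated for morphisms in given morphism spaces. With sources and targets as functions, the
  side conditions of each law are equations between words that the simplifier evaluates, and the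
  laws become rewrite rules.
\<close>

context linear_monoidal_category begin

definition arr :: "'m \<Rightarrow> bool" where "arr f \<longleftrightarrow> f \<in> mor C"
definition source :: "'m \<Rightarrow> 'o" where "source f = (THE u. \<exists>v. f \<in> hom C u v)"
definition target :: "'m \<Rightarrow> 'o" where "target f = (THE v. \<exists>u. f \<in> hom C u v)"

lemma hom_iff: "f \<in> hom C u v \<longleftrightarrow> arr f \<and> source f = u \<and> target f = v"
proof -
  have st: "source f = u' \<and> target f = v'" if "f \<in> hom C u' v'" for u' v'
    using that hom_disjoint unfolding source_def target_def by (auto intro!: the_equality)
  have "\<exists>u v. f \<in> hom C u v" if "arr f"
    using that unfolding arr_def mor_def by auto
  moreover have "arr f" if "f \<in> hom C u v"
    using that hom_obj[OF that] unfolding arr_def mor_def by auto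
  ultimately show ?thesis using st by metis
qed

lemma arr_hom: "arr f \<Longrightarrow> f \<in> hom C (source f) (target f)"
  by (simp add: hom_iff)

lemma arr_obj [simp]: "arr f \<Longrightarrow> source f \<in> obj C" "arr f \<Longrightarrow> target f \<in> obj C"
  using arr_hom hom_obj by blast+

lemma arr_ident [simp]:
  "u \<in> obj C \<Longrightarrow> arr (ident C u)" "u \<in> obj C \<Longrightarrow> source (ident C u) = u" "u \<in> obj C \<Longrightarrow> target (ident C u) = u"
  using ident_hom[of u] by (simp_all add: hom_iff)

lemma arr_zero [simp]:
  assumes "u \<in> obj C" "v \<in> obj C"
  shows "arr (zero C u v)" "source (zero C u v) = u" "target (zero C u v) = v"
  using zero_hom[OF assms] by (simp_all add: hom_iff)

lemma arr_comp [simp]: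
  assumes "arr f" "arr g" "source f = target g"
  shows "arr (f \<odot> g)" "source (f \<odot> g) = source g" "target (f \<odot> g) = target f"
  using comp_hom[of f "source f" "target f" g "source g"] assms by (simp_all add: hom_iff)

lemma arr_tensor [simp]:
  assumes "arr f" "arr g"
  shows "arr (f \<otimes> g)" "source (f \<otimes> g) = tensor_obj C (source f) (source g)"
    "target (f \<otimes> g) = tensor_obj C (target f) (target g)"
  using tensor_hom[OF arr_hom[OF assms(1)] arr_hom[OF assms(2)]] by (simp_all add: hom_iff)

lemma arr_add [simp]:
  assumes "arr f" "arr g" "source f = source g" "target f = target g"
  shows "arr (f \<oplus> g)" "source (f \<oplus> g) = source g" "target (f \<oplus> g) = target g"
  using add_hom[of f "source f" "target f" g] assms by (simp_all add: hom_iff)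

lemma arr_scale [simp]:
  assumes "arr f"
  shows "arr (c \<cdot> f)" "source (c \<cdot> f) = source f" "target (c \<cdot> f) = target f"
  using scale_hom[OF arr_hom[OF assms], of c] by (simp_all add: hom_iff)

lemma comp_assoc_arr:
  "arr f \<Longrightarrow> arr g \<Longrightarrow> arr k \<Longrightarrow> source f = target g \<Longrightarrow> source g = target k \<Longrightarrow> (f \<odot> g) \<odot> k = f \<odot> (g \<odot> k)"
  by (rule comp_assoc) (auto simp: hom_iff)

lemma comp_ident_arr [simp]:
  "arr f \<Longrightarrow> target f = v \<Longrightarrow> ident C v \<odot> f = f" "arr f \<Longrightarrow> source f = u \<Longrightarrow> f \<odot> ident C u = f"
  by (rule comp_ident, auto simp: hom_iff)+

lemma comp_add_arr:
  "arr f \<Longrightarrow> arr f' \<Longrightarrow> arr g \<Longrightarrow> source f = source f' \<Longrightarrow> target f = target f' \<Longrightarrow> source f' = target g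
    \<Longrightarrow> (f \<oplus> f') \<odot> g = f \<odot> g \<oplus> f' \<odot> g"
  "arr f \<Longrightarrow> arr g \<Longrightarrow> arr g' \<Longrightarrow> source g = source g' \<Longrightarrow> target g = target g' \<Longrightarrow> source f = target g'
    \<Longrightarrow> f \<odot> (g \<oplus> g') = f \<odot> g \<oplus> f \<odot> g'"
  by (rule comp_add; auto simp: hom_iff)+

lemma comp_scale_arr:
  "arr f \<Longrightarrow> arr g \<Longrightarrow> source f = target g \<Longrightarrow> (c \<cdot> f) \<odot> g = c \<cdot> (f \<odot> g)"
  "arr f \<Longrightarrow> arr g \<Longrightarrow> source f = target g \<Longrightarrow> f \<odot> (c \<cdot> g) = c \<cdot> (f \<odot> g)"
  by (rule comp_scale; auto simp: hom_iff)+

lemma tensor_assoc_arr: "arr f \<Longrightarrow> arr g \<Longrightarrow> arr k \<Longrightarrow> (f \<otimes> g) \<otimes> k = f \<otimes> (g \<otimes> k)"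
  by (rule tensor_assoc; rule arr_hom)

lemma tensor_add_arr:
  "arr f \<Longrightarrow> arr f' \<Longrightarrow> arr g \<Longrightarrow> source f = source f' \<Longrightarrow> target f = target f' \<Longrightarrow> (f \<oplus> f') \<otimes> g = f \<otimes> g \<oplus> f' \<otimes> g"
  "arr f \<Longrightarrow> arr g \<Longrightarrow> arr g' \<Longrightarrow> source g = source g' \<Longrightarrow> target g = target g' \<Longrightarrow> f \<otimes> (g \<oplus> g') = f \<otimes> g \<oplus> f \<otimes> g'"
  by (rule tensor_add; auto simp: hom_iff)+

lemma tensor_scale_arr:
  "arr f \<Longrightarrow> arr g \<Longrightarrow> (c \<cdot> f) \<otimes> g = c \<cdot> (f \<otimes> g)" "arr f \<Longrightarrow> arr g \<Longrightarrow> f \<otimes> (c \<cdot> g) = c \<cdot> (f \<otimes> g)"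
  by (rule tensor_scale; (rule arr_hom, assumption))+

lemma interchange_arr:
  "arr f \<Longrightarrow> arr g \<Longrightarrow> arr f' \<Longrightarrow> arr g' \<Longrightarrow> source f = target g \<Longrightarrow> source f' = target g'
    \<Longrightarrow> (f \<otimes> f') \<odot> (g \<otimes> g') = (f \<odot> g) \<otimes> (f' \<odot> g')"
  by (rule interchange[symmetric]; auto simp: hom_iff)

lemma add_assoc_arr:
  "arr f \<Longrightarrow> arr g \<Longrightarrow> arr k \<Longrightarrow> source f = source g \<Longrightarrow> target f = target g \<Longrightarrow> source g = source k
    \<Longrightarrow> target g = target k \<Longrightarrow> (f \<oplus> g) \<oplus> k = f \<oplus> (g \<oplus> k)"
  by (rule add_assoc; auto simp: hom_iff)

lemma add_comm_arr:
  "arr f \<Longrightarrow> arr g \<Longrightarrow> source f = source g \<Longrightarrow> target f = target g \<Longrightarrow> f \<oplus> g = g \<oplus> f"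
  by (rule add_comm; auto simp: hom_iff)

lemma add_left_comm_arr:
  "arr f \<Longrightarrow> arr g \<Longrightarrow> arr k \<Longrightarrow> source f = source g \<Longrightarrow> target f = target g \<Longrightarrow> source g = source k
    \<Longrightarrow> target g = target k \<Longrightarrow> f \<oplus> (g \<oplus> k) = g \<oplus> (f \<oplus> k)"
  by (metis add_assoc_arr add_comm_arr)

lemma scale_add_arr:
  "arr f \<Longrightarrow> arr g \<Longrightarrow> source f = source g \<Longrightarrow> target f = target g \<Longrightarrow> c \<cdot> (f \<oplus> g) = c \<cdot> f \<oplus> c \<cdot> g"
  by (rule scale_right; auto simp: hom_iff)

lemma scale_scale_arr [simp]: "arr f \<Longrightarrow> a \<cdot> b \<cdot> f = (a * b) \<cdot> f"
  by (rule scale_scale[OF arr_hom])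

lemma scale_one_arr [simp]: "arr f \<Longrightarrow> 1 \<cdot> f = f"
  by (rule scale_one[OF arr_hom])

lemma scale_zero_arr: "arr f \<Longrightarrow> 0 \<cdot> f = zero C (source f) (target f)"
  by (rule scale_zero[OF arr_hom])

lemma add_zero_arr [simp]:
  "arr f \<Longrightarrow> source f = u \<Longrightarrow> target f = v \<Longrightarrow> f \<oplus> zero C u v = f"
  "arr f \<Longrightarrow> source f = u \<Longrightarrow> target f = v \<Longrightarrow> zero C u v \<oplus> f = f"
  using add_zero[OF arr_hom[of f]] add_comm_arr[of "zero C u v" f] by auto

lemma scale_zero_right [simp]: "u \<in> obj C \<Longrightarrow> v \<in> obj C \<Longrightarrow> c \<cdot> zero C u v = zero C u v"
  using scale_zero_arr[of "zero C u v"] scale_scale_arr[of "zero C u v" c 0] by simp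

lemma comp_zero [simp]:
  "arr f \<Longrightarrow> source f = v \<Longrightarrow> u \<in> obj C \<Longrightarrow> f \<odot> zero C u v = zero C u (target f)"
  "arr f \<Longrightarrow> target f = v \<Longrightarrow> w \<in> obj C \<Longrightarrow> zero C v w \<odot> f = zero C (source f) w"
  using comp_scale_arr(2)[of f "zero C u v" 0] comp_scale_arr(1)[of "zero C v w" f 0]
  by (auto simp: scale_zero_arr)

lemma tensor_zero [simp]:
  assumes "arr f" "u \<in> obj C" "v \<in> obj C"
  shows "f \<otimes> zero C u v = zero C (tensor_obj C (source f) u) (tensor_obj C (target f) v)"
    "zero C u v \<otimes> f = zero C (tensor_obj C u (source f)) (tensor_obj C v (target f))"
  using tensor_scale_arr(2)[of f "zero C u v" 0] tensor_scale_arr(1)[of "zero C u v" f 0] assms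
  by (auto simp: scale_zero_arr)

lemma add_inverse_arr [simp]: "arr f \<Longrightarrow> f \<oplus> (- 1) \<cdot> f = zero C (source f) (target f)"
  by (rule add_inverse[OF arr_hom])

text \<open>
  Moving the subtracted term to the other side leaves equations between sums, which associativity and
  commutativity decide.
\<close>

lemma difference_eq_iff:
  assumes "arr f" "arr g" "arr k" "source f = source g" "target f = target g" "source g = source k" "target g = target k"
  shows "f \<oplus> (- 1) \<cdot> g = k \<longleftrightarrow> f = k \<oplus> g"
proof
  have "(f \<oplus> (- 1) \<cdot> g) \<oplus> g = f \<oplus> ((- 1) \<cdot> g \<oplus> g)"
    using assms by (intro add_assoc_arr) simp_all
  also have "(- 1) \<cdot> g \<oplus> g = zero C (source g) (target g)"
    using add_comm_arr[of "(- 1) \<cdot> g" g] assms(2) by simp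
  finally have "(f \<oplus> (- 1) \<cdot> g) \<oplus> g = f"
    using assms by simp
  then show "f = k \<oplus> g" if "f \<oplus> (- 1) \<cdot> g = k"
    using that by simp
  have "(k \<oplus> g) \<oplus> (- 1) \<cdot> g = k \<oplus> (g \<oplus> (- 1) \<cdot> g)"
    using assms by (intro add_assoc_arr) simp_all
  also have "\<dots> = k"
    using assms by simp
  finally show "f \<oplus> (- 1) \<cdot> g = k" if "f = k \<oplus> g"
    using that by simp
qed

text \<open>
  Turns a commutation rule for two composed morphisms into one that applies inside longer composites
  that are nested to the right.
\<close>

lemma comp_reassoc:
  assumes "p \<odot> q = r \<odot> s" "arr p" "arr q" "arr r" "arr s" "source p = target q" "source r = target s"
    and "arr f" "source q = target f"
  shows "p \<odot> (q \<odot> f) = r \<odot> (s \<odot> f)"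
proof -
  have "source s = source q"
    using arr_comp(2)[of p q] arr_comp(2)[of r s] assms by simp
  then show ?thesis
    using assms by (simp add: comp_assoc_arr[symmetric])
qed

end

section \<open>Functors out of the Khovanov-Lauda-Rouquier category\<close>

primrec evaluate :: "('v list, 'm) moncat \<Rightarrow> ('v \<Rightarrow> 'm) \<Rightarrow> ('v \<Rightarrow> 'v \<Rightarrow> 'm) \<Rightarrow> 'v diagram \<Rightarrow> 'm" where
  "evaluate C X Y (Ident u) = ident C u"
| "evaluate C X Y (Dot i) = X i"
| "evaluate C X Y (Cross i j) = Y i j"
| "evaluate C X Y (Null u v) = zero C u v"
| "evaluate C X Y (s \<boxplus> t) = evaluate C X Y s \<oplus>\<^bsub>C\<^esub> evaluate C X Y t"
| "evaluate C X Y (c \<bullet> s) = c \<cdot>\<^bsub>C\<^esub> evaluate C X Y s"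
| "evaluate C X Y (s \<boxdot> t) = evaluate C X Y s \<odot>\<^bsub>C\<^esub> evaluate C X Y t"
| "evaluate C X Y (s \<boxtimes> t) = evaluate C X Y s \<otimes>\<^bsub>C\<^esub> evaluate C X Y t"

locale pre_klr_model = linear_monoidal_category C for C :: "('v list, 'm) moncat" (structure) +
  fixes V :: "'v set" and X :: "'v \<Rightarrow> 'm" and Y :: "'v \<Rightarrow> 'v \<Rightarrow> 'm"
  assumes words: "obj C = lists V" "unit C = []" "tensor_obj C = (@)"
    and X_hom: "i \<in> V \<Longrightarrow> X i \<in> hom C [i] [i]"
    and Y_hom: "i \<in> V \<Longrightarrow> j \<in> V \<Longrightarrow> Y i j \<in> hom C [i, j] [j, i]"
begin

abbreviation "ev \<equiv> evaluate C X Y"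

lemma words_simps [simp]: "obj C = lists V" "unit C = []" "tensor_obj C u v = u @ v"
  by (simp_all add: words)

lemma ev_hom: "arrow V u v t \<Longrightarrow> ev t \<in> hom C u v"
proof (induction rule: arrow.induct)
  case (8 u v s u' v' t)
  then show ?case using tensor_hom by fastforce
qed (auto intro: ident_hom X_hom Y_hom zero_hom add_hom scale_hom comp_hom)

end

text \<open>
  A category on the same objects with chosen dots and crossings that satisfy the defining relations.
\<close>

locale klr_model = pre_klr_model C V X Y for C :: "('v list, 'm) moncat" (structure) and V X Y +
  fixes E :: "('v \<times> 'v) set"
  assumes ev_relation: "klr_relation E s t \<Longrightarrow> arrow V u v s \<Longrightarrow> arrow V u v t
    \<Longrightarrow> evaluate C X Y s = evaluate C X Y t"
begin

text \<open>
  The universal property of the presentation: evaluation in a model respects all equations, by induction on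
  the congruence. The axioms of a linear strict monoidal category hold because the model is one.
\<close>

theorem ev_cong: "klr_eq V E u v s t \<Longrightarrow> ev s = ev t"
proof (induction rule: klr_eq.induct)
  case relation
  then show ?case by (rule ev_relation)
next
  case (Tensor_Ident u v)
  then show ?case using tensor_ident[of u v] by simp
next
  case Tensor_unit_left
  then show ?case unfolding evaluate.simps words_simps(2)[symmetric] by (intro tensor_unit(1) ev_hom)
next
  case Tensor_unit_right
  then show ?case unfolding evaluate.simps words_simps(2)[symmetric] by (intro tensor_unit(2) ev_hom)
qed (unfold evaluate.simps, (assumption | (simp only:; fail) |
    (rule add_assoc add_comm add_zero add_inverse scale_one scale_scale scale_left scale_right
      comp_assoc comp_ident comp_add comp_scale tensor_assoc interchange tensor_add tensor_scale;
      (rule ev_hom, assumption)))+)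

end

section \<open>Models over a central variable\<close>

context linear_monoidal_category begin

lemma sub_cancel:
  assumes "arr a" "arr b" "arr w" "source a = u" "source b = u" "source w = u"
    "target a = v" "target b = v" "target w = v"
  shows "(a \<oplus> (- 1) \<cdot> (w \<oplus> b)) \<oplus> w = a \<oplus> (- 1) \<cdot> b"
    and "(a \<oplus> (- 1) \<cdot> w) \<oplus> (- 1) \<cdot> (b \<oplus> (- 1) \<cdot> w) = a \<oplus> (- 1) \<cdot> b"
    and "(a \<oplus> w) \<oplus> (- 1) \<cdot> (b \<oplus> w) = a \<oplus> (- 1) \<cdot> b"
proof -
  have *: "(- 1) \<cdot> w \<oplus> ((- 1) \<cdot> b \<oplus> w) = (- 1) \<cdot> b"
    using assms by (subst add_left_comm_arr) (simp_all add: add_comm_arr[of "(- 1) \<cdot> w" w])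
  then show "(a \<oplus> (- 1) \<cdot> (w \<oplus> b)) \<oplus> w = a \<oplus> (- 1) \<cdot> b"
    using assms by (simp add: scale_add_arr add_assoc_arr)
  have "w \<oplus> ((- 1) \<cdot> b \<oplus> (- 1) \<cdot> w) = (- 1) \<cdot> b"
    using assms by (subst add_left_comm_arr) simp_all
  then show "(a \<oplus> w) \<oplus> (- 1) \<cdot> (b \<oplus> w) = a \<oplus> (- 1) \<cdot> b"
    using assms by (simp add: scale_add_arr add_assoc_arr)
  show "(a \<oplus> (- 1) \<cdot> w) \<oplus> (- 1) \<cdot> (b \<oplus> (- 1) \<cdot> w) = a \<oplus> (- 1) \<cdot> b"
    using assms * by (simp add: scale_add_arr add_assoc_arr)
qed

lemma tensor_ident_arr [simp]: "u \<in> obj C \<Longrightarrow> v \<in> obj C \<Longrightarrow> ident C u \<otimes> ident C v = ident C (tensor_obj C u v)"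
  by (rule tensor_ident)

lemma whisker_comp:
  "arr f \<Longrightarrow> arr g \<Longrightarrow> source f = target g \<Longrightarrow> u \<in> obj C \<Longrightarrow> (f \<odot> g) \<otimes> ident C u = (f \<otimes> ident C u) \<odot> (g \<otimes> ident C u)"
  "arr f \<Longrightarrow> arr g \<Longrightarrow> source f = target g \<Longrightarrow> u \<in> obj C \<Longrightarrow> ident C u \<otimes> (f \<odot> g) = (ident C u \<otimes> f) \<odot> (ident C u \<otimes> g)"
  by (simp_all add: interchange_arr)

lemma whisker_commute:
  assumes "arr f" "arr g" "source f = u" "target f = u'" "source g = v" "target g = v'"
  shows "(ident C u' \<otimes> g) \<odot> (f \<otimes> ident C v) = (f \<otimes> ident C v') \<odot> (ident C u \<otimes> g)"
proof -
  have "u \<in> obj C" "u' \<in> obj C" "v \<in> obj C" "v' \<in> obj C" using assms by auto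
  then show ?thesis using assms by (simp add: interchange_arr)
qed

end

text \<open>
  A model whose category has a central variable: \<open>T\<close> stands for multiplication by \<open>t\<close>.
\<close>

locale klr_model_with_variable = klr_model C V X Y E for C :: "('v list, 'm) moncat" (structure) and V X Y E +
  fixes T :: "'m \<Rightarrow> 'm"
  assumes graph: "oriented_simply_laced_graph V E"
    and T_hom: "f \<in> hom C u v \<Longrightarrow> T f \<in> hom C u v"
    and T_add: "f \<in> hom C u v \<Longrightarrow> g \<in> hom C u v \<Longrightarrow> T (f \<oplus> g) = T f \<oplus> T g"
    and T_scale: "f \<in> hom C u v \<Longrightarrow> T (c \<cdot> f) = c \<cdot> T f"
    and T_comp: "f \<in> hom C v w \<Longrightarrow> g \<in> hom C u v \<Longrightarrow> T f \<odot> g = T (f \<odot> g)"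
      "f \<in> hom C v w \<Longrightarrow> g \<in> hom C u v \<Longrightarrow> f \<odot> T g = T (f \<odot> g)"
    and T_tensor: "f \<in> hom C u v \<Longrightarrow> g \<in> hom C u' v' \<Longrightarrow> T f \<otimes> g = T (f \<otimes> g)"
      "f \<in> hom C u v \<Longrightarrow> g \<in> hom C u' v' \<Longrightarrow> f \<otimes> T g = T (f \<otimes> g)"
begin

lemma edge_distinct: "(i, j) \<in> E \<Longrightarrow> i \<noteq> j \<and> i \<in> V \<and> j \<in> V"
  using graph unfolding oriented_simply_laced_graph_def by blast

lemma adjacent_commute: "adjacent E i j \<longleftrightarrow> adjacent E j i"
  by (auto simp: adjacent_def)

lemma arr_XY [simp]:
  "i \<in> V \<Longrightarrow> arr (X i)" "i \<in> V \<Longrightarrow> source (X i) = [i]" "i \<in> V \<Longrightarrow> target (X i) = [i]"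
  "i \<in> V \<Longrightarrow> j \<in> V \<Longrightarrow> arr (Y i j)" "i \<in> V \<Longrightarrow> j \<in> V \<Longrightarrow> source (Y i j) = [i, j]"
  "i \<in> V \<Longrightarrow> j \<in> V \<Longrightarrow> target (Y i j) = [j, i]"
  using X_hom[of i] Y_hom[of i j] by (simp_all add: hom_iff)

lemma arr_T [simp]:
  assumes "arr f" shows "arr (T f)" "source (T f) = source f" "target (T f) = target f"
  using T_hom[OF arr_hom[OF assms]] by (simp_all add: hom_iff)

lemma T_arr:
  "arr f \<Longrightarrow> arr g \<Longrightarrow> source f = source g \<Longrightarrow> target f = target g \<Longrightarrow> T (f \<oplus> g) = T f \<oplus> T g"
  "arr f \<Longrightarrow> T (c \<cdot> f) = c \<cdot> T f"
  "arr f \<Longrightarrow> arr g \<Longrightarrow> source f = target g \<Longrightarrow> T f \<odot> g = T (f \<odot> g)"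
  "arr f \<Longrightarrow> arr g \<Longrightarrow> source f = target g \<Longrightarrow> f \<odot> T g = T (f \<odot> g)"
  "arr f \<Longrightarrow> arr g \<Longrightarrow> T f \<otimes> g = T (f \<otimes> g)"
  "arr f \<Longrightarrow> arr g \<Longrightarrow> f \<otimes> T g = T (f \<otimes> g)"
  using T_add[of f "source f" "target f" g] T_scale[OF arr_hom, of f c]
    T_comp[of f "source f" "target f" g "source g"] T_tensor[OF arr_hom arr_hom, of f g]
  by (simp_all add: hom_iff)

text \<open>
  Writes a composite of sums as a sum in which the scalars and \<open>T\<close> stand outside.
\<close>

lemmas expand = comp_add_arr comp_scale_arr tensor_add_arr tensor_scale_arr T_arr

lemma distinct_colours_X:
  assumes "i \<in> V" "j \<in> V" "i \<noteq> j"
  shows "(X j \<otimes> ident C [i]) \<odot> Y i j = Y i j \<odot> (ident C [i] \<otimes> X j)"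
    "(ident C [j] \<otimes> X i) \<odot> Y i j = Y i j \<odot> (X i \<otimes> ident C [j])"
  using ev_relation[OF klr_relation.dot_slide_1, of i j "[i, j]" "[j, i]"]
    ev_relation[OF klr_relation.dot_slide_2, of i j "[i, j]" "[j, i]"] assms
  by (simp_all add: arrow_iff)

lemma same_colour_X:
  assumes "i \<in> V"
  shows "(X i \<otimes> ident C [i]) \<odot> Y i i = ident C [i, i] \<oplus> Y i i \<odot> (ident C [i] \<otimes> X i)"
    "Y i i \<odot> (X i \<otimes> ident C [i]) = ident C [i, i] \<oplus> (ident C [i] \<otimes> X i) \<odot> Y i i"
    "Y i i \<odot> Y i i = zero C [i, i] [i, i]"
  using ev_relation[OF klr_relation.dot_same_1, of "[i, i]" "[i, i]" i]
    ev_relation[OF klr_relation.dot_same_2, of "[i, i]" "[i, i]" i]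
    ev_relation[OF klr_relation.double_same, of "[i, i]" "[i, i]" i] assms
  by (simp_all add: arrow_iff difference_eq_iff)

lemma double_edge:
  assumes "(i, j) \<in> E"
  shows "Y j i \<odot> Y i j = (X i \<otimes> ident C [j]) \<oplus> (- 1) \<cdot> (ident C [i] \<otimes> X j)"
    "Y i j \<odot> Y j i = (ident C [j] \<otimes> X i) \<oplus> (- 1) \<cdot> (X j \<otimes> ident C [i])"
  using edge_distinct[OF assms] ev_relation[OF klr_relation.double_tail_head[OF assms], of "[i, j]" "[i, j]"]
    ev_relation[OF klr_relation.double_head_tail[OF assms], of "[j, i]" "[j, i]"]
  by (simp_all add: arrow_iff)

text \<open>
  Only differences of dots, and commutators of dots with crossings, occur in the relations, and adding
  the central element \<open>t\<close> to every dot changes neither.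
\<close>

theorem klr_model_translated: "klr_model C V (\<lambda>i. X i \<oplus> T (ident C [i])) Y E"
proof unfold_locales
  show "X i \<oplus> T (ident C [i]) \<in> hom C [i] [i]" if "i \<in> V" for i
    using that by (simp add: hom_iff)
  fix s t u v assume "klr_relation E s t" "arrow V u v s" "arrow V u v t"
  then show "evaluate C (\<lambda>i. X i \<oplus> T (ident C [i])) Y s = evaluate C (\<lambda>i. X i \<oplus> T (ident C [i])) Y t"
  proof induction
    case (dot_same_1 i)
    then have i: "i \<in> V" by (simp add: arrow_iff)
    show ?case
      using i by (simp add: expand difference_eq_iff same_colour_X(1) add_assoc_arr)
  next
    case (dot_same_2 i)
    then have i: "i \<in> V" by (simp add: arrow_iff)
    show ?case
      using i by (simp add: expand difference_eq_iff same_colour_X(2) add_assoc_arr)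
  next
    case (dot_slide_1 i j)
    then have i: "i \<in> V" "j \<in> V" by (simp_all add: arrow_iff)
    show ?case
      using i dot_slide_1(1) by (simp add: expand distinct_colours_X(1))
  next
    case (dot_slide_2 i j)
    then have i: "i \<in> V" "j \<in> V" by (simp_all add: arrow_iff)
    show ?case
      using i dot_slide_2(1) by (simp add: expand distinct_colours_X(2))
  next
    case (double_same i)
    then have i: "i \<in> V" by (simp add: arrow_iff)
    show ?case
      using i by (simp add: same_colour_X(3))
  next
    case (double_distant i j)
    then show ?case using ev_relation[OF klr_relation.double_distant[OF double_distant(1,2)]] by simp
  next
    case (double_tail_head i j)
    then show ?case using double_edge(1)[of i j] edge_distinct[of i j]
      by (simp add: expand sub_cancel(3)[where u = "[i, j]" and v = "[i, j]"])
  next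
    case (double_head_tail j i)
    then show ?case using double_edge(2)[of j i] edge_distinct[of j i]
      by (simp add: expand sub_cancel(3)[where u = "[i, j]" and v = "[i, j]"])
  next
    case (braid i k j)
    then show ?case using ev_relation[OF klr_relation.braid[OF braid(1)]] by simp
  next
    case (braid_tail_head i j)
    then show ?case using ev_relation[OF klr_relation.braid_tail_head[OF braid_tail_head(1)]] by simp
  next
    case (braid_head_tail j i)
    then show ?case using ev_relation[OF klr_relation.braid_head_tail[OF braid_head_tail(1)]] by simp
  qed
qed (simp_all add: words Y_hom)

end

section \<open>The deformed generators: two strands\<close>

text \<open>
  Here \<open>1 - t X i\<close> has the inverse \<open>Q i\<close>. Primes mark the deformed generators \<open>X'\<close> and \<open>Y'\<close>, and the relations
  proved for them.
\<close>

locale klr_deformation = klr_model_with_variable C V X Y E T for C :: "('v list, 'm) moncat" (structure) and V X Y E T +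
  fixes Q :: "'v \<Rightarrow> 'm"
  assumes Q_hom: "i \<in> V \<Longrightarrow> Q i \<in> hom C [i] [i]"
    and Q_inverse: "i \<in> V \<Longrightarrow> (ident C [i] \<oplus> (- 1) \<cdot> T (X i)) \<odot> Q i = ident C [i]"
      "i \<in> V \<Longrightarrow> Q i \<odot> (ident C [i] \<oplus> (- 1) \<cdot> T (X i)) = ident C [i]"
begin

definition G :: "'v \<Rightarrow> 'm" where "G i = ident C [i] \<oplus> (- 1) \<cdot> T (X i)"

definition M :: "'v \<Rightarrow> 'v \<Rightarrow> 'm" where "M i j = (if adjacent E i j then Q j else ident C [j])"

definition X' :: "'v \<Rightarrow> 'm" where "X' i = X i \<odot> Q i"

text \<open>
  For distinct colours the factor \<open>M i j\<close> sits at the top left end of the crossing, on the strand of colour \<open>j\<close>.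
\<close>

definition Y' :: "'v \<Rightarrow> 'v \<Rightarrow> 'm" where
  "Y' i j = (if i = j then (G i \<otimes> ident C [i]) \<odot> (Y i i \<odot> (ident C [i] \<otimes> G i))
     else (M i j \<otimes> ident C [i]) \<odot> Y i j)"

lemma arr_Q [simp]: "i \<in> V \<Longrightarrow> arr (Q i)" "i \<in> V \<Longrightarrow> source (Q i) = [i]" "i \<in> V \<Longrightarrow> target (Q i) = [i]"
  using Q_hom[of i] by (simp_all add: hom_iff)

lemma arr_GM [simp]:
  "i \<in> V \<Longrightarrow> arr (G i)" "i \<in> V \<Longrightarrow> source (G i) = [i]" "i \<in> V \<Longrightarrow> target (G i) = [i]"
  "j \<in> V \<Longrightarrow> arr (M i j)" "j \<in> V \<Longrightarrow> source (M i j) = [j]" "j \<in> V \<Longrightarrow> target (M i j) = [j]"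
  by (simp_all add: G_def M_def)

lemma arr_XY' [simp]:
  "i \<in> V \<Longrightarrow> arr (X' i)" "i \<in> V \<Longrightarrow> source (X' i) = [i]" "i \<in> V \<Longrightarrow> target (X' i) = [i]"
  "i \<in> V \<Longrightarrow> j \<in> V \<Longrightarrow> arr (Y' i j)" "i \<in> V \<Longrightarrow> j \<in> V \<Longrightarrow> source (Y' i j) = [i, j]"
  "i \<in> V \<Longrightarrow> j \<in> V \<Longrightarrow> target (Y' i j) = [j, i]"
  by (auto simp: X'_def Y'_def)

lemma GQ [simp]: "i \<in> V \<Longrightarrow> G i \<odot> Q i = ident C [i]" "i \<in> V \<Longrightarrow> Q i \<odot> G i = ident C [i]"
  using Q_inverse[of i] by (simp_all add: G_def)

lemma XG: "i \<in> V \<Longrightarrow> X i \<odot> G i = G i \<odot> X i"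
  by (simp add: G_def expand)

lemma commute_inverse:
  assumes "arr f" "arr g" "arr q" "source f = u" "source g = u" "source q = u" "target f = u" "target g = u" "target q = u"
    and "f \<odot> g = g \<odot> f" "g \<odot> q = ident C u" "q \<odot> g = ident C u"
  shows "f \<odot> q = q \<odot> f"
proof -
  have "f \<odot> q = (q \<odot> g) \<odot> (f \<odot> q)" using assms by simp
  also have "\<dots> = q \<odot> ((g \<odot> f) \<odot> q)" using assms(1-9) by (simp add: comp_assoc_arr)
  also have "\<dots> = (q \<odot> f) \<odot> (g \<odot> q)" unfolding assms(10)[symmetric] using assms(1-9) by (simp add: comp_assoc_arr)
  also have "\<dots> = q \<odot> f" using assms by simp
  finally show ?thesis .
qed

lemma XQ: "i \<in> V \<Longrightarrow> X i \<odot> Q i = Q i \<odot> X i"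
  by (rule commute_inverse[where g = "G i" and u = "[i]"]) (simp_all add: XG)

lemma M_commute: "k \<in> V \<Longrightarrow> M i k \<odot> M j k = M j k \<odot> M i k" "k \<in> V \<Longrightarrow> X' k \<odot> M i k = M i k \<odot> X' k"
  by (auto simp: M_def X'_def comp_assoc_arr XQ)

text \<open>
  Endomorphisms of a strand that pass through every crossing with a strand of another colour.
\<close>

definition slides :: "'v \<Rightarrow> 'm \<Rightarrow> bool" where
  "slides j m \<longleftrightarrow> arr m \<and> source m = [j] \<and> target m = [j] \<and> j \<in> V \<and>
     (\<forall>i \<in> V. i \<noteq> j \<longrightarrow> (m \<otimes> ident C [i]) \<odot> Y i j = Y i j \<odot> (ident C [i] \<otimes> m) \<and>
       (ident C [i] \<otimes> m) \<odot> Y j i = Y j i \<odot> (m \<otimes> ident C [i]))"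

lemma slidesD:
  "slides j m \<Longrightarrow> arr m" "slides j m \<Longrightarrow> source m = [j]" "slides j m \<Longrightarrow> target m = [j]" "slides j m \<Longrightarrow> j \<in> V"
  "slides j m \<Longrightarrow> i \<in> V \<Longrightarrow> i \<noteq> j \<Longrightarrow> (m \<otimes> ident C [i]) \<odot> Y i j = Y i j \<odot> (ident C [i] \<otimes> m)"
  "slides j m \<Longrightarrow> i \<in> V \<Longrightarrow> i \<noteq> j \<Longrightarrow> (ident C [i] \<otimes> m) \<odot> Y j i = Y j i \<odot> (m \<otimes> ident C [i])"
  by (simp_all add: slides_def)

lemma slides_ident: "j \<in> V \<Longrightarrow> slides j (ident C [j])"
  by (simp add: slides_def)

lemma slides_X: "j \<in> V \<Longrightarrow> slides j (X j)"
  by (simp add: slides_def distinct_colours_X)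

lemma slides_comp:
  assumes "slides j m" "slides j n"
  shows "slides j (m \<odot> n)"
  unfolding slides_def
proof (intro conjI ballI impI)
  fix i assume i: "i \<in> V" "i \<noteq> j"
  note s = slidesD[OF assms(1)] slidesD[OF assms(2)]
  note r = slidesD(5)[OF assms(1) i] slidesD(6)[OF assms(1) i]
  show "((m \<odot> n) \<otimes> ident C [i]) \<odot> Y i j = Y i j \<odot> (ident C [i] \<otimes> (m \<odot> n))"
    "(ident C [i] \<otimes> (m \<odot> n)) \<odot> Y j i = Y j i \<odot> ((m \<odot> n) \<otimes> ident C [i])"
    using s(1-4,7-10) i by (simp_all add: whisker_comp comp_assoc_arr slidesD(5,6)[OF assms(2) i]
      r[THEN comp_reassoc])
qed (use slidesD(1-4)[OF assms(1)] slidesD(1-4)[OF assms(2)] in simp_all)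

lemma slides_G: "j \<in> V \<Longrightarrow> slides j (G j)"
  using slides_X[of j] by (auto simp: slides_def G_def expand)

text \<open>
  Conjugate the sliding rule of \<open>g\<close> by its inverse.
\<close>

lemma slides_inverse:
  assumes g: "slides j g" and q: "arr q" "source q = [j]" "target q = [j]"
    and gq: "g \<odot> q = ident C [j]" "q \<odot> g = ident C [j]"
  shows "slides j q"
  unfolding slides_def
proof (intro conjI ballI impI)
  fix i assume i: "i \<in> V" "i \<noteq> j"
  note s = slidesD(1-4)[OF g]
  have r: "(q \<otimes> ident C [i]) \<odot> (g \<otimes> ident C [i]) = ident C [j, i]" "(ident C [i] \<otimes> q) \<odot> (ident C [i] \<otimes> g) = ident C [i, j]"
    "(g \<otimes> ident C [i]) \<odot> (q \<otimes> ident C [i]) = ident C [j, i]" "(ident C [i] \<otimes> g) \<odot> (ident C [i] \<otimes> q) = ident C [i, j]"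
    using s q i by (simp_all add: interchange_arr gq)
  have "(q \<otimes> ident C [i]) \<odot> Y i j = (q \<otimes> ident C [i]) \<odot> ((Y i j \<odot> (ident C [i] \<otimes> g)) \<odot> (ident C [i] \<otimes> q))"
    using s q i by (simp add: comp_assoc_arr r)
  also have "\<dots> = ((q \<otimes> ident C [i]) \<odot> (g \<otimes> ident C [i])) \<odot> (Y i j \<odot> (ident C [i] \<otimes> q))"
    unfolding slidesD(5)[OF g i, symmetric] using s q i by (simp add: comp_assoc_arr)
  also have "\<dots> = Y i j \<odot> (ident C [i] \<otimes> q)"
    unfolding r using s q i by simp
  finally show "(q \<otimes> ident C [i]) \<odot> Y i j = Y i j \<odot> (ident C [i] \<otimes> q)" .
  have "(ident C [i] \<otimes> q) \<odot> Y j i = (ident C [i] \<otimes> q) \<odot> ((Y j i \<odot> (g \<otimes> ident C [i])) \<odot> (q \<otimes> ident C [i]))"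
    using s q i by (simp add: comp_assoc_arr r)
  also have "\<dots> = ((ident C [i] \<otimes> q) \<odot> (ident C [i] \<otimes> g)) \<odot> (Y j i \<odot> (q \<otimes> ident C [i]))"
    unfolding slidesD(6)[OF g i, symmetric] using s q i by (simp add: comp_assoc_arr)
  also have "\<dots> = Y j i \<odot> (q \<otimes> ident C [i])"
    unfolding r using s q i by simp
  finally show "(ident C [i] \<otimes> q) \<odot> Y j i = Y j i \<odot> (q \<otimes> ident C [i])" .
qed (use slidesD(1-4)[OF g] q in simp_all)

lemma slides_Q: "j \<in> V \<Longrightarrow> slides j (Q j)"
  by (rule slides_inverse[OF slides_G]) simp_all

lemma slides_M: "j \<in> V \<Longrightarrow> slides j (M i j)"
  by (simp add: M_def slides_Q slides_ident)

lemma slides_X': "j \<in> V \<Longrightarrow> slides j (X' j)"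
  by (simp add: X'_def slides_comp slides_X slides_Q)

text \<open>
  The relations \<open>x\<^sub>1 \<psi> - \<psi> x\<^sub>2 = 1 = \<psi> x\<^sub>1 - x\<^sub>2 \<psi>\<close>, multiplied by \<open>t\<close> and written in terms of \<open>g = 1 - t x\<close>. All
  computations with a crossing of two strands of one colour rest on them.
\<close>

lemma same_colour_G:
  assumes "i \<in> V"
  shows "Y i i \<odot> (ident C [i] \<otimes> G i) = (G i \<otimes> ident C [i]) \<odot> Y i i \<oplus> T (ident C [i, i])"
    "(ident C [i] \<otimes> G i) \<odot> Y i i = Y i i \<odot> (G i \<otimes> ident C [i]) \<oplus> T (ident C [i, i])"
  using assms by (simp_all add: G_def expand same_colour_X sub_cancel[where u = "[i, i]" and v = "[i, i]"])

text \<open>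
  By the previous rules both sides are equal to \<open>\<psi> g\<^sub>2 g\<^sub>1 = g\<^sub>1 \<psi> g\<^sub>1 + t g\<^sub>1\<close>: symmetric expressions in the two dots
  commute with the crossing.
\<close>

lemma same_colour_GG:
  assumes "i \<in> V"
  shows "(G i \<otimes> ident C [i]) \<odot> ((ident C [i] \<otimes> G i) \<odot> Y i i) = Y i i \<odot> ((G i \<otimes> ident C [i]) \<odot> (ident C [i] \<otimes> G i))"
proof -
  have "(G i \<otimes> ident C [i]) \<odot> (ident C [i] \<otimes> G i) = (ident C [i] \<otimes> G i) \<odot> (G i \<otimes> ident C [i])"
    by (rule whisker_commute[symmetric]) (use assms in simp_all)
  then have "Y i i \<odot> ((G i \<otimes> ident C [i]) \<odot> (ident C [i] \<otimes> G i)) = (Y i i \<odot> (ident C [i] \<otimes> G i)) \<odot> (G i \<otimes> ident C [i])"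
    using assms by (simp add: comp_assoc_arr)
  then show ?thesis
    unfolding same_colour_G[OF assms] using assms by (simp add: comp_add_arr comp_assoc_arr T_arr)
qed

lemma GX' [simp]: "i \<in> V \<Longrightarrow> G i \<odot> X' i = X i" "i \<in> V \<Longrightarrow> X' i \<odot> G i = X i"
  by (simp_all add: X'_def comp_assoc_arr comp_assoc_arr[symmetric, of "G i" "X i"] XG[symmetric])

text \<open>
  The deformed crossing and its products with deformed dots are polynomials in \<open>t\<close>, because \<open>x q g = x\<close>.
  The divided powers of \<open>d\<close> on \<open>\<psi>\<^sub>i\<^sub>i\<close> are read off from them.
\<close>

lemma same_colour_deformed:
  assumes i: "i \<in> V"
  defines "x1 \<equiv> X i \<otimes> ident C [i]" and "x2 \<equiv> ident C [i] \<otimes> X i" and "y \<equiv> Y i i"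
  shows "Y' i i = (y \<oplus> (- 1) \<cdot> T (x1 \<odot> y)) \<oplus> (- 1) \<cdot> T (y \<odot> x2 \<oplus> (- 1) \<cdot> T (x1 \<odot> (y \<odot> x2)))"
    and "(X' i \<otimes> ident C [i]) \<odot> Y' i i = x1 \<odot> y \<oplus> (- 1) \<cdot> T (x1 \<odot> (y \<odot> x2))"
    and "Y' i i \<odot> (ident C [i] \<otimes> X' i) = y \<odot> x2 \<oplus> (- 1) \<cdot> T (x1 \<odot> (y \<odot> x2))"
    and "(X' i \<otimes> ident C [i]) \<odot> (Y' i i \<odot> (ident C [i] \<otimes> X' i)) = x1 \<odot> (y \<odot> x2)"
proof -
  have 1: "(X' i \<otimes> ident C [i]) \<odot> (G i \<otimes> ident C [i]) = x1" "(ident C [i] \<otimes> G i) \<odot> (ident C [i] \<otimes> X' i) = x2"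
    using i by (simp_all add: interchange_arr x1_def x2_def)
  have 2: "(X' i \<otimes> ident C [i]) \<odot> Y' i i = x1 \<odot> (y \<odot> (ident C [i] \<otimes> G i))"
    unfolding 1(1)[symmetric] y_def using i by (simp add: Y'_def comp_assoc_arr)
  have 3: "Y' i i \<odot> (ident C [i] \<otimes> X' i) = (G i \<otimes> ident C [i]) \<odot> (y \<odot> x2)"
    unfolding 1(2)[symmetric] y_def using i by (simp add: Y'_def comp_assoc_arr)
  show "Y' i i = (y \<oplus> (- 1) \<cdot> T (x1 \<odot> y)) \<oplus> (- 1) \<cdot> T (y \<odot> x2 \<oplus> (- 1) \<cdot> T (x1 \<odot> (y \<odot> x2)))"
    using i by (simp add: Y'_def G_def expand x1_def x2_def y_def)
  show "(X' i \<otimes> ident C [i]) \<odot> Y' i i = x1 \<odot> y \<oplus> (- 1) \<cdot> T (x1 \<odot> (y \<odot> x2))"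
    unfolding 2 using i by (simp add: G_def expand x1_def x2_def y_def)
  show "Y' i i \<odot> (ident C [i] \<otimes> X' i) = y \<odot> x2 \<oplus> (- 1) \<cdot> T (x1 \<odot> (y \<odot> x2))"
    unfolding 3 using i by (simp add: G_def expand x1_def x2_def y_def)
  show "(X' i \<otimes> ident C [i]) \<odot> (Y' i i \<odot> (ident C [i] \<otimes> X' i)) = x1 \<odot> (y \<odot> x2)"
    unfolding 3 1(1)[symmetric] y_def x2_def using i by (simp add: comp_assoc_arr)
qed

lemma dot_same_1':
  assumes i: "i \<in> V"
  shows "(X' i \<otimes> ident C [i]) \<odot> Y' i i \<oplus> (- 1) \<cdot> Y' i i \<odot> (ident C [i] \<otimes> X' i) = ident C [i, i]"
  unfolding same_colour_deformed(2,3)[OF i] using i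
  by (subst sub_cancel(2)[where u = "[i, i]" and v = "[i, i]"]) (simp_all add: difference_eq_iff same_colour_X(1))

text \<open>
  On this side of the crossing the factors \<open>g\<close> and \<open>q\<close> do not meet. Inserting \<open>q\<^sub>2 g\<^sub>2 = 1\<close> at the top and
  moving \<open>g\<^sub>1 g\<^sub>2\<close> through the crossing brings both products to the form \<open>q\<^sub>2 (\<dots>) g\<^sub>2\<close>, where the expressions in
  parentheses, \<open>\<psi> x\<^sub>1 g\<^sub>2\<close> and \<open>x\<^sub>2 g\<^sub>1 \<psi>\<close>, differ by \<open>1\<close>.
\<close>

lemma dot_same_2':
  assumes i: "i \<in> V"
  shows "Y' i i \<odot> (X' i \<otimes> ident C [i]) \<oplus> (- 1) \<cdot> (ident C [i] \<otimes> X' i) \<odot> Y' i i = ident C [i, i]"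
proof -
  let ?x1 = "X i \<otimes> ident C [i]" and ?x2 = "ident C [i] \<otimes> X i" and ?y = "Y i i"
  let ?g1 = "G i \<otimes> ident C [i]" and ?g2 = "ident C [i] \<otimes> G i" and ?q2 = "ident C [i] \<otimes> Q i"
  let ?x1' = "X' i \<otimes> ident C [i]" and ?x2' = "ident C [i] \<otimes> X' i"
  have y: "?y \<odot> (?x1 \<odot> ?x2) = ?x2 \<oplus> ?x2 \<odot> (?y \<odot> ?x2)"
    using i by (simp add: comp_assoc_arr[symmetric, of ?y ?x1] same_colour_X(2) expand)
      (simp add: comp_assoc_arr)
  have *: "?y \<odot> (?x1 \<odot> ?g2) = ident C [i, i] \<oplus> ?x2 \<odot> (?g1 \<odot> ?y)"
    using i by (simp add: G_def expand y same_colour_X(1)) (simp add: same_colour_X(2) add_assoc_arr)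
  have q2: "?q2 \<odot> ?g2 = ident C [i, i]" "?x2' = ?q2 \<odot> ?x2"
    using i by (simp_all add: interchange_arr X'_def XQ)
  have g: "?g2 \<odot> (?g1 \<odot> ?y) = ?y \<odot> (?g1 \<odot> ?g2)"
    using i same_colour_GG[OF i] whisker_commute[of "G i" "G i" "[i]" "[i]" "[i]" "[i]"]
    by (simp add: comp_assoc_arr[symmetric])
  have x: "?g2 \<odot> ?x1' = ?x1' \<odot> ?g2" "?g1 \<odot> ?x1' = ?x1"
    using i whisker_commute[of "X' i" "G i" "[i]" "[i]" "[i]" "[i]"] by (simp_all add: interchange_arr)
  have "Y' i i \<odot> ?x1' = (?q2 \<odot> ?g2) \<odot> (?g1 \<odot> (?y \<odot> (?g2 \<odot> ?x1')))"
    using i by (simp add: q2 Y'_def comp_assoc_arr)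
  also have "\<dots> = ?q2 \<odot> ((?g2 \<odot> (?g1 \<odot> ?y)) \<odot> (?g2 \<odot> ?x1'))"
    using i by (simp add: comp_assoc_arr)
  also have "\<dots> = ?q2 \<odot> (?y \<odot> (?g1 \<odot> (?g2 \<odot> (?x1' \<odot> ?g2))))"
    unfolding g x using i by (simp add: comp_assoc_arr)
  also have "\<dots> = ?q2 \<odot> (?y \<odot> ((?g1 \<odot> ?x1') \<odot> (?g2 \<odot> ?g2)))"
    using i by (simp add: comp_assoc_arr comp_assoc_arr[symmetric, of ?g2 ?x1'] x(1))
  also have "\<dots> = ?q2 \<odot> ((?y \<odot> (?x1 \<odot> ?g2)) \<odot> ?g2)"
    unfolding x(2) using i by (simp add: comp_assoc_arr)
  also have "\<dots> = ident C [i, i] \<oplus> (?q2 \<odot> (?x2 \<odot> (?g1 \<odot> (?y \<odot> ?g2))))"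
    unfolding * using i by (simp add: comp_add_arr comp_assoc_arr q2(1))
  also have "?q2 \<odot> (?x2 \<odot> (?g1 \<odot> (?y \<odot> ?g2))) = ?x2' \<odot> Y' i i"
    unfolding q2(2) using i by (simp add: Y'_def comp_assoc_arr)
  finally show ?thesis
    using i by (simp add: difference_eq_iff)
qed

lemma double_same':
  assumes i: "i \<in> V"
  shows "Y' i i \<odot> Y' i i = zero C [i, i] [i, i]"
proof -
  let ?y = "Y i i" and ?g1 = "G i \<otimes> ident C [i]" and ?g2 = "ident C [i] \<otimes> G i"
  have g: "?g2 \<odot> (?g1 \<odot> ?y) = ?y \<odot> (?g1 \<odot> ?g2)"
    using i same_colour_GG[OF i] whisker_commute[of "G i" "G i" "[i]" "[i]" "[i]" "[i]"]
    by (simp add: comp_assoc_arr[symmetric])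
  have "Y' i i \<odot> Y' i i = ?g1 \<odot> (?y \<odot> ((?g2 \<odot> (?g1 \<odot> ?y)) \<odot> ?g2))"
    using i by (simp add: Y'_def comp_assoc_arr)
  also have "\<dots> = ?g1 \<odot> ((?y \<odot> ?y) \<odot> (?g1 \<odot> (?g2 \<odot> ?g2)))"
    unfolding g using i by (simp add: comp_assoc_arr)
  finally show ?thesis
    using i by (simp add: same_colour_X(3))
qed

lemma dot_slide':
  assumes ij: "i \<in> V" "j \<in> V" "i \<noteq> j"
  shows "(X' j \<otimes> ident C [i]) \<odot> Y' i j = Y' i j \<odot> (ident C [i] \<otimes> X' j)"
    "(ident C [j] \<otimes> X' i) \<odot> Y' i j = Y' i j \<odot> (X' i \<otimes> ident C [j])"
proof -
  note s = slidesD(5)[OF slides_X'[OF ij(2)], of i] slidesD(6)[OF slides_X'[OF ij(1)], of j]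
  have m: "(X' j \<otimes> ident C [i]) \<odot> (M i j \<otimes> ident C [i]) = (M i j \<otimes> ident C [i]) \<odot> (X' j \<otimes> ident C [i])"
    using ij by (simp add: interchange_arr M_commute)
  have c: "(ident C [j] \<otimes> X' i) \<odot> (M i j \<otimes> ident C [i]) = (M i j \<otimes> ident C [i]) \<odot> (ident C [j] \<otimes> X' i)"
    by (rule whisker_commute) (use ij in simp_all)
  show "(X' j \<otimes> ident C [i]) \<odot> Y' i j = Y' i j \<odot> (ident C [i] \<otimes> X' j)"
    "(ident C [j] \<otimes> X' i) \<odot> Y' i j = Y' i j \<odot> (X' i \<otimes> ident C [j])"
    using ij s by (simp_all add: Y'_def comp_assoc_arr m[THEN comp_reassoc] c[THEN comp_reassoc])
qed

lemma double_distinct: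
  assumes ij: "i \<in> V" "j \<in> V" "i \<noteq> j"
  shows "Y' j i \<odot> Y' i j = (M j i \<otimes> ident C [j]) \<odot> ((ident C [i] \<otimes> M i j) \<odot> (Y j i \<odot> Y i j))"
proof -
  have "Y' j i \<odot> Y' i j = (M j i \<otimes> ident C [j]) \<odot> ((Y j i \<odot> (M i j \<otimes> ident C [i])) \<odot> Y i j)"
    using ij by (simp add: Y'_def comp_assoc_arr)
  also have "Y j i \<odot> (M i j \<otimes> ident C [i]) = (ident C [i] \<otimes> M i j) \<odot> Y j i"
    using slidesD(6)[OF slides_M[OF ij(2), of i], of i] ij by simp
  finally show ?thesis
    using ij by (simp add: comp_assoc_arr)
qed

lemma double_distant':
  assumes ij: "i \<in> V" "j \<in> V" "i \<noteq> j" "\<not> adjacent E i j"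
  shows "Y' j i \<odot> Y' i j = ident C [i, j]"
  using ij ev_relation[OF klr_relation.double_distant, of i j "[i, j]" "[i, j]"]
  by (simp add: double_distinct arrow_iff M_def adjacent_commute[of j i])

text \<open>
  This is \<open>x\<^sub>1 / (1 - t x\<^sub>1) - x\<^sub>2 / (1 - t x\<^sub>2) = (x\<^sub>1 - x\<^sub>2) / ((1 - t x\<^sub>1) (1 - t x\<^sub>2))\<close>, in both signs.
\<close>

lemma Q_difference:
  assumes ij: "i \<in> V" "j \<in> V"
  shows "(Q i \<otimes> ident C [j]) \<odot> ((ident C [i] \<otimes> Q j) \<odot> ((X i \<otimes> ident C [j]) \<oplus> (- 1) \<cdot> (ident C [i] \<otimes> X j))) =
      (X' i \<otimes> ident C [j]) \<oplus> (- 1) \<cdot> (ident C [i] \<otimes> X' j)" 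
    and "(Q i \<otimes> ident C [j]) \<odot> ((ident C [i] \<otimes> Q j) \<odot> ((ident C [i] \<otimes> X j) \<oplus> (- 1) \<cdot> (X i \<otimes> ident C [j]))) =
      (ident C [i] \<otimes> X' j) \<oplus> (- 1) \<cdot> (X' i \<otimes> ident C [j])"
proof -
  let ?q1 = "Q i \<otimes> ident C [j]" and ?q2 = "ident C [i] \<otimes> Q j"
  let ?x1 = "X i \<otimes> ident C [j]" and ?x2 = "ident C [i] \<otimes> X j"
  let ?A = "X' i \<otimes> ident C [j]" and ?B = "ident C [i] \<otimes> X' j"
  let ?g1 = "G i \<otimes> ident C [j]" and ?g2 = "ident C [i] \<otimes> G j" and ?W = "T (?x1 \<odot> ?x2)"
  let ?w = "?q1 \<odot> (?q2 \<odot> ?W)"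
  have 1: "?g1 \<odot> ?x2 = ?x2 \<oplus> (- 1) \<cdot> ?W" "?x1 \<odot> ?g2 = ?x1 \<oplus> (- 1) \<cdot> ?W"
    using ij by (simp_all add: G_def expand)
  have q: "?q2 \<odot> ?g2 = ident C [i, j]" "?q1 \<odot> ?g1 = ident C [i, j]" "?A = ?q1 \<odot> ?x1" "?B = ?q2 \<odot> ?x2"
    using ij by (simp_all add: interchange_arr X'_def XQ)
  have c: "?q2 \<odot> ?x1 = ?x1 \<odot> ?q2" "?q2 \<odot> ?g1 = ?g1 \<odot> ?q2"
    by (rule whisker_commute; use ij in simp)+
  have "?A = ?q1 \<odot> (?x1 \<odot> (?q2 \<odot> ?g2))"
    unfolding q using ij by simp
  also have "\<dots> = ?q1 \<odot> (?q2 \<odot> (?x1 \<odot> ?g2))"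
    using ij by (simp add: c[THEN comp_reassoc])
  finally have A: "?A = ?q1 \<odot> (?q2 \<odot> ?x1) \<oplus> (- 1) \<cdot> ?w"
    unfolding 1 using ij by (simp add: comp_add_arr comp_scale_arr)
  have "?B = (?q1 \<odot> ?g1) \<odot> (?q2 \<odot> ?x2)"
    unfolding q using ij by simp
  also have "\<dots> = ?q1 \<odot> (?q2 \<odot> (?g1 \<odot> ?x2))"
    using ij by (simp add: c[THEN comp_reassoc] comp_assoc_arr)
  finally have B: "?B = ?q1 \<odot> (?q2 \<odot> ?x2) \<oplus> (- 1) \<cdot> ?w"
    unfolding 1 using ij by (simp add: comp_add_arr comp_scale_arr)
  show "?q1 \<odot> (?q2 \<odot> (?x1 \<oplus> (- 1) \<cdot> ?x2)) = ?A \<oplus> (- 1) \<cdot> ?B"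
    unfolding A B using ij
    by (subst sub_cancel(2)[where u = "[i, j]" and v = "[i, j]"]) (simp_all add: comp_add_arr comp_scale_arr)
  show "?q1 \<odot> (?q2 \<odot> (?x2 \<oplus> (- 1) \<cdot> ?x1)) = ?B \<oplus> (- 1) \<cdot> ?A"
    unfolding A B using ij
    by (subst sub_cancel(2)[where u = "[i, j]" and v = "[i, j]"]) (simp_all add: comp_add_arr comp_scale_arr)
qed

lemma double_edge':
  assumes "(i, j) \<in> E"
  shows "Y' j i \<odot> Y' i j = (X' i \<otimes> ident C [j]) \<oplus> (- 1) \<cdot> (ident C [i] \<otimes> X' j)"
    "Y' i j \<odot> Y' j i = (ident C [j] \<otimes> X' i) \<oplus> (- 1) \<cdot> (X' j \<otimes> ident C [i])"
proof -
  have ij: "i \<in> V" "j \<in> V" "i \<noteq> j" using edge_distinct[OF assms] by auto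
  have "adjacent E i j" "adjacent E j i" using assms by (auto simp: adjacent_def)
  then show "Y' j i \<odot> Y' i j = (X' i \<otimes> ident C [j]) \<oplus> (- 1) \<cdot> (ident C [i] \<otimes> X' j)"
    "Y' i j \<odot> Y' j i = (ident C [j] \<otimes> X' i) \<oplus> (- 1) \<cdot> (X' j \<otimes> ident C [i])"
    using ij ij(3)[symmetric] by (simp_all add: double_distinct double_edge[OF assms] M_def Q_difference)
qed

section \<open>The deformed generators: braid relations\<close>

text \<open>
  In \<open>strand1\<close>, \<open>strand2\<close> and \<open>strand3\<close> the argument \<open>m\<close> acts on the first, second or third of three strands, and
  the other arguments are the colours of the remaining strands in order. For crossings, \<open>i\<close>, \<open>j\<close>, \<open>k\<close> are the
  colours at the bottom.
\<close>

definition strand1 where "strand1 m j k = m \<otimes> ident C [j, k]"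
definition strand2 where "strand2 i m k = ident C [i] \<otimes> (m \<otimes> ident C [k])"
definition strand3 where "strand3 i j m = ident C [i, j] \<otimes> m"
definition cross1 where "cross1 i j k = Y i j \<otimes> ident C [k]"
definition cross2 where "cross2 i j k = ident C [i] \<otimes> Y j k"

lemmas strand_defs = strand1_def strand2_def strand3_def cross1_def cross2_def

lemma arr_strand [simp]:
  "arr m \<Longrightarrow> j \<in> V \<Longrightarrow> k \<in> V \<Longrightarrow> arr (strand1 m j k)"
  "arr m \<Longrightarrow> j \<in> V \<Longrightarrow> k \<in> V \<Longrightarrow> source (strand1 m j k) = source m @ [j, k]"
  "arr m \<Longrightarrow> j \<in> V \<Longrightarrow> k \<in> V \<Longrightarrow> target (strand1 m j k) = target m @ [j, k]"
  "arr m \<Longrightarrow> i \<in> V \<Longrightarrow> k \<in> V \<Longrightarrow> arr (strand2 i m k)"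
  "arr m \<Longrightarrow> i \<in> V \<Longrightarrow> k \<in> V \<Longrightarrow> source (strand2 i m k) = i # source m @ [k]"
  "arr m \<Longrightarrow> i \<in> V \<Longrightarrow> k \<in> V \<Longrightarrow> target (strand2 i m k) = i # target m @ [k]"
  "arr m \<Longrightarrow> i \<in> V \<Longrightarrow> j \<in> V \<Longrightarrow> arr (strand3 i j m)"
  "arr m \<Longrightarrow> i \<in> V \<Longrightarrow> j \<in> V \<Longrightarrow> source (strand3 i j m) = i # j # source m"
  "arr m \<Longrightarrow> i \<in> V \<Longrightarrow> j \<in> V \<Longrightarrow> target (strand3 i j m) = i # j # target m"
  by (simp_all add: strand_defs)

lemma arr_cross [simp]:
  assumes "i \<in> V" "j \<in> V" "k \<in> V"
  shows "arr (cross1 i j k)" "source (cross1 i j k) = [i, j, k]" "target (cross1 i j k) = [j, i, k]"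
    "arr (cross2 i j k)" "source (cross2 i j k) = [i, j, k]" "target (cross2 i j k) = [i, k, j]"
  using assms by (simp_all add: strand_defs)

lemma strand_ident [simp]:
  "i \<in> V \<Longrightarrow> j \<in> V \<Longrightarrow> k \<in> V \<Longrightarrow> strand1 (ident C [i]) j k = ident C [i, j, k]"
  "i \<in> V \<Longrightarrow> j \<in> V \<Longrightarrow> k \<in> V \<Longrightarrow> strand2 i (ident C [j]) k = ident C [i, j, k]"
  "i \<in> V \<Longrightarrow> j \<in> V \<Longrightarrow> k \<in> V \<Longrightarrow> strand3 i j (ident C [k]) = ident C [i, j, k]"
  by (simp_all add: strand_defs)

lemma strand_comp:
  "arr m \<Longrightarrow> arr n \<Longrightarrow> source m = target n \<Longrightarrow> j \<in> V \<Longrightarrow> k \<in> V \<Longrightarrow> strand1 (m \<odot> n) j k = strand1 m j k \<odot> strand1 n j k"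
  "arr m \<Longrightarrow> arr n \<Longrightarrow> source m = target n \<Longrightarrow> i \<in> V \<Longrightarrow> k \<in> V \<Longrightarrow> strand2 i (m \<odot> n) k = strand2 i m k \<odot> strand2 i n k"
  "arr m \<Longrightarrow> arr n \<Longrightarrow> source m = target n \<Longrightarrow> i \<in> V \<Longrightarrow> j \<in> V \<Longrightarrow> strand3 i j (m \<odot> n) = strand3 i j m \<odot> strand3 i j n"
  by (simp_all add: strand_defs interchange_arr)

lemma two_to_three:
  assumes "arr m" "i \<in> V" "j \<in> V"
  shows "(m \<otimes> ident C [i]) \<otimes> ident C [j] = strand1 m i j"
    "(ident C [i] \<otimes> m) \<otimes> ident C [j] = strand2 i m j"
    "ident C [i] \<otimes> (m \<otimes> ident C [j]) = strand2 i m j"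
    "ident C [i] \<otimes> (ident C [j] \<otimes> m) = strand3 i j m"
  using assms by (simp_all add: strand_defs tensor_assoc_arr tensor_assoc_arr[symmetric, of "ident C [i]" "ident C [j]"])

lemma strand_commute:
  assumes "arr m" "source m = [i]" "target m = [i]" "arr n" "source n = [j]" "target n = [j]"
    and "i \<in> V" "j \<in> V" "k \<in> V"
  shows "strand2 i n k \<odot> strand1 m j k = strand1 m j k \<odot> strand2 i n k"
    and "strand3 i k n \<odot> strand1 m k j = strand1 m k j \<odot> strand3 i k n"
    and "strand3 k i n \<odot> strand2 k m j = strand2 k m j \<odot> strand3 k i n"
proof -
  show "strand2 i n k \<odot> strand1 m j k = strand1 m j k \<odot> strand2 i n k"
    using whisker_commute[of m "n \<otimes> ident C [k]" "[i]" "[i]" "[j, k]" "[j, k]"] assms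
    by (simp add: strand_defs)
  show "strand3 i k n \<odot> strand1 m k j = strand1 m k j \<odot> strand3 i k n"
    using whisker_commute[of m "ident C [k] \<otimes> n" "[i]" "[i]" "[k, j]" "[k, j]"] assms
    by (simp add: strand1_def two_to_three)
  show "strand3 k i n \<odot> strand2 k m j = strand2 k m j \<odot> strand3 k i n"
    using whisker_commute[of m n "[i]" "[i]" "[j]" "[j]"] assms
    by (simp add: two_to_three(3,4)[symmetric] interchange_arr)
qed

lemma cross_far:
  assumes "arr m" "i \<in> V" "j \<in> V" "k \<in> V"
  shows "source m = [k] \<Longrightarrow> target m = [k] \<Longrightarrow> cross1 i j k \<odot> strand3 i j m = strand3 j i m \<odot> cross1 i j k"
    and "source m = [i] \<Longrightarrow> target m = [i] \<Longrightarrow> cross2 i j k \<odot> strand1 m j k = strand1 m k j \<odot> cross2 i j k"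
  using whisker_commute[of "Y i j" m "[i, j]" "[j, i]" "[k]" "[k]"]
    whisker_commute[of m "Y j k" "[i]" "[i]" "[j, k]" "[k, j]"] assms
  by (simp_all add: strand_defs)

lemma cross_slide:
  assumes "i \<in> V" "j \<in> V" "k \<in> V"
  shows "slides j m \<Longrightarrow> i \<noteq> j \<Longrightarrow> cross1 i j k \<odot> strand2 i m k = strand1 m i k \<odot> cross1 i j k"
    and "slides i m \<Longrightarrow> i \<noteq> j \<Longrightarrow> cross1 i j k \<odot> strand1 m j k = strand2 j m k \<odot> cross1 i j k"
    and "slides k m \<Longrightarrow> j \<noteq> k \<Longrightarrow> cross2 i j k \<odot> strand3 i j m = strand2 i m j \<odot> cross2 i j k"
    and "slides j m \<Longrightarrow> j \<noteq> k \<Longrightarrow> cross2 i j k \<odot> strand2 i m k = strand3 i k m \<odot> cross2 i j k"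
proof -
  show "cross1 i j k \<odot> strand2 i m k = strand1 m i k \<odot> cross1 i j k" if "slides j m" "i \<noteq> j"
    using slidesD(5)[OF that(1) assms(1) that(2)] slidesD(1-3)[OF that(1)] assms
    by (simp add: cross1_def two_to_three(1,2)[symmetric] interchange_arr)
  show "cross1 i j k \<odot> strand1 m j k = strand2 j m k \<odot> cross1 i j k" if "slides i m" "i \<noteq> j"
    using slidesD(6)[OF that(1) assms(2)] slidesD(1-3)[OF that(1)] that(2) assms
    by (simp add: cross1_def two_to_three(1,2)[symmetric] interchange_arr)
  show "cross2 i j k \<odot> strand3 i j m = strand2 i m j \<odot> cross2 i j k" if "slides k m" "j \<noteq> k"
    using slidesD(5)[OF that(1) assms(2) that(2)] slidesD(1-3)[OF that(1)] assms
    by (simp add: cross2_def two_to_three(3,4)[symmetric] interchange_arr)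
  show "cross2 i j k \<odot> strand2 i m k = strand3 i k m \<odot> cross2 i j k" if "slides j m" "j \<noteq> k"
    using slidesD(6)[OF that(1) assms(3)] slidesD(1-3)[OF that(1)] that(2) assms
    by (simp add: cross2_def two_to_three(3,4)[symmetric] interchange_arr)
qed

lemma cross':
  assumes "i \<in> V" "j \<in> V" "k \<in> V"
  shows "i \<noteq> j \<Longrightarrow> Y' i j \<otimes> ident C [k] = strand1 (M i j) i k \<odot> cross1 i j k"
    and "i \<noteq> j \<Longrightarrow> ident C [k] \<otimes> Y' i j = strand2 k (M i j) i \<odot> cross2 k i j"
    and "Y' i i \<otimes> ident C [k] = strand1 (G i) i k \<odot> (cross1 i i k \<odot> strand2 i (G i) k)"
    and "ident C [k] \<otimes> Y' i i = strand2 k (G i) i \<odot> (cross2 k i i \<odot> strand3 k i (G i))"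
  using assms
  by (simp_all add: Y'_def cross1_def cross2_def whisker_comp two_to_three)

text \<open>
  These rules move endomorphisms of strands towards the top and sort them by position. They stop below a
  crossing of two strands of one colour, where the rules for equal colours take over.
\<close>

lemmas move_up = cross_far cross_far[THEN comp_reassoc] cross_slide cross_slide[THEN comp_reassoc]
  strand_commute strand_commute[THEN comp_reassoc]

abbreviation (input) "braid121 i j k \<equiv> cross1 j k i \<odot> (cross2 j i k \<odot> cross1 i j k)"
abbreviation (input) "braid212 i j k \<equiv> cross2 k i j \<odot> (cross1 i k j \<odot> cross2 i j k)"
abbreviation (input) "braid121' i j k \<equiv>
  (Y' j k \<otimes> ident C [i]) \<odot> ((ident C [j] \<otimes> Y' i k) \<odot> (Y' i j \<otimes> ident C [k]))"
abbreviation (input) "braid212' i j k \<equiv>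
  (ident C [k] \<otimes> Y' i j) \<odot> ((Y' i k \<otimes> ident C [j]) \<odot> (ident C [i] \<otimes> Y' j k))"

lemma braid:
  assumes "i \<in> V" "j \<in> V" "k \<in> V" "\<not> (i = k \<and> adjacent E i j)"
  shows "braid121 i j k = braid212 i j k"
  using ev_relation[OF klr_relation.braid[OF assms(4)], of "[i, j, k]" "[k, j, i]"] assms
  by (simp add: arrow_iff cross1_def cross2_def)

lemma M_G_commute: "k \<in> V \<Longrightarrow> M i k \<odot> G k = G k \<odot> M i k"
  by (simp add: M_def)

text \<open>
  All factors slide to the top, where the two sides carry the same factors.
\<close>

lemma braid_distinct':
  assumes V: "i \<in> V" "j \<in> V" "k \<in> V" and "i \<noteq> j" "j \<noteq> k" "i \<noteq> k"
  shows "braid121' i j k = braid212' i j k"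
proof -
  have "braid121' i j k = strand1 (M j k \<odot> M i k) j i \<odot> (strand2 k (M i j) i \<odot> braid121 i j k)"
    using assms by (simp add: cross' comp_assoc_arr move_up slides_M strand_comp)
  moreover have "braid212' i j k = strand1 (M i k \<odot> M j k) j i \<odot> (strand2 k (M i j) i \<odot> braid212 i j k)"
    using assms by (simp add: cross' comp_assoc_arr move_up slides_M strand_comp)
  ultimately show ?thesis
    using braid[of i j k] M_commute(1)[of k i j] assms by simp
qed

text \<open>
  The element \<open>M \<otimes> M\<close> is the identity or the inverse of \<open>g\<^sub>1 g\<^sub>2\<close>, which commutes with the crossing.
\<close>

lemma same_colour_MM:
  assumes "k \<in> V"
  shows "Y k k \<odot> ((M i k \<otimes> ident C [k]) \<odot> (ident C [k] \<otimes> M i k)) =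
    ((M i k \<otimes> ident C [k]) \<odot> (ident C [k] \<otimes> M i k)) \<odot> Y k k"
proof (cases "adjacent E i k")
  case True
  have "Y k k \<odot> ((Q k \<otimes> ident C [k]) \<odot> (ident C [k] \<otimes> Q k)) =
      ((Q k \<otimes> ident C [k]) \<odot> (ident C [k] \<otimes> Q k)) \<odot> Y k k"
  proof (rule commute_inverse[where g = "(G k \<otimes> ident C [k]) \<odot> (ident C [k] \<otimes> G k)" and u = "[k, k]"])
    show "Y k k \<odot> ((G k \<otimes> ident C [k]) \<odot> (ident C [k] \<otimes> G k)) = ((G k \<otimes> ident C [k]) \<odot> (ident C [k] \<otimes> G k)) \<odot> Y k k"
      using same_colour_GG[OF assms] assms by (simp add: comp_assoc_arr)
  qed (use assms in \<open>simp_all add: interchange_arr\<close>)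
  with True show ?thesis by (simp add: M_def)
qed (use assms in \<open>simp add: M_def\<close>)

text \<open>
  The crossing of equal colours carries \<open>g\<close> on one strand, at the top and at the bottom. That strand crosses the
  third one by a rule for distinct colours, so both factors \<open>g\<close> can be moved to the ends of the strand.
\<close>

lemma braid_left_equal':
  assumes "i \<in> V" "k \<in> V" "i \<noteq> k"
  shows "braid121' i i k = braid212' i i k"
proof -
  have "braid121' i i k = strand1 (M i k) i i \<odot> (strand1 (M i k) i i \<odot>
      (strand2 k (G i) i \<odot> (braid121 i i k \<odot> strand2 i (G i) k)))"
    using assms by (simp add: cross' comp_assoc_arr move_up slides_M slides_G)
  also have "\<dots> = strand1 (M i k) i i \<odot> (strand1 (M i k) i i \<odot>
      (strand2 k (G i) i \<odot> (braid212 i i k \<odot> strand2 i (G i) k)))"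
    using braid[of i i k] assms by simp
  also have "\<dots> = braid212' i i k"
    using assms by (simp add: cross' comp_assoc_arr move_up slides_M slides_G)
  finally show ?thesis .
qed

text \<open>
  In one composite the factors from the crossings of distinct colours lie below the crossing of equal
  colours, but they occur there on both strands and pass through it together.
\<close>

lemma braid_right_equal':
  assumes "i \<in> V" "k \<in> V" "i \<noteq> k"
  shows "braid121' i k k = braid212' i k k"
proof -
  have MM: "cross1 k k i \<odot> (strand1 (M i k) k i \<odot> strand2 k (M i k) i) =
      strand1 (M i k) k i \<odot> (strand2 k (M i k) i \<odot> cross1 k k i)"
    using same_colour_MM[OF assms(2), of i] assms
    by (simp add: cross1_def two_to_three(1,2)[symmetric] interchange_arr comp_assoc_arr)
      (simp add: interchange_arr comp_assoc_arr[symmetric])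
  have "braid121' i k k = strand1 (G k) k i \<odot> (cross1 k k i \<odot> (strand1 (M i k) k i \<odot>
      (strand2 k (G k \<odot> M i k) i \<odot> (cross2 k i k \<odot> cross1 i k k))))"
    using assms by (simp add: cross' comp_assoc_arr move_up slides_M slides_G strand_comp)
  also have "\<dots> = strand1 (G k) k i \<odot> ((cross1 k k i \<odot> (strand1 (M i k) k i \<odot> strand2 k (M i k) i)) \<odot>
      (strand2 k (G k) i \<odot> (cross2 k i k \<odot> cross1 i k k)))"
    unfolding M_G_commute[OF assms(2), symmetric] using assms by (simp add: comp_assoc_arr strand_comp)
  also have "\<dots> = strand1 (G k \<odot> M i k) k i \<odot> (strand2 k (M i k) i \<odot> (braid121 i k k \<odot> strand3 i k (G k)))"
    unfolding MM using assms by (simp add: comp_assoc_arr strand_comp move_up slides_G)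
  also have "\<dots> = strand1 (M i k \<odot> G k) k i \<odot> (strand2 k (M i k) i \<odot> (braid212 i k k \<odot> strand3 i k (G k)))"
    unfolding M_G_commute[OF assms(2), symmetric] using braid[of i k k] assms by simp
  also have "\<dots> = braid212' i k k"
    using assms by (simp add: cross' comp_assoc_arr move_up slides_M slides_G strand_comp)
  finally show ?thesis .
qed

lemma braid_outer_equal':
  assumes "i \<in> V" "j \<in> V" "i \<noteq> j" "\<not> adjacent E i j"
  shows "braid121' i j i = braid212' i j i"
proof -
  have M: "M i j = ident C [j]" "M j i = ident C [i]"
    using assms(4) by (simp_all add: M_def adjacent_commute)
  have "braid121' i j i = strand1 (G i) j i \<odot> (braid121 i j i \<odot> strand3 i j (G i))"
    using assms assms(3)[symmetric] by (simp add: cross' comp_assoc_arr move_up slides_G M)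
  also have "\<dots> = strand1 (G i) j i \<odot> (braid212 i j i \<odot> strand3 i j (G i))"
    using braid[of i j i] assms by simp
  also have "\<dots> = braid212' i j i"
    using assms assms(3)[symmetric] by (simp add: cross' comp_assoc_arr move_up slides_G M)
  finally show ?thesis .
qed

lemma same_colour_G3:
  assumes "i \<in> V" "k \<in> V"
  shows "cross1 i i k \<odot> strand2 i (G i) k = strand1 (G i) i k \<odot> cross1 i i k \<oplus> T (ident C [i, i, k])"
    "cross2 k i i \<odot> strand3 k i (G i) = strand2 k (G i) i \<odot> cross2 k i i \<oplus> T (ident C [k, i, i])"
proof -
  note w = same_colour_G(1)[OF assms(1)]
  have "cross1 i i k \<odot> strand2 i (G i) k = (Y i i \<odot> (ident C [i] \<otimes> G i)) \<otimes> ident C [k]"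
    using assms by (simp add: cross1_def two_to_three(1,2)[symmetric] interchange_arr)
  also have "\<dots> = strand1 (G i) i k \<odot> cross1 i i k \<oplus> T (ident C [i, i, k])"
    unfolding w using assms by (simp add: cross1_def two_to_three(1,2)[symmetric] tensor_add_arr T_arr whisker_comp)
  finally show "cross1 i i k \<odot> strand2 i (G i) k = strand1 (G i) i k \<odot> cross1 i i k \<oplus> T (ident C [i, i, k])" .
  have "cross2 k i i \<odot> strand3 k i (G i) = ident C [k] \<otimes> (Y i i \<odot> (ident C [i] \<otimes> G i))"
    using assms by (simp add: cross2_def two_to_three(3,4)[symmetric] interchange_arr)
  also have "\<dots> = strand2 k (G i) i \<odot> cross2 k i i \<oplus> T (ident C [k, i, i])"
    unfolding w using assms by (simp add: cross2_def two_to_three(3,4)[symmetric] tensor_add_arr T_arr whisker_comp)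
  finally show "cross2 k i i \<odot> strand3 k i (G i) = strand2 k (G i) i \<odot> cross2 k i i \<oplus> T (ident C [k, i, i])" .
qed

text \<open>
  With \<open>c\<^sub>1\<close>, \<open>c\<^sub>2\<close> the crossings and \<open>g\<^sub>1\<close>, \<open>g\<^sub>2\<close>, \<open>g\<^sub>3\<close> the factors on the strands, both sides are
  \<open>g\<^sub>1 g\<^sub>1 g\<^sub>2 Z g\<^sub>2 g\<^sub>3\<close> for the common expression \<open>Z = g\<^sub>1 c\<^sub>1 c\<^sub>2 c\<^sub>1 + t c\<^sub>2 c\<^sub>1\<close>. On the side of \<open>c\<^sub>2 c\<^sub>1 c\<^sub>2\<close> the other terms
  contain \<open>c\<^sub>2 c\<^sub>2 = 0\<close>.
\<close>

lemma braid_equal':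
  assumes i: "i \<in> V"
  shows "braid121' i i i = braid212' i i i"
proof -
  let ?g1 = "strand1 (G i) i i" and ?g2 = "strand2 i (G i) i" and ?g3 = "strand3 i i (G i)"
  let ?c1 = "cross1 i i i" and ?c2 = "cross2 i i i" and ?e = "ident C [i, i, i]"
  let ?Z = "?g1 \<odot> braid121 i i i \<oplus> T (?c2 \<odot> ?c1)"
  have c: "?g3 \<odot> ?c1 = ?c1 \<odot> ?g3" "?c2 \<odot> ?g1 = ?g1 \<odot> ?c2" "?g2 \<odot> ?g1 = ?g1 \<odot> ?g2" "?g3 \<odot> ?g1 = ?g1 \<odot> ?g3"
    "?g3 \<odot> ?g2 = ?g2 \<odot> ?g3"
    using i by (simp_all add: move_up)
  have sym: "?c1 \<odot> (?g1 \<odot> ?g2) = ?g1 \<odot> (?g2 \<odot> ?c1)"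
    using same_colour_GG[OF i] i
    by (simp add: cross1_def two_to_three(1,2)[symmetric] interchange_arr)
  have sym2: "?g2 \<odot> (?g3 \<odot> ?c2) = ?c2 \<odot> (?g2 \<odot> ?g3)"
    using same_colour_GG[OF i] i
    by (simp add: cross2_def two_to_three(3,4)[symmetric] interchange_arr)
  have nil: "?c2 \<odot> ?c2 = zero C [i, i, i] [i, i, i]"
    using i same_colour_X(3)[OF i] by (simp add: cross2_def interchange_arr)
  note G3 = same_colour_G3[OF i i]
  have br: "?c2 \<odot> (?c1 \<odot> ?c2) = ?c1 \<odot> (?c2 \<odot> ?c1)"
    using braid[OF i i i] edge_distinct[of i i] unfolding adjacent_def by metis
  have "braid121' i i i = ?g1 \<odot> ((?c1 \<odot> (?g1 \<odot> ?g2)) \<odot> (?g2 \<odot> (?c2 \<odot> (?c1 \<odot> (?g2 \<odot> ?g3)))))"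
    using i by (simp add: cross' comp_assoc_arr c c[THEN comp_reassoc])
  also have "\<dots> = ?g1 \<odot> (?g1 \<odot> (?g2 \<odot> (((?c1 \<odot> ?g2) \<odot> (?c2 \<odot> ?c1)) \<odot> (?g2 \<odot> ?g3))))"
    unfolding sym using i by (simp add: comp_assoc_arr)
  also have "(?c1 \<odot> ?g2) \<odot> (?c2 \<odot> ?c1) = ?Z"
    unfolding G3 using i by (simp add: comp_add_arr T_arr comp_assoc_arr)
  finally have 1: "braid121' i i i = ?g1 \<odot> (?g1 \<odot> (?g2 \<odot> (?Z \<odot> (?g2 \<odot> ?g3))))" .
  have T0: "T (zero C [i, i, i] [i, i, i]) = zero C [i, i, i] [i, i, i]"
    using T_arr(2)[of ?e 0] i by (simp add: scale_zero_arr)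
  \<comment> \<open>the term with \<open>t\<close> that \<open>c\<^sub>1 g\<^sub>2\<close> produces is a multiple of \<open>c\<^sub>2 c\<^sub>2\<close>\<close>
  have 2: "?c2 \<odot> ((?c1 \<odot> ?g2) \<odot> ?c2) = ?g1 \<odot> braid212 i i i"
    unfolding G3 using i by (simp add: comp_add_arr T_arr comp_assoc_arr c(2)[THEN comp_reassoc] nil T0)
  have "braid212 i i i \<odot> ?g3 = ?c2 \<odot> (?c1 \<odot> (?c2 \<odot> ?g3))"
    using i by (simp add: comp_assoc_arr)
  also have "\<dots> = ?c2 \<odot> ((?c1 \<odot> ?g2) \<odot> ?c2) \<oplus> T (?c2 \<odot> ?c1)"
    unfolding G3(2) using i by (simp add: comp_add_arr T_arr comp_assoc_arr)
  finally have 3: "braid212 i i i \<odot> ?g3 = ?Z"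
    unfolding 2 br .
  have "braid212' i i i = ?g1 \<odot> (?g2 \<odot> (?c2 \<odot> ((?c1 \<odot> ?g2) \<odot> ((?g2 \<odot> (?g3 \<odot> ?c2)) \<odot> ?g3))))"
    using i by (simp add: cross' comp_assoc_arr c c[THEN comp_reassoc])
  also have "\<dots> = ?g1 \<odot> (?g2 \<odot> ((?c2 \<odot> ((?c1 \<odot> ?g2) \<odot> ?c2)) \<odot> (?g3 \<odot> (?g2 \<odot> ?g3))))"
    unfolding sym2 using i by (simp add: comp_assoc_arr c(5)[THEN comp_reassoc])
  also have "\<dots> = ?g1 \<odot> (?g1 \<odot> (?g2 \<odot> ((braid212 i i i \<odot> ?g3) \<odot> (?g2 \<odot> ?g3))))"
    unfolding 2 using i by (simp add: comp_assoc_arr c(3)[THEN comp_reassoc])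
  also have "\<dots> = braid121' i i i"
    unfolding 1 3 ..
  finally show ?thesis ..
qed

lemma add_cancel_middle:
  assumes "m \<oplus> n = zero C u v" "arr m" "arr n" "arr p" "arr q" "arr z"
    "source m = u" "source n = u" "source p = u" "source q = u" "source z = u"
    "target m = v" "target n = v" "target p = v" "target q = v" "target z = v"
  shows "(p \<oplus> m) \<oplus> (z \<oplus> (n \<oplus> q)) = z \<oplus> (p \<oplus> q)"
proof -
  have "m \<oplus> (n \<oplus> q) = q"
    using assms add_assoc_arr[of m n q] by simp
  then have "z \<oplus> (p \<oplus> (m \<oplus> (n \<oplus> q))) = z \<oplus> (p \<oplus> q)" by simp
  moreover have "(p \<oplus> m) \<oplus> (z \<oplus> (n \<oplus> q)) = z \<oplus> (p \<oplus> (m \<oplus> (n \<oplus> q)))"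
    using assms(2-) by (simp add: add_assoc_arr add_left_comm_arr)
  ultimately show ?thesis by simp
qed

lemma braid_edge:
  assumes "(i, j) \<in> E"
  shows "braid121 i j i = ident C [i, j, i] \<oplus> braid212 i j i"
    "braid121 j i j = (- 1) \<cdot> ident C [j, i, j] \<oplus> braid212 j i j"
  using edge_distinct[OF assms] ev_relation[OF klr_relation.braid_tail_head[OF assms], of "[i, j, i]" "[i, j, i]"]
    ev_relation[OF klr_relation.braid_head_tail[OF assms], of "[j, i, j]" "[j, i, j]"]
  by (simp_all add: arrow_iff cross1_def cross2_def difference_eq_iff)

text \<open>
  The colours \<open>i\<close>, \<open>j\<close>, \<open>i\<close>, with the sign \<open>c\<close> of the braid relation for either orientation of the edge. Let \<open>B\<close> and \<open>B'\<close>
  be the two braids. The deformed braids are \<open>q\<^sub>2 B g\<^sub>3\<close> and \<open>q\<^sub>2 g\<^sub>1 B'\<close>. Moving \<open>g\<^sub>3\<close> up through \<open>B'\<close>, it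
  meets the crossing of equal colours and leaves the double crossing of \<open>i\<close> and \<open>j\<close> behind, which is
  \<open>c (x\<^sub>3 - x\<^sub>2)\<close>. Together with \<open>B = B' + c\<close> this gives \<open>B g\<^sub>3 = g\<^sub>1 B' + c (g\<^sub>3 + t (x\<^sub>3 - x\<^sub>2)) = g\<^sub>1 B' + c g\<^sub>2\<close>.
\<close>

lemma braid_adjacent':
  assumes V: "i \<in> V" "j \<in> V" "i \<noteq> j" and adj: "adjacent E i j"
    and braid: "braid121 i j i = c \<cdot> ident C [i, j, i] \<oplus> braid212 i j i"
    and double: "Y i j \<odot> Y j i = c \<cdot> (ident C [j] \<otimes> X i) \<oplus> (- c) \<cdot> (X j \<otimes> ident C [i])"
  shows "braid121' i j i = c \<cdot> ident C [i, j, i] \<oplus> braid212' i j i"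
proof -
  let ?q1 = "strand1 (Q i) j i" and ?g1 = "strand1 (G i) j i" and ?g2 = "strand2 i (G j) i" and ?q2 = "strand2 i (Q j) i"
  let ?x2 = "strand2 i (X j) i" and ?x3 = "strand3 i j (X i)" and ?g3 = "strand3 i j (G i)"
  let ?e = "ident C [i, j, i]" and ?c1 = "cross1 i i j" and ?c2 = "cross2 i j i" and ?c2' = "cross2 i i j"
  have M: "M i j = Q j" "M j i = Q i"
    using adj by (simp_all add: M_def adjacent_commute)
  have inv: "?q1 \<odot> ?g1 = ?e" "?q2 \<odot> ?g2 = ?e" "strand2 i (G i) j \<odot> strand2 i (Q i) j = ident C [i, i, j]"
    using V by (simp_all add: strand_comp[symmetric])
  have c2c2: "?c2' \<odot> ?c2 = c \<cdot> ?x3 \<oplus> (- c) \<cdot> ?x2"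
    using V by (simp add: cross2_def interchange_arr double tensor_add_arr tensor_scale_arr two_to_three)
  have g: "?g2 = ?e \<oplus> (- 1) \<cdot> T ?x2" "?g3 = ?e \<oplus> (- 1) \<cdot> T ?x3"
    using V by (simp_all add: G_def strand_defs expand)
  have "braid212 i j i \<odot> ?g3 = ?c2' \<odot> ((?c1 \<odot> strand2 i (G i) j) \<odot> ?c2)"
    using V V(3)[symmetric] by (simp add: comp_assoc_arr move_up slides_G)
  also have "\<dots> = ?g1 \<odot> braid212 i j i \<oplus> T (?c2' \<odot> ?c2)"
    unfolding same_colour_G3(1)[OF V(1,2)] using V by (simp add: comp_assoc_arr comp_add_arr T_arr move_up)
  also have "T (?c2' \<odot> ?c2) = c \<cdot> T ?x3 \<oplus> (- c) \<cdot> T ?x2"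
    unfolding c2c2 using V by (simp add: T_arr)
  finally have "braid121 i j i \<odot> ?g3 = (c \<cdot> ?e \<oplus> (- c) \<cdot> T ?x3) \<oplus> (?g1 \<odot> braid212 i j i \<oplus> (c \<cdot> T ?x3 \<oplus> (- c) \<cdot> T ?x2))"
    using V unfolding braid by (simp add: comp_add_arr comp_scale_arr) (simp add: g(2) scale_add_arr)
  also have "\<dots> = ?g1 \<odot> braid212 i j i \<oplus> (c \<cdot> ?e \<oplus> (- c) \<cdot> T ?x2)"
  proof (rule add_cancel_middle)
    show "(- c) \<cdot> T ?x3 \<oplus> c \<cdot> T ?x3 = zero C [i, j, i] [i, j, i]"
      using V scale_left[OF arr_hom[of "T ?x3"], of "- c" c] by (simp add: scale_zero_arr)
  qed (use V in simp_all)
  also have "c \<cdot> ?e \<oplus> (- c) \<cdot> T ?x2 = c \<cdot> ?g2"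
    unfolding g(1) using V by (simp add: scale_add_arr)
  finally have key: "braid121 i j i \<odot> ?g3 = ?g1 \<odot> braid212 i j i \<oplus> c \<cdot> ?g2" .
  have "braid121' i j i = (?q1 \<odot> ?g1) \<odot> (?q2 \<odot> (braid121 i j i \<odot> ?g3))"
    using V V(3)[symmetric] by (simp add: cross' comp_assoc_arr move_up slides_G slides_Q M)
  also have "\<dots> = ?q2 \<odot> (?g1 \<odot> braid212 i j i) \<oplus> c \<cdot> ?e"
    unfolding key inv(1) using V by (simp add: comp_add_arr comp_scale_arr inv(2))
  also have "?q2 \<odot> (?g1 \<odot> braid212 i j i) =
      ?q2 \<odot> (?c2' \<odot> (strand1 (G i) i j \<odot> (?c1 \<odot> ((strand2 i (G i) j \<odot> strand2 i (Q i) j) \<odot> ?c2))))"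
    unfolding inv(3) using V by (simp add: move_up)
  also have "\<dots> = braid212' i j i"
    using V V(3)[symmetric] by (simp add: cross' comp_assoc_arr M)
  finally show ?thesis
    using V by (simp add: add_comm_arr)
qed

lemma braid_edge':
  assumes "(i, j) \<in> E"
  shows "braid121' i j i = ident C [i, j, i] \<oplus> braid212' i j i"
    "braid121' j i j = (- 1) \<cdot> ident C [j, i, j] \<oplus> braid212' j i j"
proof -
  have V: "i \<in> V" "j \<in> V" "i \<noteq> j" "j \<noteq> i" using edge_distinct[OF assms] by auto
  have adj: "adjacent E i j" "adjacent E j i" using assms by (auto simp: adjacent_def)
  show "braid121' i j i = ident C [i, j, i] \<oplus> braid212' i j i"
    using braid_adjacent'[OF V(1-3) adj(1), of 1] V by (simp add: braid_edge[OF assms] double_edge(2)[OF assms])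
  show "braid121' j i j = (- 1) \<cdot> ident C [j, i, j] \<oplus> braid212' j i j"
    using V by (intro braid_adjacent'[OF V(2,1,4) adj(2), of "- 1"])
      (simp_all add: braid_edge[OF assms] double_edge(1)[OF assms] add_comm_arr)
qed

lemma braid':
  assumes "i \<in> V" "j \<in> V" "k \<in> V" "\<not> (i = k \<and> adjacent E i j)"
  shows "braid121' i j k = braid212' i j k"
proof -
  consider "i = j" "j = k" | "i = j" "j \<noteq> k" | "i \<noteq> j" "j = k" | "i \<noteq> j" "i = k" | "i \<noteq> j" "j \<noteq> k" "i \<noteq> k"
    by blast
  then show ?thesis
    using assms braid_equal' braid_left_equal' braid_right_equal' braid_outer_equal' braid_distinct'
    by cases simp_all
qed

theorem klr_model_deformed: "klr_model C V X' Y' E"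
proof unfold_locales
  show "X' i \<in> hom C [i] [i]" if "i \<in> V" for i
    using that by (simp add: hom_iff)
  show "Y' i j \<in> hom C [i, j] [j, i]" if "i \<in> V" "j \<in> V" for i j
    using that by (simp add: hom_iff)
  fix s t u v assume "klr_relation E s t" "arrow V u v s" "arrow V u v t"
  then show "evaluate C X' Y' s = evaluate C X' Y' t"
  proof induction
    case (dot_same_1 i)
    then show ?case using dot_same_1' by (simp add: arrow_iff)
  next
    case (dot_same_2 i)
    then show ?case using dot_same_2' by (simp add: arrow_iff)
  next
    case (dot_slide_1 i j)
    then show ?case using dot_slide'(1) by (simp add: arrow_iff)
  next
    case (dot_slide_2 i j)
    then show ?case using dot_slide'(2) by (simp add: arrow_iff)
  next
    case (double_same i)
    then show ?case using double_same' by (simp add: arrow_iff)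
  next
    case (double_distant i j)
    then show ?case using double_distant' by (simp add: arrow_iff)
  next
    case (double_tail_head i j)
    then show ?case using double_edge'(1) by simp
  next
    case (double_head_tail j i)
    then show ?case using double_edge'(2) by simp
  next
    case (braid i k j)
    then show ?case using braid' by (simp add: arrow_iff)
  next
    case (braid_tail_head i j)
    then show ?case
      using braid_edge'(1) edge_distinct[of i j] by (simp add: difference_eq_iff)
  next
    case (braid_head_tail j i)
    then show ?case
      using braid_edge'(2) edge_distinct[of j i] by (simp add: difference_eq_iff)
  qed
qed (simp_all add: words)

end

section \<open>Divided powers and products\<close>

text \<open>
  The substitution of \<open>s + t\<close> for \<open>t\<close>: the coefficient of \<open>s\<^sup>k t\<^sup>l\<close> in \<open>F (s + t)\<close>. Series in two variables are sequences
  of sequences, with the exponent \<open>l\<close> of the outer variable \<open>t\<close> first.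
\<close>

definition spread :: "(int \<Rightarrow> 'm \<Rightarrow> 'm) \<Rightarrow> (nat \<Rightarrow> 'm) \<Rightarrow> nat \<Rightarrow> nat \<Rightarrow> 'm" where
  "spread smul F = (\<lambda>l k. smul (int ((k + l) choose k)) (F (k + l)))"

context int_module begin

lemma t_times_plus:
  assumes "f \<in> sequences A" "g \<in> sequences A"
  shows "t_times smul (pointwise_plus addm f g) = pointwise_plus addm (t_times smul f) (t_times smul g)"
  using assms by (auto simp: t_times_def fun_eq_iff smul_right sequencesD split: nat.split)

lemma spread_closed: "F \<in> sequences A \<Longrightarrow> spread smul F \<in> sequences (sequences A)"
  by (auto simp: spread_def sequences_def smul_closed)

text \<open>
  From \<open>F = F\<^sub>0 + t (tail F)\<close>: the substituted series is \<open>F\<^sub>0 + (t + s) (tail F) (s + t)\<close>, by the rule of Pascal's triangle.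
\<close>

lemma spread_split:
  assumes "F \<in> sequences A"
  shows "spread smul F = pointwise_plus (pointwise_plus addm)
    (const_series (pointwise_smul smul) (const_series smul (F 0)))
    (pointwise_plus (pointwise_plus addm)
      (t_times (pointwise_smul smul) (spread smul (tail F)))
      (\<lambda>l. t_times smul (spread smul (tail F) l)))"
proof (intro ext)
  fix l k
  have F: "F n \<in> A" for n using assms by (rule sequencesD)
  show "spread smul F l k = pointwise_plus (pointwise_plus addm)
    (const_series (pointwise_smul smul) (const_series smul (F 0)))
    (pointwise_plus (pointwise_plus addm)
      (t_times (pointwise_smul smul) (spread smul (tail F)))
      (\<lambda>l. t_times smul (spread smul (tail F) l))) l k"
  proof (cases k)
    case k: 0
    show ?thesis
      by (cases l) (simp_all add: k F spread_def smul_one smul_smul plus_zero zero_plus smul_closed)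
  next
    case k: (Suc k')
    show ?thesis
    proof (cases l)
      case 0
      then show ?thesis
        by (simp add: k F spread_def smul_one smul_smul plus_zero zero_plus smul_closed)
    next
      case (Suc l')
      then show ?thesis
        using smul_left[OF F, of "int (Suc (k' + l') choose Suc k')" "int (Suc (k' + l') choose k')" "Suc (Suc (k' + l'))"]
        by (simp add: k F spread_def smul_smul zero_plus smul_closed plus_closed add.commute)
    qed
  qed
qed

end

context bilinear_operation begin

abbreviation "cau2 \<equiv> cauchy (pointwise_plus addm) cau"

text \<open>
  For a series in two variables this multiplies by the inner variable \<open>s\<close>.
\<close>

lemma cau2_inner_t_times:
  assumes "F \<in> sequences (sequences A)" "G \<in> sequences (sequences B)"
  shows "cau2 (\<lambda>l. t_times smul (F l)) G l = t_times smul (cau2 F G l)"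
proof -
  interpret S: bilinear_operation "sequences A" "sequences B" "sequences H" "pointwise_plus addm" "pointwise_smul smul" cau
    by (rule bilinear_operation_cauchy)
  show ?thesis
    using assms
  proof (induction l arbitrary: F)
    case 0
    then show ?case by (simp add: cauchy_t_times_left[OF sequencesD sequencesD])
  next
    case (Suc l)
    have c: "cau2 (tail F) G l \<in> sequences H" "cau (F 0) (G (Suc l)) \<in> sequences H"
      using Suc.prems by (auto intro!: S.cauchy_closed cauchy_sequences dest: sequencesD)
    have "cau (t_times smul (F 0)) (G (Suc l)) = t_times smul (cau (F 0) (G (Suc l)))"
      using Suc.prems by (intro cauchy_t_times_left sequencesD[of _ "sequences A"] sequencesD[of _ "sequences B"])
    then show ?case
      using Suc.IH[OF sequences_tail[OF Suc.prems(1)] Suc.prems(2)] H.t_times_plus[OF c]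
      unfolding cauchy.simps(2) by metis
  qed
qed

text \<open>
  The substitution is multiplicative. Split \<open>F (s + t) = F\<^sub>0 + (t + s) (tail F) (s + t)\<close> and use induction on the
  total degree for the product with the second summand; the two binomial coefficients add up.
\<close>

lemma cau2_spread:
  assumes "F \<in> sequences A" "G \<in> sequences B"
  shows "cau2 (spread smul F) (spread smul G) l k = int ((k + l) choose k) \<star> cau F G (k + l)"
proof -
  interpret S: bilinear_operation "sequences A" "sequences B" "sequences H" "pointwise_plus addm" "pointwise_smul smul" cau
    by (rule bilinear_operation_cauchy)
  show ?thesis
    using assms
  proof (induction "k + l" arbitrary: k l F rule: less_induct)
    case less
    let ?F = "spread smul (tail F)" and ?G = "spread smul G"
    let ?K = "const_series (pointwise_smul smul) (const_series smul (F 0))"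
    have F0: "F 0 \<in> A" and G: "\<And>n. G n \<in> B" using less.prems by (auto dest: sequencesD)
    have c: "?F \<in> sequences (sequences A)" "?G \<in> sequences (sequences B)"
      "?K \<in> sequences (sequences A)" "(\<lambda>l. t_times smul (?F l)) \<in> sequences (sequences A)"
      "t_times (pointwise_smul smul) ?F \<in> sequences (sequences A)"
      using less.prems A.spread_closed[OF sequences_tail] B.spread_closed F0
        S.A.const_series_closed[OF A.const_series_closed[OF F0]] S.A.t_times_closed A.t_times_closed
      by (auto simp: sequences_def[of "sequences A"])
    have K: "cau2 ?K ?G l k = int ((k + l) choose k) \<star> op (F 0) (G (k + l))"
      using c G F0 by (simp add: S.cauchy_constant_left A.const_series_closed cauchy_constant_left sequencesD)
        (simp add: spread_def op_smul_right)
    interpret SA: int_module "sequences (sequences A)" "pointwise_plus (pointwise_plus addm)" "pointwise_smul (pointwise_smul smul)"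
      by (rule S.A.int_module_sequences)
    have "cau2 (spread smul F) ?G l k = cau2 ?K ?G l k \<uplus>
        (t_times (pointwise_smul smul) (cau2 ?F ?G) l k \<uplus> t_times smul (cau2 ?F ?G l) k)"
      unfolding A.spread_split[OF less.prems(1)] S.cauchy_plus_left[OF c(3) SA.plus_closed[OF c(5,4)] c(2)]
        S.cauchy_plus_left[OF c(5,4,2)] S.cauchy_t_times_left[OF c(1,2)] cau2_inner_t_times[OF c(1,2)] ..
    also have "\<dots> = int ((k + l) choose k) \<star> cau F G (k + l)"
    proof -
      define Z where "Z = cau2 ?F ?G"
      define R where "R = cau (tail F) G"
      have IH: "Z l' k' = int ((k' + l') choose k') \<star> R (k' + l')" if "k' + l' < k + l" for k' l'
        unfolding Z_def R_def by (rule less.hyps[OF that sequences_tail[OF less.prems(1)] less.prems(2)])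
      have h: "R n \<in> H" "op (F 0) (G n) \<in> H" "Z n m \<in> H" for n m
        using less.prems F0 G cauchy_closed[of "tail F" G] op_closed S.cauchy_closed[OF c(1,2), of n]
        unfolding Z_def R_def by (auto dest: sequencesD)
      have R: "cau F G 0 = op (F 0) (G 0)" "cau F G (Suc n) = R n \<uplus> op (F 0) (G (Suc n))" for n
        unfolding R_def by simp_all
      show ?thesis
        unfolding K Z_def[symmetric]
      proof (cases k)
        case k: 0
        show "int ((k + l) choose k) \<star> op (F 0) (G (k + l)) \<uplus>
            (t_times (pointwise_smul smul) (Z) l k \<uplus> t_times smul (Z l) k) =
          int ((k + l) choose k) \<star> cau F G (k + l)"
          using IH[of k "l - 1"] h
          by (cases l) (simp_all add: k R H.smul_one H.smul_smul H.plus_zero H.zero_plus H.smul_closed H.plus_closed H.plus_comm del: cauchy.simps)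
      next
        case k: (Suc k')
        show "int ((k + l) choose k) \<star> op (F 0) (G (k + l)) \<uplus>
            (t_times (pointwise_smul smul) (Z) l k \<uplus> t_times smul (Z l) k) =
          int ((k + l) choose k) \<star> cau F G (k + l)"
        proof (cases l)
          case 0
          then show ?thesis
            using IH[of k' 0] h
            by (simp add: k R H.smul_one H.smul_smul H.plus_zero H.zero_plus H.smul_closed H.plus_closed H.plus_comm del: cauchy.simps)
        next
          case l: (Suc l')
          have "int (Suc (k' + l') choose Suc k') \<star> R (Suc (k' + l')) \<uplus>
              int (Suc (k' + l') choose k') \<star> R (Suc (k' + l')) =
            int (Suc (Suc (k' + l')) choose Suc k') \<star> R (Suc (k' + l'))"
            by (subst H.smul_left[OF h(1), symmetric]) (simp add: add.commute)
          moreover have "Z l' k = int (Suc (k' + l') choose Suc k') \<star> R (Suc (k' + l'))"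
            using IH[of k l'] by (simp add: k l)
          moreover have "Z l k' = int (Suc (k' + l') choose k') \<star> R (Suc (k' + l'))"
            using IH[of k' l] by (simp add: k l)
          ultimately have "t_times (pointwise_smul smul) (Z) l k \<uplus> t_times smul (Z l) k =
              int (Suc (Suc (k' + l')) choose Suc k') \<star> R (Suc (k' + l'))"
            by (simp only: k l t_times_const_series_simps)
          then show ?thesis
            using h(1)[of "Suc (k' + l')"] h(2)[of "Suc (Suc (k' + l'))"]
            by (simp add: k l R H.smul_right H.plus_comm H.smul_closed del: binomial_Suc_Suc cauchy.simps)
        qed
      qed
    qed
    finally show ?case .
  qed
qed

end

definition divided_power_law :: "(int \<Rightarrow> 'm \<Rightarrow> 'm) \<Rightarrow> (nat \<Rightarrow> 'm \<Rightarrow> 'm) \<Rightarrow> 'm \<Rightarrow> bool" where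
  "divided_power_law smul P f \<longleftrightarrow> (\<forall>k l. P k (P l f) = smul (int ((k + l) choose k)) (P (k + l) f))"

text \<open>
  By the Leibniz rule \<open>P k (P l (op a b))\<close> is the coefficient of \<open>s\<^sup>k t\<^sup>l\<close> in the product of two series in two
  variables. The hypotheses identify these factors as the exponentials of \<open>a\<close> and \<open>b\<close> at \<open>s + t\<close>, and the
  substitution is multiplicative.
\<close>

lemma (in bilinear_operation) divided_power_law_op:
  assumes P_A: "\<And>k x. x \<in> A \<Longrightarrow> P k x \<in> A" and P_B: "\<And>k x. x \<in> B \<Longrightarrow> P k x \<in> B"
    and P_plus: "\<And>k x y. x \<in> H \<Longrightarrow> y \<in> H \<Longrightarrow> P k (x \<uplus> y) = P k x \<uplus> P k y"
    and P_op: "\<And>k x y. x \<in> A \<Longrightarrow> y \<in> B \<Longrightarrow> P k (op x y) = cau (\<lambda>k. P k x) (\<lambda>k. P k y) k"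
    and a: "a \<in> A" "divided_power_law smul P a" and b: "b \<in> B" "divided_power_law smul P b"
  shows "divided_power_law smul P (op a b)"
  unfolding divided_power_law_def
proof (intro allI)
  fix k l
  have cau: "P k (cau F G l) = cau2 (\<lambda>l k. P k (F l)) (\<lambda>l k. P k (G l)) l k"
    if "F \<in> sequences A" "G \<in> sequences B" for F G
    using that
  proof (induction l arbitrary: F)
    case 0
    then show ?case by (simp add: P_op sequencesD)
  next
    case (Suc l)
    then show ?case
      using P_plus[OF cauchy_closed op_closed, of "tail F" G "F 0" "G (Suc l)" k l]
      by (simp add: P_op sequencesD)
  qed
  have F: "(\<lambda>k. P k a) \<in> sequences A" "(\<lambda>k. P k b) \<in> sequences B"
    using a b by (auto intro!: sequencesI P_A P_B)
  have "P k (P l (op a b)) = cau2 (spread smul (\<lambda>k. P k a)) (spread smul (\<lambda>k. P k b)) l k"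
    using a(2) b(2) unfolding P_op[OF a(1) b(1)] cau[OF F] by (simp add: divided_power_law_def spread_def)
  also have "\<dots> = int ((k + l) choose k) \<star> P (k + l) (op a b)"
    unfolding cau2_spread[OF F] P_op[OF a(1) b(1)] ..
  finally show "P k (P l (op a b)) = int ((k + l) choose k) \<star> P (k + l) (op a b)" .
qed

context linear_monoidal_category begin

lemma linear_operatorI:
  assumes "\<And>f. arr f \<Longrightarrow> arr (D f) \<and> source (D f) = source f \<and> target (D f) = target f"
    and "\<And>f g. arr f \<Longrightarrow> arr g \<Longrightarrow> source f = source g \<Longrightarrow> target f = target g \<Longrightarrow> D (f \<oplus> g) = D f \<oplus> D g"
    and "\<And>f c. arr f \<Longrightarrow> D (c \<cdot> f) = c \<cdot> D f"
  shows "linear_operator C D"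
  using assms by (auto simp: linear_operator_def hom_iff)

lemma linear_operatorD:
  assumes "linear_operator C D" "arr f"
  shows "arr (D f)" "source (D f) = source f" "target (D f) = target f" "D (c \<cdot> f) = c \<cdot> D f"
    "arr g \<Longrightarrow> source f = source g \<Longrightarrow> target f = target g \<Longrightarrow> D (f \<oplus> g) = D f \<oplus> D g"
proof -
  have "D f \<in> hom C (source f) (target f) \<and> (\<forall>g \<in> hom C (source f) (target f). D (f \<oplus> g) = D f \<oplus> D g) \<and>
      (\<forall>c. D (c \<cdot> f) = c \<cdot> D f)"
    using assms(1) arr_obj[OF assms(2)] arr_hom[OF assms(2)] unfolding linear_operator_def by blast
  then show "arr (D f)" "source (D f) = source f" "target (D f) = target f" "D (c \<cdot> f) = c \<cdot> D f"
    "arr g \<Longrightarrow> source f = source g \<Longrightarrow> target f = target g \<Longrightarrow> D (f \<oplus> g) = D f \<oplus> D g"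
    by (auto simp: hom_iff)
qed

lemma derivationI:
  assumes "linear_operator C D"
    and "\<And>f g. arr f \<Longrightarrow> arr g \<Longrightarrow> source f = target g \<Longrightarrow> D (f \<odot> g) = D f \<odot> g \<oplus> f \<odot> D g"
    and "\<And>f g. arr f \<Longrightarrow> arr g \<Longrightarrow> D (f \<otimes> g) = D f \<otimes> g \<oplus> f \<otimes> D g"
  shows "derivation C D"
  using assms by (auto simp: derivation_def hom_iff arr_def)

lemma derivationD:
  assumes "derivation C D"
  shows "linear_operator C D"
    "arr f \<Longrightarrow> arr g \<Longrightarrow> source f = target g \<Longrightarrow> D (f \<odot> g) = D f \<odot> g \<oplus> f \<odot> D g"
    "arr f \<Longrightarrow> arr g \<Longrightarrow> D (f \<otimes> g) = D f \<otimes> g \<oplus> f \<otimes> D g"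
proof -
  show "linear_operator C D" using assms by (simp add: derivation_def)
  show "D (f \<odot> g) = D f \<odot> g \<oplus> f \<odot> D g" if "arr f" "arr g" "source f = target g"
    using assms that arr_hom[of f] arr_hom[of g] arr_obj[of f] arr_obj[of g]
    unfolding derivation_def by metis
  show "D (f \<otimes> g) = D f \<otimes> g \<oplus> f \<otimes> D g" if "arr f" "arr g"
    using assms that unfolding derivation_def arr_def by blast
qed

lemmas linear_simps = linear_operatorD[OF derivationD(1)]

lemma derivation_scale:
  assumes "derivation C D"
  shows "derivation C (\<lambda>m. c \<cdot> D m)"
  by (intro derivationI linear_operatorI)
    (simp_all add: linear_simps[OF assms] derivationD(2,3)[OF assms] scale_add_arr comp_scale_arr tensor_scale_arr mult.commute)

text \<open>
  Here \<open>b\<close> and \<open>c\<close> are the mixed terms, such as \<open>D' f \<odot> D g\<close>, of \<open>D D' (f g)\<close> and \<open>D' D (f g)\<close>. They cancel.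
\<close>

lemma commutator_add:
  assumes "arr a" "arr a'" "arr b" "arr c" "arr d" "arr d'"
    and "source a = u" "source a' = u" "source b = u" "source c = u" "source d = u" "source d' = u"
    and "target a = v" "target a' = v" "target b = v" "target c = v" "target d = v" "target d' = v"
  shows "((a \<oplus> b) \<oplus> (c \<oplus> d)) \<oplus> (- 1) \<cdot> ((a' \<oplus> c) \<oplus> (b \<oplus> d')) = (a \<oplus> (- 1) \<cdot> a') \<oplus> (d \<oplus> (- 1) \<cdot> d')"
proof -
  define p q where "p = a \<oplus> (- 1) \<cdot> a'" and "q = d \<oplus> (- 1) \<cdot> d'"
  have pq: "arr p" "source p = u" "target p = v" "arr q" "source q = u" "target q = v"
    using assms by (simp_all add: p_def q_def)
  have "a = p \<oplus> a'" "d = q \<oplus> d'"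
    using difference_eq_iff[of a a' p] difference_eq_iff[of d d' q] assms pq p_def q_def by simp_all
  then show ?thesis
    unfolding p_def[symmetric] q_def[symmetric] using assms pq
    by (subst difference_eq_iff) (simp_all add: add_assoc_arr add_comm_arr add_left_comm_arr)
qed

lemma derivation_commutator:
  assumes D: "derivation C D" and D': "derivation C D'"
  shows "derivation C (\<lambda>m. D (D' m) \<oplus> (- 1) \<cdot> D' (D m))"
proof (intro derivationI linear_operatorI)
  note s = linear_simps[OF D] linear_simps[OF D']
  fix f g assume f: "arr f" and g: "arr g"
  show "D (D' (f \<otimes> g)) \<oplus> (- 1) \<cdot> D' (D (f \<otimes> g)) =
      (D (D' f) \<oplus> (- 1) \<cdot> D' (D f)) \<otimes> g \<oplus> f \<otimes> (D (D' g) \<oplus> (- 1) \<cdot> D' (D g))"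
    using f g
    by (simp add: derivationD(3)[OF D] derivationD(3)[OF D'] s tensor_add_arr tensor_scale_arr commutator_add[OF _ _ _ _ _ _ HOL.refl _ _ _ _ _ HOL.refl])
  show "D (D' (f \<odot> g)) \<oplus> (- 1) \<cdot> D' (D (f \<odot> g)) =
      (D (D' f) \<oplus> (- 1) \<cdot> D' (D f)) \<odot> g \<oplus> f \<odot> (D (D' g) \<oplus> (- 1) \<cdot> D' (D g))"
    if "source f = target g"
    using f g that
    by (simp add: derivationD(2)[OF D] derivationD(2)[OF D'] s comp_add_arr comp_scale_arr commutator_add[OF _ _ _ _ _ _ HOL.refl _ _ _ _ _ HOL.refl])
  show "D (D' (f \<oplus> g)) \<oplus> (- 1) \<cdot> D' (D (f \<oplus> g)) =
      (D (D' f) \<oplus> (- 1) \<cdot> D' (D f)) \<oplus> (D (D' g) \<oplus> (- 1) \<cdot> D' (D g))"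
    if "source f = source g" "target f = target g"
    using f g that
    by (simp add: s scale_add_arr add_assoc_arr add_left_comm_arr)
qed (simp_all add: linear_simps[OF D] linear_simps[OF D'] scale_add_arr mult.commute)

text \<open>
  Apply the Leibniz rule to \<open>1 \<odot> 1 = 1\<close>.
\<close>

lemma derivation_ident_zero:
  assumes D: "derivation C D"
  shows "u \<in> obj C \<Longrightarrow> D (ident C u) = zero C u u"
    "u \<in> obj C \<Longrightarrow> v \<in> obj C \<Longrightarrow> D (zero C u v) = zero C u v"
proof -
  note s = linear_simps[OF D]
  assume u: "u \<in> obj C"
  have "D (ident C u) \<oplus> D (ident C u) = D (ident C u)"
    using derivationD(2)[OF D, of "ident C u" "ident C u"] u by (simp add: s)
  then have "D (ident C u) \<oplus> (- 1) \<cdot> D (ident C u) = D (ident C u)"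
    using u by (subst difference_eq_iff) (simp_all add: s)
  then show "D (ident C u) = zero C u u"
    using u by (simp add: s)
  assume v: "v \<in> obj C"
  show "D (zero C u v) = zero C u v"
    using u v s(4)[of "zero C u v" 0] by (simp add: s scale_zero_arr)
qed

primrec endo_power :: "'m \<Rightarrow> nat \<Rightarrow> 'm" where
  "endo_power a 0 = ident C (source a)"
| "endo_power a (Suc k) = a \<odot> endo_power a k"

lemma arr_endo_power [simp]:
  assumes "arr a" "target a = source a"
  shows "arr (endo_power a k)" "source (endo_power a k) = source a" "target (endo_power a k) = source a"
  using assms by (induction k) simp_all

lemma endo_power_commute: "arr a \<Longrightarrow> target a = source a \<Longrightarrow> endo_power a k \<odot> a = a \<odot> endo_power a k"
  by (induction k) (simp_all add: comp_assoc_arr)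

lemma endo_power_tensor_ident:
  "arr a \<Longrightarrow> target a = source a \<Longrightarrow> u \<in> obj C \<Longrightarrow> endo_power (a \<otimes> ident C u) k = endo_power a k \<otimes> ident C u"
  by (induction k) (simp_all add: interchange_arr)

end

section \<open>Higher derivations\<close>

text \<open>
  The coefficients of a monoidal functor to power series that is the identity modulo \<open>t\<close>: a
  Hasse-Schmidt derivation.
\<close>

locale higher_derivation = linear_monoidal_category C for C :: "('o, 'm) moncat" (structure) +
  fixes P :: "nat \<Rightarrow> 'm \<Rightarrow> 'm"
  assumes P_linear: "linear_operator C (P k)"
    and P_0: "arr f \<Longrightarrow> P 0 f = f"
    and P_comp: "arr f \<Longrightarrow> arr g \<Longrightarrow> source f = target g
      \<Longrightarrow> P k (f \<odot> g) = cauchy (add C) (comp C) (\<lambda>k. P k f) (\<lambda>k. P k g) k"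
    and P_tensor: "arr f \<Longrightarrow> arr g
      \<Longrightarrow> P k (f \<otimes> g) = cauchy (add C) (tensor C) (\<lambda>k. P k f) (\<lambda>k. P k g) k"
    and P_ident: "u \<in> obj C \<Longrightarrow> P (Suc k) (ident C u) = zero C u u"
begin

lemmas P_simps = linear_operatorD[OF P_linear]

lemma P_zero: "u \<in> obj C \<Longrightarrow> v \<in> obj C \<Longrightarrow> P k (zero C u v) = zero C u v"
  using P_simps(4)[of "zero C u v" k 0] by (simp add: P_simps scale_zero_arr)

lemma P_hom: "f \<in> hom C u v \<Longrightarrow> P k f \<in> hom C u v"
  by (simp add: hom_iff P_simps)

lemma P_sequence: "f \<in> hom C u v \<Longrightarrow> (\<lambda>k. P k f) \<in> sequences (hom C u v)"
  by (intro sequencesI P_hom)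

lemma derivation_P: "derivation C (P (Suc 0))"
  by (rule derivationI[OF P_linear]) (simp_all add: P_comp P_tensor P_0)

abbreviation "law \<equiv> divided_power_law (scale C) P"

lemma law_comp:
  assumes "arr f" "arr g" "source f = target g" "law f" "law g"
  shows "law (f \<odot> g)"
  using assms
  by (intro bilinear_operation.divided_power_law_op[OF bilinear_comp[of "target g" "target f" "source g"]])
    (auto simp: hom_iff P_simps P_comp)

lemma law_tensor:
  assumes "arr f" "arr g" "law f" "law g"
  shows "law (f \<otimes> g)"
  using assms
  by (intro bilinear_operation.divided_power_law_op[OF bilinear_tensor[of "source f" "target f" "source g" "target g"]])
    (auto simp: hom_iff P_simps P_tensor)

lemma law_add:
  assumes "arr f" "arr g" "source f = source g" "target f = target g" "law f" "law g"
  shows "law (f \<oplus> g)"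
  using assms by (simp add: divided_power_law_def P_simps scale_add_arr)

lemma law_scale: "arr f \<Longrightarrow> law f \<Longrightarrow> law (c \<cdot> f)"
  by (simp add: divided_power_law_def P_simps mult.commute)

text \<open>
  If the exponential of \<open>f\<close> is a polynomial in \<open>t\<close> of degree at most two, the law is a finite list of conditions.
\<close>

lemma law_finite:
  assumes "arr f" "P (Suc 0) f = g" "P (Suc (Suc 0)) f = h"
    and "\<And>k. P (Suc (Suc (Suc k))) f = zero C (source f) (target f)"
    and "P (Suc 0) g = 2 \<cdot> h" "\<And>k. P (Suc (Suc k)) g = zero C (source f) (target f)"
    and "\<And>k. P (Suc k) h = zero C (source f) (target f)"
  shows "law f"
proof -
  have a: "arr g" "arr h" "source g = source f" "source h = source f" "target g = target f" "target h = target f"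
    unfolding assms(2,3)[symmetric] by (simp_all add: P_simps assms(1))
  have "P k (P l f) = int ((k + l) choose k) \<cdot> P (k + l) f" for k l
  proof -
    consider "l = 0" | "k = 0" | "l = Suc 0" "k = Suc 0" | k' where "l = Suc 0" "k = Suc (Suc k')"
      | k' where "l = Suc (Suc 0)" "k = Suc k'" | l' k' where "l = Suc (Suc (Suc l'))" "k = Suc k'"
      by (metis not0_implies_Suc)
    then show ?thesis
      by cases (simp_all add: assms a P_0 P_simps P_zero)
  qed
  then show ?thesis by (simp add: divided_power_law_def)
qed

lemma law_ident: "u \<in> obj C \<Longrightarrow> law (ident C u)"
  by (rule law_finite[of _ "zero C u u" "zero C u u"]) (simp_all add: P_ident P_zero)

lemma law_zero: "u \<in> obj C \<Longrightarrow> v \<in> obj C \<Longrightarrow> law (zero C u v)"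
  by (simp add: divided_power_law_def P_zero)

text \<open>
  If \<open>a\<close> is mapped to \<open>a / (1 - t a)\<close> and \<open>y\<close> to \<open>y / (1 - t a)\<close>, then \<open>w\<^sub>l = a\<^sup>l y\<close> is mapped to \<open>w\<^sub>l / (1 - t a)\<^sup>l\<^sup>+\<^sup>1\<close>, whose
  coefficients are \<open>(k + l choose k) w\<^sub>k\<^sub>+\<^sub>l\<close>. Both dots and crossings of adjacent colours have this form.
\<close>

lemma law_geometric:
  assumes a: "arr a" "target a = source a" and y: "arr y" "target y = source a"
    and P_a: "\<And>k. P k a = a \<odot> endo_power a k" and P_y: "\<And>k. P k y = endo_power a k \<odot> y"
  shows "law y"
proof -
  define w where "w l = endo_power a l \<odot> y" for l
  have w [simp]: "arr (w l)" "source (w l) = source y" "target (w l) = source a" "w 0 = y" for l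
    using a y by (simp_all add: w_def)
  have w_Suc: "w (Suc l) = a \<odot> w l" for l
    using a y by (simp add: w_def comp_assoc_arr)
  \<comment> \<open>the equation \<open>(1 - t a) exp (a z) = a exp z\<close> in coefficients\<close>
  have step: "P (Suc k) (a \<odot> z) = a \<odot> (P k (a \<odot> z) \<oplus> P (Suc k) z)"
    if z: "arr z" "target z = source a" for k z
  proof -
    have hom: "a \<in> hom C (source a) (source a)" "z \<in> hom C (source z) (source a)"
      using a z by (simp_all add: hom_iff)
    let ?cau = "cauchy (add C) (comp C)" and ?A = "\<lambda>k. P k a" and ?Z = "\<lambda>k. P k z" and ?c = "const_series (scale C) a"
    interpret aa: bilinear_operation "hom C (source a) (source a)" "hom C (source a) (source a)" "hom C (source a) (source a)" "add C" "scale C" "comp C"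
      by (rule bilinear_comp)
    interpret az: bilinear_operation "hom C (source a) (source a)" "hom C (source z) (source a)" "hom C (source z) (source a)" "add C" "scale C" "comp C"
      by (rule bilinear_comp)
    have tl: "(\<lambda>k. P (Suc k) a) = ?cau ?c ?A"
      using P_sequence[OF hom(1)] hom by (simp add: aa.cauchy_constant_left) (simp add: P_a a)
    have "?cau (?cau ?c ?A) ?Z = ?cau ?c (?cau ?A ?Z)"
      using P_sequence hom aa.A.const_series_closed
      by (intro cauchy_assoc[OF aa.bilinear_operation_axioms az.bilinear_operation_axioms az.bilinear_operation_axioms az.bilinear_operation_axioms])
        (auto intro: comp_assoc)
    also have "\<dots> = (\<lambda>k. a \<odot> ?cau ?A ?Z k)"
      using P_sequence hom by (intro az.cauchy_constant_left az.cauchy_sequences)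
    finally have *: "?cau (?cau ?c ?A) ?Z = (\<lambda>k. a \<odot> ?cau ?A ?Z k)" .
    have "?cau ?A ?Z k \<in> hom C (source z) (source a)"
      using P_sequence hom by (intro az.cauchy_closed)
    with * show ?thesis
      using a z by (simp add: P_comp tl P_0 P_simps comp_add_arr hom_iff)
  qed
  have "P k (w l) = int ((k + l) choose k) \<cdot> w (k + l)" for k l
  proof (induction "k + l" arbitrary: k l rule: less_induct)
    case less
    consider "k = 0" | "l = 0" | k' l' where "k = Suc k'" "l = Suc l'"
      by (metis not0_implies_Suc)
    then show ?case
    proof cases
      case 1
      then show ?thesis by (simp add: P_0)
    next
      case 2
      then show ?thesis using P_y[of k] a y by (simp add: w_def[of k])
    next
      case 3
      have "P k (w l) = a \<odot> (P k' (w l) \<oplus> P k (w l'))"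
        using step[of "w l'" k'] a unfolding 3 w_Suc by simp
      also have "\<dots> = a \<odot> (int ((k' + l) choose k') \<cdot> w (k' + l) \<oplus> int ((k + l') choose k) \<cdot> w (k + l'))"
        using less[of k' l] less[of k l'] 3 by simp
      also have "\<dots> = int (((k' + l) choose k') + ((k + l') choose k)) \<cdot> w (k + l)"
        using a scale_left[OF arr_hom[of "w (k + l)"]]
        by (simp add: 3 w_Suc comp_add_arr comp_scale_arr del: binomial_Suc_Suc)
      also have "((k' + l) choose k') + ((k + l') choose k) = (k + l) choose k"
        by (simp add: 3)
      finally show ?thesis .
    qed
  qed
  then show ?thesis
    unfolding divided_power_law_def P_y w_def[symmetric] using P_y by (simp add: w_def)
qed

text \<open>
  The law with \<open>k = 1\<close> reads \<open>P 1 (P l m) = (l + 1) P (l + 1) m\<close>, so \<open>k! P k\<close> is the \<open>k\<close>-th power of \<open>P 1\<close>.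
\<close>

lemma divided_powers_of_P:
  assumes law: "\<And>f. arr f \<Longrightarrow> law f"
  shows "divided_powers_of C (P (Suc 0)) P"
proof -
  have "fact k \<cdot> P k m = (P (Suc 0) ^^ k) m" if m: "arr m" for k m
  proof (induction k)
    case 0
    then show ?case using m by (simp add: P_0)
  next
    case (Suc k)
    have "(P (Suc 0) ^^ Suc k) m = fact k \<cdot> P (Suc 0) (P k m)"
      using m by (simp add: Suc[symmetric] P_simps)
    also have "P (Suc 0) (P k m) = int (Suc k) \<cdot> P (Suc k) m"
      using law[OF m] by (simp add: divided_power_law_def)
    finally show ?case using m by (simp add: P_simps mult.commute)
  qed
  then show ?thesis
    using law by (simp add: divided_powers_of_def P_linear divided_power_law_def arr_def)
qed

end

section \<open>Power series over a model\<close>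

context klr_model begin

text \<open>
  Constant series form a copy of the coefficient category, so a model gives a model over power series.
\<close>

lemma evaluate_series:
  "arrow V u v t \<Longrightarrow> evaluate (series C) (\<lambda>i. const_series (scale C) (X i)) (\<lambda>i j. const_series (scale C) (Y i j)) t =
    const_series (scale C) (ev t)"
proof (induction rule: arrow.induct)
  case (4 u v)
  then show ?case
    by (auto simp: series_simps const_series_def fun_eq_iff scale_zero_arr split: nat.split)
next
  case (5 u v s t)
  note h = ev_hom[OF 5(1)] ev_hom[OF 5(2)]
  have "0 \<cdot> ev s \<oplus> 0 \<cdot> ev t = 0 \<cdot> (ev s \<oplus> ev t)"
    using h by (simp add: hom_iff scale_add_arr)
  with 5 show ?case
    by (auto simp: series_simps const_series_def fun_eq_iff split: nat.split)
next
  case (6 u v s c)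
  have "c \<cdot> 0 \<cdot> ev s = 0 \<cdot> c \<cdot> ev s"
    using ev_hom[OF 6(1)] by (simp add: hom_iff)
  with 6 show ?case
    by (auto simp: series_simps const_series_def fun_eq_iff split: nat.split)
next
  case (7 v w s u t)
  then show ?case
    using bilinear_operation.cauchy_constant[OF bilinear_comp ev_hom[OF 7(1)] ev_hom[OF 7(2)]]
    by (simp add: series_simps)
next
  case (8 u v s u' v' t)
  then show ?case
    using bilinear_operation.cauchy_constant[OF bilinear_tensor ev_hom[OF 8(1)] ev_hom[OF 8(2)]]
    by (simp add: series_simps)
qed (simp_all add: series_simps)

lemma klr_model_series:
  "klr_model (series C) V (\<lambda>i. const_series (scale C) (X i)) (\<lambda>i j. const_series (scale C) (Y i j)) E"
proof (intro klr_model.intro pre_klr_model.intro linear_monoidal_category_series; unfold_locales)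
  fix s t u v assume "klr_relation E s t" "arrow V u v s" "arrow V u v t"
  then show "evaluate (series C) (\<lambda>i. const_series (scale C) (X i)) (\<lambda>i j. const_series (scale C) (Y i j)) s =
      evaluate (series C) (\<lambda>i. const_series (scale C) (X i)) (\<lambda>i j. const_series (scale C) (Y i j)) t"
    using ev_relation by (simp add: evaluate_series)
qed (auto simp: series_simps words X_hom Y_hom intro: int_module.const_series_closed[OF int_module_hom])

lemma klr_model_with_variable_series:
  assumes "oriented_simply_laced_graph V E"
  shows "klr_model_with_variable (series C) V (\<lambda>i. const_series (scale C) (X i)) (\<lambda>i j. const_series (scale C) (Y i j)) E
    (t_times (scale C))"
proof -
  interpret S: klr_model "series C" V "\<lambda>i. const_series (scale C) (X i)" "\<lambda>i j. const_series (scale C) (Y i j)" E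
    by (rule klr_model_series)
  show ?thesis
proof (unfold_locales, unfold series_simps)
  show "oriented_simply_laced_graph V E" by fact
  fix f u v assume f: "f \<in> sequences (hom C u v)"
  show "t_times (scale C) f \<in> sequences (hom C u v)"
    using f by (rule int_module.t_times_closed[OF int_module_hom])
  show "t_times (scale C) (pointwise_plus (add C) f g) = pointwise_plus (add C) (t_times (scale C) f) (t_times (scale C) g)"
    if "g \<in> sequences (hom C u v)" for g
    using f that by (rule int_module.t_times_plus[OF int_module_hom])
  show "t_times (scale C) (pointwise_smul (scale C) c f) = pointwise_smul (scale C) c (t_times (scale C) f)" for c
    using sequencesD[OF f] by (auto simp: t_times_def fun_eq_iff hom_iff split: nat.split)
next
  fix f g u v w assume "f \<in> sequences (hom C v w)" "g \<in> sequences (hom C u v)"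
  then show "cauchy (add C) (comp C) (t_times (scale C) f) g = t_times (scale C) (cauchy (add C) (comp C) f g)"
    "cauchy (add C) (comp C) f (t_times (scale C) g) = t_times (scale C) (cauchy (add C) (comp C) f g)"
    using bilinear_operation.cauchy_t_times_left[OF bilinear_comp] bilinear_operation.cauchy_t_times_right[OF bilinear_comp]
    by blast+
next
  fix f g u v u' v' assume "f \<in> sequences (hom C u v)" "g \<in> sequences (hom C u' v')"
  then show "cauchy (add C) (tensor C) (t_times (scale C) f) g = t_times (scale C) (cauchy (add C) (tensor C) f g)"
    "cauchy (add C) (tensor C) f (t_times (scale C) g) = t_times (scale C) (cauchy (add C) (tensor C) f g)"
    using bilinear_operation.cauchy_t_times_left[OF bilinear_tensor] bilinear_operation.cauchy_t_times_right[OF bilinear_tensor]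
    by blast+
qed
qed

text \<open>
  The geometric series \<open>\<Sum>k. t\<^sup>k x\<^sup>k\<close> is the inverse of \<open>1 - t x\<close>.
\<close>

lemma klr_deformation_series:
  assumes "oriented_simply_laced_graph V E"
  shows "klr_deformation (series C) V (\<lambda>i. const_series (scale C) (X i)) (\<lambda>i j. const_series (scale C) (Y i j)) E
    (t_times (scale C)) (\<lambda>i. endo_power (X i))"
proof -
  interpret S: klr_model_with_variable "series C" V "\<lambda>i. const_series (scale C) (X i)" "\<lambda>i j. const_series (scale C) (Y i j)" E
    "t_times (scale C)"
    by (rule klr_model_with_variable_series[OF assms])
  show ?thesis
  proof unfold_locales
    fix i assume i: "i \<in> V"
    let ?X = "const_series (scale C) (X i)" and ?Q = "endo_power (X i)"
    have a: "arr (X i)" "source (X i) = [i]" "target (X i) = [i]"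
      using X_hom[OF i] by (simp_all add: hom_iff)
    have Xh: "X i \<in> hom C [i] [i]" using X_hom[OF i] .
    have Q: "?Q \<in> sequences (hom C [i] [i])"
      using a by (intro sequencesI) (simp add: hom_iff)
    then show Q': "?Q \<in> hom (series C) [i] [i]"
      by (simp add: series_simps)
    have S: "S.arr ?Q" "S.source ?Q = [i]" "S.target ?Q = [i]"
      using Q' by (simp_all add: S.hom_iff)
    have XQ: "?X \<odot>\<^bsub>series C\<^esub> ?Q = (\<lambda>k. ?Q (Suc k))" "?Q \<odot>\<^bsub>series C\<^esub> ?X = (\<lambda>k. ?Q (Suc k))"
      using a bilinear_operation.cauchy_constant_left[OF bilinear_comp Xh Q]
        bilinear_operation.cauchy_constant_right[OF bilinear_comp Q Xh]
      by (simp_all add: series_simps endo_power_commute)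
    have Q_split: "?Q = ident (series C) [i] \<oplus>\<^bsub>series C\<^esub> t_times (scale C) (\<lambda>k. ?Q (Suc k))"
      using a i by (auto simp: fun_eq_iff series_simps const_series_def t_times_def scale_zero_arr split: nat.split)
    have tail: "S.arr (\<lambda>k. ?Q (Suc k))" "S.source (\<lambda>k. ?Q (Suc k)) = [i]" "S.target (\<lambda>k. ?Q (Suc k)) = [i]"
      using i S unfolding XQ(1)[symmetric] by simp_all
    show "(ident (series C) [i] \<oplus>\<^bsub>series C\<^esub> (- 1) \<cdot>\<^bsub>series C\<^esub> t_times (scale C) ?X) \<odot>\<^bsub>series C\<^esub> ?Q = ident (series C) [i]"
      "?Q \<odot>\<^bsub>series C\<^esub> (ident (series C) [i] \<oplus>\<^bsub>series C\<^esub> (- 1) \<cdot>\<^bsub>series C\<^esub> t_times (scale C) ?X) = ident (series C) [i]"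
      using i S tail Q_split by (simp_all add: S.expand XQ S.difference_eq_iff)
  qed
qed

end

section \<open>Higher derivations of the Khovanov-Lauda-Rouquier category\<close>

text \<open>
  A model over power series whose generators have those of the category itself as constant terms. Its
  evaluation functor has the coefficients \<open>coefficient k\<close>, which form a higher derivation.
\<close>

locale klr_expansion =
  fixes V :: "'v set" and E :: "('v \<times> 'v) set"
    and A :: "'v \<Rightarrow> nat \<Rightarrow> 'v diagram set" and B :: "'v \<Rightarrow> 'v \<Rightarrow> nat \<Rightarrow> 'v diagram set"
  assumes model: "klr_model (series (KLR V E)) V A B E"
    and A_0: "i \<in> V \<Longrightarrow> A i 0 = klr_dot V E i"
    and B_0: "i \<in> V \<Longrightarrow> j \<in> V \<Longrightarrow> B i j 0 = klr_cross V E i j"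

lemma arr_KLR:
  "linear_monoidal_category.arr (KLR V E) f \<longleftrightarrow> (\<exists>t. typed V t \<and> f = klr_class V E t)"
proof -
  interpret K: linear_monoidal_category "KLR V E" by (rule linear_monoidal_category_KLR)
  show ?thesis
    using K.arr_hom[of f] hom_KLR[of f V E] K.hom_iff[of f] by metis
qed

lemma arr_klr_class [simp]:
  assumes "typed V t"
  shows "linear_monoidal_category.arr (KLR V E) (klr_class V E t)"
    "linear_monoidal_category.source (KLR V E) (klr_class V E t) = src t"
    "linear_monoidal_category.target (KLR V E) (klr_class V E t) = tgt t"
proof -
  interpret K: linear_monoidal_category "KLR V E" by (rule linear_monoidal_category_KLR)
  show "K.arr (klr_class V E t)" "K.source (klr_class V E t) = src t" "K.target (klr_class V E t) = tgt t"
    using klr_class_hom[OF assms, of E "src t" "tgt t"] by (simp_all add: K.hom_iff)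
qed

lemma KLR_induct [consumes 1, case_names Ident Dot Cross Zero Add Scale Comp Tensor]:
  assumes "linear_monoidal_category.arr (KLR V E) f"
    and "\<And>u. u \<in> lists V \<Longrightarrow> R (ident (KLR V E) u)"
    and "\<And>i. i \<in> V \<Longrightarrow> R (klr_dot V E i)"
    and "\<And>i j. i \<in> V \<Longrightarrow> j \<in> V \<Longrightarrow> R (klr_cross V E i j)"
    and "\<And>u v. u \<in> lists V \<Longrightarrow> v \<in> lists V \<Longrightarrow> R (zero (KLR V E) u v)"
    and "\<And>f g u v. f \<in> hom (KLR V E) u v \<Longrightarrow> g \<in> hom (KLR V E) u v \<Longrightarrow> R f \<Longrightarrow> R g \<Longrightarrow> R (f \<oplus>\<^bsub>KLR V E\<^esub> g)"
    and "\<And>f u v c. f \<in> hom (KLR V E) u v \<Longrightarrow> R f \<Longrightarrow> R (c \<cdot>\<^bsub>KLR V E\<^esub> f)"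
    and "\<And>f g u v w. f \<in> hom (KLR V E) v w \<Longrightarrow> g \<in> hom (KLR V E) u v \<Longrightarrow> R f \<Longrightarrow> R g \<Longrightarrow> R (f \<odot>\<^bsub>KLR V E\<^esub> g)"
    and "\<And>f g u v u' v'. f \<in> hom (KLR V E) u v \<Longrightarrow> g \<in> hom (KLR V E) u' v' \<Longrightarrow> R f \<Longrightarrow> R g \<Longrightarrow> R (f \<otimes>\<^bsub>KLR V E\<^esub> g)"
  shows "R f"
proof -
  have "R (klr_class V E t)" if "typed V t" for t
    using that
  proof (induction t)
    case (Ident u) then show ?case using assms(2)[of u] by simp
  next
    case (Dot i) then show ?case using assms(3)[of i] by (simp add: klr_dot_def)
  next
    case (Cross i j) then show ?case using assms(4)[of i j] by (simp add: klr_cross_def)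
  next
    case (Null u v) then show ?case using assms(5)[of u v] by simp
  next
    case (Plus s t)
    then show ?case using assms(6)[of "klr_class V E s" "src s" "tgt s" "klr_class V E t"] by simp
  next
    case (Scale c s)
    then show ?case using assms(7)[of "klr_class V E s" "src s" "tgt s" c] by simp
  next
    case (Comp s t)
    then show ?case using assms(8)[of "klr_class V E s" "src s" "tgt s" "klr_class V E t" "src t"] by simp
  next
    case (Tensor s t)
    then show ?case using assms(9)[of "klr_class V E s" "src s" "tgt s" "klr_class V E t" "src t" "tgt t"] by simp
  qed
  then show ?thesis using assms(1) unfolding arr_KLR by auto
qed

lemma derivation_KLR_eqI:
  assumes D: "derivation (KLR V E) D" and D': "derivation (KLR V E) D'"
    and dot: "\<And>i. i \<in> V \<Longrightarrow> D (klr_dot V E i) = D' (klr_dot V E i)"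
    and cross: "\<And>i j. i \<in> V \<Longrightarrow> j \<in> V \<Longrightarrow> D (klr_cross V E i j) = D' (klr_cross V E i j)"
    and f: "f \<in> mor (KLR V E)"
  shows "D f = D' f"
proof -
  interpret K: linear_monoidal_category "KLR V E" by (rule linear_monoidal_category_KLR)
  note s = K.linear_simps[OF D] K.linear_simps[OF D']
  have "K.arr f" using f by (simp add: K.arr_def)
  then show ?thesis
  proof (induction rule: KLR_induct)
    case (Ident u)
    then show ?case
      using K.derivation_ident_zero(1)[OF D, of u] K.derivation_ident_zero(1)[OF D', of u] by simp
  next
    case (Zero u v)
    then show ?case
      using K.derivation_ident_zero(2)[OF D, of u v] K.derivation_ident_zero(2)[OF D', of u v] by simp
  next
    case (Add f g u v)
    then show ?case by (simp add: K.hom_iff s)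
  next
    case (Scale f u v c)
    then show ?case by (simp add: K.hom_iff s)
  next
    case (Comp f g v w u)
    then show ?case by (simp add: K.hom_iff K.derivationD(2)[OF D] K.derivationD(2)[OF D'])
  next
    case (Tensor f g u v u' v')
    then show ?case by (simp add: K.hom_iff K.derivationD(3)[OF D] K.derivationD(3)[OF D'])
  qed (simp_all add: dot cross)
qed

context klr_expansion begin

sublocale K: linear_monoidal_category "KLR V E" by (rule linear_monoidal_category_KLR)
sublocale M: klr_model "series (KLR V E)" V A B E by (rule model)

text \<open>
  The value does not depend on the representative because evaluation respects the congruence.
\<close>

definition coefficient :: "nat \<Rightarrow> 'v diagram set \<Rightarrow> 'v diagram set" where
  "coefficient k f = evaluate (series (KLR V E)) A B (SOME t. t \<in> f) k"

lemma coefficient_class: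
  assumes "typed V t"
  shows "coefficient k (klr_class V E t) = M.ev t k"
proof -
  have "t \<in> klr_class V E t"
    using klr_eq_refl[OF assms] klr_class_elem[OF assms] by blast
  then have "(SOME s. s \<in> klr_class V E t) \<in> klr_class V E t"
    by (rule someI)
  then have "klr_eq V E (src t) (tgt t) t (SOME s. s \<in> klr_class V E t)"
    by (simp add: klr_class_elem[OF assms])
  then show ?thesis
    unfolding coefficient_def by (simp add: M.ev_cong)
qed

lemma coefficient_hom:
  assumes "typed V t"
  shows "coefficient k (klr_class V E t) \<in> hom (KLR V E) (src t) (tgt t)"
  using M.ev_hom[OF arrow_if_typed[OF assms]] assms
  by (simp add: series_simps coefficient_class sequencesD)

lemma coefficient_0: "K.arr f \<Longrightarrow> coefficient 0 f = f"
proof -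
  have "M.ev t 0 = klr_class V E t" if "typed V t" for t
    using that by (induction t) (simp_all add: series_simps A_0 B_0 klr_dot_def klr_cross_def)
  then show "K.arr f \<Longrightarrow> coefficient 0 f = f"
    by (auto simp: arr_KLR coefficient_class)
qed

sublocale higher_derivation "KLR V E" coefficient
proof
  show "linear_operator (KLR V E) (coefficient k)" for k
  proof (rule K.linear_operatorI)
    fix f assume "K.arr f"
    then obtain s where s: "typed V s" "f = klr_class V E s" unfolding arr_KLR by blast
    show "K.arr (coefficient k f) \<and> K.source (coefficient k f) = K.source f \<and> K.target (coefficient k f) = K.target f"
      using coefficient_hom[OF s(1), of k] s by (simp add: K.hom_iff)
    show "coefficient k (c \<cdot>\<^bsub>KLR V E\<^esub> f) = c \<cdot>\<^bsub>KLR V E\<^esub> coefficient k f" for c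
      using s by (simp add: coefficient_class series_simps)
    fix g assume "K.arr g" and p: "K.source f = K.source g" "K.target f = K.target g"
    then obtain t where t: "typed V t" "g = klr_class V E t" unfolding arr_KLR by blast
    show "coefficient k (f \<oplus>\<^bsub>KLR V E\<^esub> g) = coefficient k f \<oplus>\<^bsub>KLR V E\<^esub> coefficient k g"
      using s t p by (simp add: coefficient_class series_simps)
  qed
  fix k
  show "coefficient 0 f = f" if "K.arr f" for f
    using that by (rule coefficient_0)
  show "coefficient (Suc k) (ident (KLR V E) u) = zero (KLR V E) u u" if "u \<in> obj (KLR V E)" for u
    using that K.scale_zero_arr[of "klr_class V E (Ident u)"] by (simp add: coefficient_class series_simps)
  fix f g assume "K.arr f" "K.arr g"
  then obtain s t where st: "typed V s" "f = klr_class V E s" "typed V t" "g = klr_class V E t"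
    unfolding arr_KLR by blast
  show "coefficient k (f \<odot>\<^bsub>KLR V E\<^esub> g) =
      cauchy (add (KLR V E)) (comp (KLR V E)) (\<lambda>k. coefficient k f) (\<lambda>k. coefficient k g) k"
    if "K.source f = K.target g"
    using st that by (simp add: coefficient_class series_simps)
  show "coefficient k (f \<otimes>\<^bsub>KLR V E\<^esub> g) =
      cauchy (add (KLR V E)) (tensor (KLR V E)) (\<lambda>k. coefficient k f) (\<lambda>k. coefficient k g) k"
    using st by (simp add: coefficient_class series_simps)
qed

lemma coefficient_dot: "i \<in> V \<Longrightarrow> coefficient k (klr_dot V E i) = A i k"
  by (simp add: klr_dot_def coefficient_class)

lemma coefficient_cross: "i \<in> V \<Longrightarrow> j \<in> V \<Longrightarrow> coefficient k (klr_cross V E i j) = B i j k"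
  by (simp add: klr_cross_def coefficient_class)

lemma law_from_generators:
  assumes dot: "\<And>i. i \<in> V \<Longrightarrow> law (klr_dot V E i)"
    and cross: "\<And>i j. i \<in> V \<Longrightarrow> j \<in> V \<Longrightarrow> law (klr_cross V E i j)"
    and f: "K.arr f"
  shows "law f"
  using f
proof (induction rule: KLR_induct)
  case (Ident u)
  then show ?case using law_ident[of u] by simp
next
  case (Zero u v)
  then show ?case using law_zero[of u v] by simp
next
  case (Add f g u v)
  then show ?case by (intro law_add) (simp_all add: K.hom_iff)
next
  case (Scale f u v c)
  then show ?case by (intro law_scale) (simp_all add: K.hom_iff)
next
  case (Comp f g v w u)
  then show ?case by (intro law_comp) (simp_all add: K.hom_iff)
next
  case (Tensor f g u v u' v')
  then show ?case by (intro law_tensor) (simp_all add: K.hom_iff)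
qed (simp_all add: dot cross)

end

section \<open>The operators \<open>d\<close>, \<open>h\<close> and \<open>z\<close>\<close>

lemma evaluate_KLR:
  "typed V t \<Longrightarrow> evaluate (KLR V E) (klr_dot V E) (klr_cross V E) t = klr_class V E t"
  by (induction t) (simp_all add: klr_dot_def klr_cross_def)

lemma klr_model_KLR: "klr_model (KLR V E) V (klr_dot V E) (klr_cross V E) E"
proof (intro klr_model.intro pre_klr_model.intro linear_monoidal_category_KLR; unfold_locales)
  fix s t u v assume "klr_relation E s t" "arrow V u v s" "arrow V u v t"
  then show "evaluate (KLR V E) (klr_dot V E) (klr_cross V E) s = evaluate (KLR V E) (klr_dot V E) (klr_cross V E) t"
    using klr_class_eqI[OF klr_eq.relation] by (simp add: evaluate_KLR arrow_iff)
qed (auto simp: klr_dot_def klr_cross_def fun_eq_iff)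

text \<open>
  Identities and zero morphisms stay folded, so that the laws of a linear monoidal category apply
  to them instead of the classes of diagrams.
\<close>

declare KLR_simps(4,5) [simp del]

text \<open>
  The model \<open>U\<close> is the category itself, and \<open>S\<close> is the deformation over power series.
\<close>

locale klr_graph =
  fixes V :: "'v set" and E :: "('v \<times> 'v) set"
  assumes graph: "oriented_simply_laced_graph V E"
begin

abbreviation "U \<equiv> KLR V E"
abbreviation "dot \<equiv> klr_dot V E"
abbreviation "cross \<equiv> klr_cross V E"
abbreviation comp_U (infixr \<open>\<odot>\<^sub>U\<close> 70) where "f \<odot>\<^sub>U g \<equiv> f \<odot>\<^bsub>U\<^esub> g"
abbreviation tensor_U (infixr \<open>\<otimes>\<^sub>U\<close> 75) where "f \<otimes>\<^sub>U g \<equiv> f \<otimes>\<^bsub>U\<^esub> g"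
abbreviation add_U (infixl \<open>\<oplus>\<^sub>U\<close> 65) where "f \<oplus>\<^sub>U g \<equiv> f \<oplus>\<^bsub>U\<^esub> g"
abbreviation scale_U (infixr \<open>\<cdot>\<^sub>U\<close> 68) where "c \<cdot>\<^sub>U f \<equiv> c \<cdot>\<^bsub>U\<^esub> f"

sublocale U: klr_model "KLR V E" V "klr_dot V E" "klr_cross V E" E
  by (rule klr_model_KLR)

sublocale S: klr_deformation "series (KLR V E)" V "\<lambda>i. const_series (scale (KLR V E)) (dot i)"
  "\<lambda>i j. const_series (scale (KLR V E)) (cross i j)" E "t_times (scale (KLR V E))"
  "\<lambda>i. U.endo_power (dot i)"
  by (rule U.klr_deformation_series[OF graph])

lemma generators [simp]:
  "i \<in> V \<Longrightarrow> U.arr (dot i)" "i \<in> V \<Longrightarrow> U.source (dot i) = [i]" "i \<in> V \<Longrightarrow> U.target (dot i) = [i]"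
  "i \<in> V \<Longrightarrow> j \<in> V \<Longrightarrow> U.arr (cross i j)" "i \<in> V \<Longrightarrow> j \<in> V \<Longrightarrow> U.source (cross i j) = [i, j]"
  "i \<in> V \<Longrightarrow> j \<in> V \<Longrightarrow> U.target (cross i j) = [j, i]"
  by (simp_all add: klr_dot_def klr_cross_def)

lemma X'_coefficient:
  assumes "i \<in> V"
  shows "S.X' i k = dot i \<odot>\<^sub>U U.endo_power (dot i) k"
proof -
  have h: "dot i \<in> hom U [i] [i]" "U.endo_power (dot i) \<in> sequences (hom U [i] [i])"
    using assms by (auto simp: U.hom_iff intro!: sequencesI)
  show ?thesis
    unfolding S.X'_def using bilinear_operation.cauchy_constant_left[OF U.bilinear_comp h]
    by (simp add: series_simps)
qed

lemma Y'_coefficient: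
  assumes ij: "i \<in> V" "j \<in> V" "i \<noteq> j"
  shows "adjacent E i j \<Longrightarrow> S.Y' i j k =
      (U.endo_power (dot j) k \<otimes>\<^sub>U ident U [i]) \<odot>\<^sub>U cross i j"
    and "\<not> adjacent E i j \<Longrightarrow> S.Y' i j = const_series (scale U) (cross i j)"
proof -
  have h: "cross i j \<in> hom U [i, j] [j, i]" "ident U [i] \<in> hom U [i] [i]"
    "U.endo_power (dot j) \<in> sequences (hom U [j] [j])"
    using ij U.ident_hom[of "[i]"] by (auto simp: U.hom_iff intro!: sequencesI)
  have h': "(\<lambda>k. U.endo_power (dot j) k \<otimes>\<^sub>U ident U [i]) \<in> sequences (hom U [j, i] [j, i])"
    using ij by (intro sequencesI) (simp add: U.hom_iff)
  show "S.Y' i j k = (U.endo_power (dot j) k \<otimes>\<^sub>U ident U [i]) \<odot>\<^sub>U cross i j"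
    if "adjacent E i j"
    using ij that bilinear_operation.cauchy_constant_right[OF U.bilinear_tensor h(3,2)]
      bilinear_operation.cauchy_constant_right[OF U.bilinear_comp h'  h(1)]
    unfolding S.Y'_def S.M_def by (simp add: series_simps)
  show "S.Y' i j = const_series (scale U) (cross i j)" if "\<not> adjacent E i j"
    using ij that unfolding S.Y'_def S.M_def by simp
qed

abbreviation x1 where "x1 i \<equiv> dot i \<otimes>\<^sub>U ident U [i]"
abbreviation x2 where "x2 i \<equiv> ident U [i] \<otimes>\<^sub>U dot i"
abbreviation y where "y i \<equiv> cross i i"

lemma const_series_words:
  assumes "i \<in> V"
  shows "(const_series (scale U) (dot i) \<otimes>\<^bsub>series U\<^esub> ident (series U) [i]) \<odot>\<^bsub>series U\<^esub>
      const_series (scale U) (cross i i) = const_series (scale U) (x1 i \<odot>\<^sub>U y i)"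
    "const_series (scale U) (cross i i) \<odot>\<^bsub>series U\<^esub>
      (ident (series U) [i] \<otimes>\<^bsub>series U\<^esub> const_series (scale U) (dot i)) = const_series (scale U) (y i \<odot>\<^sub>U x2 i)"
    "(const_series (scale U) (dot i) \<otimes>\<^bsub>series U\<^esub> ident (series U) [i]) \<odot>\<^bsub>series U\<^esub>
      (const_series (scale U) (cross i i) \<odot>\<^bsub>series U\<^esub>
      (ident (series U) [i] \<otimes>\<^bsub>series U\<^esub> const_series (scale U) (dot i)))
      = const_series (scale U) (x1 i \<odot>\<^sub>U (y i \<odot>\<^sub>U x2 i))"
  using U.evaluate_series[of "[i, i]" "[i, i]" "dot_left i i \<boxdot> Cross i i"]
    U.evaluate_series[of "[i, i]" "[i, i]" "Cross i i \<boxdot> dot_right i i"]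
    U.evaluate_series[of "[i, i]" "[i, i]" "dot_left i i \<boxdot> (Cross i i \<boxdot> dot_right i i)"] assms
  by (simp_all add: arrow_iff)

sublocale d: klr_expansion V E S.X' S.Y'
proof (rule klr_expansion.intro)
  show "klr_model (series (KLR V E)) V S.X' S.Y' E"
    by (rule S.klr_model_deformed)
  show "S.X' i 0 = dot i" if "i \<in> V" for i
    using that by (simp add: X'_coefficient)
  show "S.Y' i j 0 = cross i j" if ij: "i \<in> V" "j \<in> V" for i j
  proof (cases "i = j")
    case True
    then show ?thesis
      using ij U.add_zero_arr(1)[of "cross i i" "[i, i]" "[i, i]"]
      by (simp add: S.same_colour_deformed(1) const_series_words)
       (simp add: series_simps U.scale_zero_arr)
  next
    case False
    then show ?thesis
      using ij by (cases "adjacent E i j") (simp_all add: Y'_coefficient)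
  qed
qed

lemma derivative_series:
  assumes "U.arr f" "U.arr g"
  shows "U.source f = U.target g \<Longrightarrow> (\<lambda>k. d.coefficient k (f \<odot>\<^sub>U g)) =
      (\<lambda>k. d.coefficient k f) \<odot>\<^bsub>series U\<^esub> (\<lambda>k. d.coefficient k g)"
    and "(\<lambda>k. d.coefficient k (f \<otimes>\<^sub>U g)) =
      (\<lambda>k. d.coefficient k f) \<otimes>\<^bsub>series U\<^esub> (\<lambda>k. d.coefficient k g)"
  using assms by (simp_all add: series_simps d.P_comp d.P_tensor)

lemma derivative_series_generators:
  "u \<in> lists V \<Longrightarrow> (\<lambda>k. d.coefficient k (ident U u)) = ident (series U) u"
  "i \<in> V \<Longrightarrow> (\<lambda>k. d.coefficient k (dot i)) = S.X' i"
  "i \<in> V \<Longrightarrow> j \<in> V \<Longrightarrow> (\<lambda>k. d.coefficient k (cross i j)) = S.Y' i j"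
proof -
  show "(\<lambda>k. d.coefficient k (ident U u)) = ident (series U) u" if "u \<in> lists V"
  proof
    fix k show "d.coefficient k (ident U u) = ident (series U) u k"
      using that by (cases k) (simp_all add: series_simps d.P_0 d.P_ident U.scale_zero_arr)
  qed
  show "(\<lambda>k. d.coefficient k (dot i)) = S.X' i" if "i \<in> V"
    using that by (simp add: d.coefficient_dot)
  show "(\<lambda>k. d.coefficient k (cross i j)) = S.Y' i j" if "i \<in> V" "j \<in> V"
    using that by (simp add: d.coefficient_cross)
qed

text \<open>
  With \<open>w = x\<^sub>1 \<psi> x\<^sub>2\<close>, the exponentials are \<open>\<psi> \<mapsto> \<psi> - t (x\<^sub>1 \<psi> + \<psi> x\<^sub>2) + t\<^sup>2 w\<close>, \<open>x\<^sub>1 \<psi> \<mapsto> x\<^sub>1 \<psi> - t w\<close>, \<open>\<psi> x\<^sub>2 \<mapsto> \<psi> x\<^sub>2 - t w\<close>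
  and \<open>w \<mapsto> w\<close>.
\<close>

lemma same_colour_series:
  assumes i: "i \<in> V"
  shows "d.coefficient (Suc 0) (y i) = (- 1) \<cdot>\<^sub>U (x1 i \<odot>\<^sub>U y i) \<oplus>\<^sub>U (- 1) \<cdot>\<^sub>U (y i \<odot>\<^sub>U x2 i)"
    and "d.coefficient (Suc (Suc 0)) (y i) = x1 i \<odot>\<^sub>U (y i \<odot>\<^sub>U x2 i)"
    and "d.coefficient (Suc (Suc (Suc k))) (y i) = zero U [i, i] [i, i]"
    and "d.coefficient (Suc 0) (x1 i \<odot>\<^sub>U y i) = (- 1) \<cdot>\<^sub>U (x1 i \<odot>\<^sub>U (y i \<odot>\<^sub>U x2 i))"
    and "d.coefficient (Suc (Suc k)) (x1 i \<odot>\<^sub>U y i) = zero U [i, i] [i, i]"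
    and "d.coefficient (Suc 0) (y i \<odot>\<^sub>U x2 i) = (- 1) \<cdot>\<^sub>U (x1 i \<odot>\<^sub>U (y i \<odot>\<^sub>U x2 i))"
    and "d.coefficient (Suc (Suc k)) (y i \<odot>\<^sub>U x2 i) = zero U [i, i] [i, i]"
    and "d.coefficient (Suc k) (x1 i \<odot>\<^sub>U (y i \<odot>\<^sub>U x2 i)) = zero U [i, i] [i, i]"
proof -
  have "(\<lambda>k. d.coefficient k (y i)) = S.Y' i i"
    "(\<lambda>k. d.coefficient k (x1 i \<odot>\<^sub>U y i)) = (S.X' i \<otimes>\<^bsub>series U\<^esub> ident (series U) [i]) \<odot>\<^bsub>series U\<^esub> S.Y' i i"
    "(\<lambda>k. d.coefficient k (y i \<odot>\<^sub>U x2 i)) = S.Y' i i \<odot>\<^bsub>series U\<^esub> (ident (series U) [i] \<otimes>\<^bsub>series U\<^esub> S.X' i)"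
    "(\<lambda>k. d.coefficient k (x1 i \<odot>\<^sub>U (y i \<odot>\<^sub>U x2 i))) =
      (S.X' i \<otimes>\<^bsub>series U\<^esub> ident (series U) [i]) \<odot>\<^bsub>series U\<^esub> (S.Y' i i \<odot>\<^bsub>series U\<^esub> (ident (series U) [i] \<otimes>\<^bsub>series U\<^esub> S.X' i))"
    using i by (simp_all add: derivative_series derivative_series_generators)
  note series = this(1)[unfolded S.same_colour_deformed(1)[OF i], unfolded const_series_words(1,3)[OF i],
      unfolded const_series_words(2)[OF i], THEN fun_cong]
    this(2)[unfolded S.same_colour_deformed(2)[OF i], unfolded const_series_words(1,3)[OF i], THEN fun_cong]
    this(3)[unfolded S.same_colour_deformed(3)[OF i], unfolded const_series_words(3)[OF i],
      unfolded const_series_words(2)[OF i], THEN fun_cong]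
    this(4)[unfolded S.same_colour_deformed(4)[OF i], unfolded const_series_words(3)[OF i], THEN fun_cong]
  show "d.coefficient (Suc 0) (y i) = (- 1) \<cdot>\<^sub>U (x1 i \<odot>\<^sub>U y i) \<oplus>\<^sub>U (- 1) \<cdot>\<^sub>U (y i \<odot>\<^sub>U x2 i)"
    "d.coefficient (Suc (Suc 0)) (y i) = x1 i \<odot>\<^sub>U (y i \<odot>\<^sub>U x2 i)"
    "d.coefficient (Suc (Suc (Suc k))) (y i) = zero U [i, i] [i, i]"
    "d.coefficient (Suc 0) (x1 i \<odot>\<^sub>U y i) = (- 1) \<cdot>\<^sub>U (x1 i \<odot>\<^sub>U (y i \<odot>\<^sub>U x2 i))"
    "d.coefficient (Suc (Suc k)) (x1 i \<odot>\<^sub>U y i) = zero U [i, i] [i, i]"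
    "d.coefficient (Suc 0) (y i \<odot>\<^sub>U x2 i) = (- 1) \<cdot>\<^sub>U (x1 i \<odot>\<^sub>U (y i \<odot>\<^sub>U x2 i))"
    "d.coefficient (Suc (Suc k)) (y i \<odot>\<^sub>U x2 i) = zero U [i, i] [i, i]"
    "d.coefficient (Suc k) (x1 i \<odot>\<^sub>U (y i \<odot>\<^sub>U x2 i)) = zero U [i, i] [i, i]"
    using i unfolding series by (simp_all add: series_simps U.scale_zero_arr)
qed

text \<open>
  Dots and crossings of adjacent colours are geometric, the other crossings have polynomial exponentials.
\<close>

lemma d_law:
  assumes "U.arr f"
  shows "d.law f"
proof (rule d.law_from_generators[OF _ _ assms])
  fix i assume i: "i \<in> V"
  show "d.law (dot i)"
    using i by (intro d.law_geometric[where a = "dot i"])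
      (simp_all add: d.coefficient_dot X'_coefficient U.endo_power_commute)
  fix j assume j: "j \<in> V"
  consider "i = j" | "i \<noteq> j" "adjacent E i j" | "i \<noteq> j" "\<not> adjacent E i j" by blast
  then show "d.law (cross i j)"
  proof cases
    case 1
    let ?w = "x1 i \<odot>\<^sub>U (y i \<odot>\<^sub>U x2 i)"
    have "2 \<cdot>\<^sub>U ?w = ?w \<oplus>\<^sub>U ?w"
      using U.scale_left[OF U.arr_hom[of ?w], of 1 1] i by simp
    then show ?thesis
      using i unfolding 1[symmetric]
      by (intro d.law_finite[OF _ same_colour_series(1,2)]) (simp_all add: same_colour_series d.P_simps)
  next
    case 2
    let ?a = "dot j \<otimes>\<^sub>U ident U [i]"
    have h: "ident U [i] \<in> hom U [i] [i]" "S.X' j \<in> sequences (hom U [j] [j])"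
      using i j S.arr_XY'(1-3)[of j] S.hom_iff[of "S.X' j" "[j]" "[j]"] by (simp_all add: U.hom_iff series_simps)
    have "d.coefficient k ?a = ?a \<odot>\<^sub>U U.endo_power ?a k" for k
    proof -
      have "(\<lambda>k. d.coefficient k ?a) = S.X' j \<otimes>\<^bsub>series U\<^esub> ident (series U) [i]"
        using i j by (simp add: derivative_series derivative_series_generators)
      then have "d.coefficient k ?a = (S.X' j \<otimes>\<^bsub>series U\<^esub> ident (series U) [i]) k"
        by (rule fun_cong)
      also have "\<dots> = S.X' j k \<otimes>\<^sub>U ident U [i]"
        using bilinear_operation.cauchy_constant_right[OF U.bilinear_tensor h(2,1)] by (simp add: series_simps)
      finally show ?thesis
        using i j by (simp add: X'_coefficient U.endo_power_tensor_ident U.interchange_arr)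
    qed
    moreover have "d.coefficient k (cross i j) = U.endo_power ?a k \<odot>\<^sub>U cross i j" for k
      using i j 2 by (simp add: d.coefficient_cross Y'_coefficient U.endo_power_tensor_ident)
    ultimately show ?thesis
      using i j by (intro d.law_geometric[where a = ?a]) simp_all
  next
    case 3
    then show ?thesis
      using i j by (intro d.law_finite[where g = "zero U [i, j] [j, i]" and h = "zero U [i, j] [j, i]"])
        (simp_all add: d.coefficient_cross Y'_coefficient U.scale_zero_arr d.P_zero)
  qed
qed

text \<open>
  The images of the generators under the exponential of \<open>z\<close>.
\<close>

definition X_translated :: "'v \<Rightarrow> nat \<Rightarrow> 'v diagram set" where
  "X_translated i = const_series (scale U) (dot i) \<oplus>\<^bsub>series U\<^esub> t_times (scale U) (ident (series U) [i])"

definition Y_constant :: "'v \<Rightarrow> 'v \<Rightarrow> nat \<Rightarrow> 'v diagram set" where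
  "Y_constant i j = const_series (scale U) (cross i j)"

sublocale z: klr_expansion V E X_translated Y_constant
proof (rule klr_expansion.intro)
  show "klr_model (series U) V X_translated Y_constant E"
    using S.klr_model_translated by (simp add: X_translated_def[abs_def] Y_constant_def[abs_def])
qed (simp_all add: X_translated_def Y_constant_def series_simps U.scale_zero_arr)

lemma z_generators:
  assumes "i \<in> V"
  shows "z.coefficient (Suc 0) (dot i) = ident U [i]"
    and "z.coefficient (Suc (Suc k)) (dot i) = zero U [i] [i]"
    and "j \<in> V \<Longrightarrow> z.coefficient (Suc k) (cross i j) = zero U [i, j] [j, i]"
  using assms
  by (simp_all add: z.coefficient_dot z.coefficient_cross X_translated_def Y_constant_def series_simps U.scale_zero_arr)

lemma z_law:
  assumes "U.arr f"
  shows "z.law f"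
proof (rule z.law_from_generators[OF _ _ assms])
  fix i assume i: "i \<in> V"
  show "z.law (dot i)"
    using i by (intro z.law_finite[OF _ z_generators(1,2)]) (simp_all add: z_generators z.P_ident z.P_zero)
  fix j assume j: "j \<in> V"
  show "z.law (cross i j)"
    using i j by (intro z.law_finite[OF _ z_generators(3) z_generators(3)]) (simp_all add: z_generators z.P_zero)
qed

abbreviation d where "d \<equiv> d.coefficient (Suc 0)"
abbreviation z where "z \<equiv> z.coefficient (Suc 0)"
definition h where "h f = z (d f) \<oplus>\<^sub>U (- 1) \<cdot>\<^sub>U d (z f)"

lemma derivations: "derivation U d" "derivation U z" "derivation U h"
  using U.derivation_commutator[OF z.derivation_P d.derivation_P]
  by (simp_all add: d.derivation_P z.derivation_P h_def[abs_def])

lemmas d_simps = U.linear_simps[OF derivations(1)] U.derivationD(2,3)[OF derivations(1)] U.derivation_ident_zero[OF derivations(1)]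
lemmas z_simps = U.linear_simps[OF derivations(2)] U.derivationD(2,3)[OF derivations(2)] U.derivation_ident_zero[OF derivations(2)]
lemmas h_simps = U.linear_simps[OF derivations(3)] U.derivationD(2,3)[OF derivations(3)] U.derivation_ident_zero[OF derivations(3)]

lemma d_dot: "i \<in> V \<Longrightarrow> d (dot i) = dot i \<odot>\<^sub>U dot i"
  by (simp add: d.coefficient_dot X'_coefficient)

lemma d_cross:
  "i \<in> V \<Longrightarrow> d (cross i i) = (- 1) \<cdot>\<^sub>U (x1 i \<odot>\<^sub>U y i) \<oplus>\<^sub>U (- 1) \<cdot>\<^sub>U (y i \<odot>\<^sub>U x2 i)"
  "i \<in> V \<Longrightarrow> j \<in> V \<Longrightarrow> adjacent E i j
    \<Longrightarrow> d (cross i j) = (dot j \<otimes>\<^sub>U ident U [i]) \<odot>\<^sub>U cross i j"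
  "i \<in> V \<Longrightarrow> j \<in> V \<Longrightarrow> i \<noteq> j \<Longrightarrow> \<not> adjacent E i j \<Longrightarrow> d (cross i j) = zero U [i, j] [j, i]"
proof -
  show "d (cross i i) = (- 1) \<cdot>\<^sub>U (x1 i \<odot>\<^sub>U y i) \<oplus>\<^sub>U (- 1) \<cdot>\<^sub>U (y i \<odot>\<^sub>U x2 i)" if "i \<in> V"
    using that by (rule same_colour_series(1))
  show "d (cross i j) = (dot j \<otimes>\<^sub>U ident U [i]) \<odot>\<^sub>U cross i j"
    if "i \<in> V" "j \<in> V" "adjacent E i j"
  proof -
    have "i \<noteq> j" using that(3) S.edge_distinct by (auto simp: adjacent_def)
    then show ?thesis using that by (simp add: d.coefficient_cross Y'_coefficient(1))
  qed
  show "d (cross i j) = zero U [i, j] [j, i]" if "i \<in> V" "j \<in> V" "i \<noteq> j" "\<not> adjacent E i j"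
    using that by (simp add: d.coefficient_cross Y'_coefficient(2) U.scale_zero_arr)
qed

lemma scale_add_same:
  assumes "U.arr f"
  shows "m \<cdot>\<^sub>U f \<oplus>\<^sub>U n \<cdot>\<^sub>U f = (m + n) \<cdot>\<^sub>U f" "f \<oplus>\<^sub>U f = 2 \<cdot>\<^sub>U f"
  using U.scale_left[OF U.arr_hom[OF assms], of m n] U.scale_left[OF U.arr_hom[OF assms], of 1 1] assms by simp_all

lemma h_dot: "i \<in> V \<Longrightarrow> h (dot i) = 2 \<cdot>\<^sub>U dot i"
  by (simp add: h_def d_dot z_simps z_generators d_simps scale_add_same)

lemma h_cross:
  assumes "i \<in> V" "j \<in> V"
  shows "h (cross i j) = (- pairing E i j) \<cdot>\<^sub>U cross i j"
proof -
  have loop: "\<not> adjacent E i i" using S.edge_distinct by (auto simp: adjacent_def)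
  consider "i = j" | "i \<noteq> j" "adjacent E i j" | "i \<noteq> j" "\<not> adjacent E i j" by blast
  then show ?thesis
    using assms loop
    by cases (simp_all add: h_def pairing_def d_cross z_simps z_generators d_simps scale_add_same U.scale_zero_arr)
qed

text \<open>
  By the Leibniz rule the degrees of factors add up.
\<close>

lemma h_degree:
  assumes "has_degree E n t" "typed V t"
  shows "h (klr_class V E t) = n \<cdot>\<^sub>U klr_class V E t"
  using assms
proof induction
  case (1 u)
  then show ?case
    using h_simps(8)[of u] U.scale_zero_arr[of "ident U u"] by (simp add: KLR_simps del: KLR_scale)
next
  case (2 i)
  then show ?case using h_dot[of i] by (simp add: klr_dot_def)
next
  case (3 i j)
  then show ?case using h_cross[of i j] by (simp add: klr_cross_def)
next
  case (4 n u v)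
  then show ?case
    using h_simps(9)[of u v] U.scale_zero_right[of u v n] by (simp add: KLR_simps del: KLR_scale)
next
  case (5 n s t)
  let ?s = "klr_class V E s" and ?t = "klr_class V E t"
  have "h (?s \<oplus>\<^sub>U ?t) = n \<cdot>\<^sub>U (?s \<oplus>\<^sub>U ?t)"
    using 5 by (simp add: h_simps U.scale_add_arr del: KLR_scale KLR_add)
  then show ?case using 5 by simp
next
  case (6 n s c)
  let ?s = "klr_class V E s"
  have "h (c \<cdot>\<^sub>U ?s) = n \<cdot>\<^sub>U c \<cdot>\<^sub>U ?s"
    using 6 by (simp add: h_simps mult.commute del: KLR_scale)
  then show ?case using 6 by simp
next
  case (7 m s n t)
  let ?s = "klr_class V E s" and ?t = "klr_class V E t"
  have "h (?s \<odot>\<^sub>U ?t) = (m + n) \<cdot>\<^sub>U (?s \<odot>\<^sub>U ?t)"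
    using 7 by (simp add: h_simps U.comp_scale_arr scale_add_same del: KLR_scale KLR_comp)
  then show ?case using 7 by simp
next
  case (8 m s n t)
  let ?s = "klr_class V E s" and ?t = "klr_class V E t"
  have "h (?s \<otimes>\<^sub>U ?t) = (m + n) \<cdot>\<^sub>U (?s \<otimes>\<^sub>U ?t)"
    using 8 by (simp add: h_simps U.tensor_scale_arr scale_add_same del: KLR_scale KLR_tensor)
  then show ?case using 8 by simp
qed

lemma homog_KLR: "f \<in> homog U u v n \<longleftrightarrow> (\<exists>t. arrow V u v t \<and> has_degree E n t \<and> f = klr_class V E t)"
  unfolding KLR_def klr_class_def quotient_def by auto

lemma degree_operator_h: "degree_operator U h"
  using U.derivationD(1)[OF derivations(3)] h_degree by (auto simp: degree_operator_def homog_KLR arrow_iff)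

text \<open>
  The span of the homogeneous morphisms. It contains the generators and is closed under all operations, so
  it contains every morphism.
\<close>

inductive homogeneous_sum :: "'v diagram set \<Rightarrow> bool" where
  homogeneous: "typed V t \<Longrightarrow> has_degree E n t \<Longrightarrow> homogeneous_sum (klr_class V E t)"
| plus: "homogeneous_sum f \<Longrightarrow> homogeneous_sum g \<Longrightarrow> U.source f = U.source g \<Longrightarrow> U.target f = U.target g
    \<Longrightarrow> homogeneous_sum (f \<oplus>\<^sub>U g)"

lemma homogeneous_sum_arr: "homogeneous_sum f \<Longrightarrow> U.arr f"
  by (induction rule: homogeneous_sum.induct) simp_all

lemma homogeneous_sum_scale: "homogeneous_sum f \<Longrightarrow> homogeneous_sum (c \<cdot>\<^sub>U f)"
proof (induction rule: homogeneous_sum.induct)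
  case (homogeneous t n)
  then show ?case using homogeneous_sum.homogeneous[of "c \<bullet> t" n] by (simp add: has_degree.intros)
next
  case (plus f g)
  then show ?case
    using homogeneous_sum.plus[OF plus.IH] by (simp add: homogeneous_sum_arr U.scale_add_arr)
qed

lemma homogeneous_sum_comp_left:
  assumes "typed V s" "has_degree E m s"
  shows "homogeneous_sum g \<Longrightarrow> src s = U.target g \<Longrightarrow> homogeneous_sum (klr_class V E s \<odot>\<^sub>U g)"
proof (induction rule: homogeneous_sum.induct)
  case (homogeneous t n)
  then show ?case
    using homogeneous_sum.homogeneous[of "s \<boxdot> t" "m + n"] assms by (simp add: has_degree.intros)
next
  case (plus f g)
  then show ?case
    using homogeneous_sum.plus[of "klr_class V E s \<odot>\<^sub>U f" "klr_class V E s \<odot>\<^sub>U g"] assms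
    by (simp add: homogeneous_sum_arr U.comp_add_arr)
qed

lemma homogeneous_sum_comp:
  "homogeneous_sum f \<Longrightarrow> homogeneous_sum g \<Longrightarrow> U.source f = U.target g \<Longrightarrow> homogeneous_sum (f \<odot>\<^sub>U g)"
proof (induction rule: homogeneous_sum.induct)
  case (homogeneous s m)
  then show ?case by (simp add: homogeneous_sum_comp_left)
next
  case (plus f f')
  then show ?case
    using homogeneous_sum.plus[of "f \<odot>\<^sub>U g" "f' \<odot>\<^sub>U g"]
    by (simp add: homogeneous_sum_arr U.comp_add_arr)
qed

lemma homogeneous_sum_tensor_left:
  assumes "typed V s" "has_degree E m s"
  shows "homogeneous_sum g \<Longrightarrow> homogeneous_sum (klr_class V E s \<otimes>\<^sub>U g)"
proof (induction rule: homogeneous_sum.induct)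
  case (homogeneous t n)
  then show ?case
    using homogeneous_sum.homogeneous[of "s \<boxtimes> t" "m + n"] assms by (simp add: has_degree.intros)
next
  case (plus f g)
  then show ?case
    using homogeneous_sum.plus[of "klr_class V E s \<otimes>\<^sub>U f" "klr_class V E s \<otimes>\<^sub>U g"] assms
    by (simp add: homogeneous_sum_arr U.tensor_add_arr)
qed

lemma homogeneous_sum_tensor:
  "homogeneous_sum f \<Longrightarrow> homogeneous_sum g \<Longrightarrow> homogeneous_sum (f \<otimes>\<^sub>U g)"
proof (induction rule: homogeneous_sum.induct)
  case (homogeneous s m)
  then show ?case by (simp add: homogeneous_sum_tensor_left)
next
  case (plus f f')
  then show ?case
    using homogeneous_sum.plus[of "f \<otimes>\<^sub>U g" "f' \<otimes>\<^sub>U g"]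
    by (simp add: homogeneous_sum_arr U.tensor_add_arr)
qed

lemma homogeneous_sum_all: "U.arr f \<Longrightarrow> homogeneous_sum f"
proof (induction rule: KLR_induct)
  case (Ident u)
  then show ?case using homogeneous[of "Ident u" 0] by (simp add: KLR_simps has_degree.intros)
next
  case (Dot i)
  then show ?case using homogeneous[of "Dot i" 2] by (simp add: klr_dot_def has_degree.intros)
next
  case (Cross i j)
  then show ?case using homogeneous[of "Cross i j" "- pairing E i j"] by (simp add: klr_cross_def has_degree.intros)
next
  case (Zero u v)
  then show ?case using homogeneous[of "Null u v" 0] by (simp add: KLR_simps has_degree.intros)
qed (auto simp: U.hom_iff intro: plus homogeneous_sum_scale homogeneous_sum_comp homogeneous_sum_tensor)

lemma degree_operator_unique:
  assumes "degree_operator U h'" "f \<in> mor U"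
  shows "h' f = h f"
proof -
  have l: "linear_operator U h'" "linear_operator U h"
    using assms(1) degree_operator_h by (simp_all add: degree_operator_def)
  have deg: "h' (klr_class V E t) = n \<cdot>\<^sub>U klr_class V E t" if "typed V t" "has_degree E n t" for t n
  proof -
    have "klr_class V E t \<in> homog U (src t) (tgt t) n"
      using that by (auto simp: homog_KLR arrow_iff)
    then show ?thesis
      using assms(1) typed_lists[OF that(1)] unfolding degree_operator_def KLR_simps(1) by blast
  qed
  have "homogeneous_sum f" using assms(2) by (intro homogeneous_sum_all) (simp add: U.arr_def)
  then show ?thesis
  proof (induction rule: homogeneous_sum.induct)
    case (homogeneous t n)
    then show ?case by (simp only: deg h_degree)
  next
    case (plus f g)
    then show ?case by (simp add: homogeneous_sum_arr U.linear_operatorD[OF l(1)] U.linear_operatorD[OF l(2)])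
  qed
qed

text \<open>
  Both sides are derivations, so generators suffice; there \<open>d\<close> raises the degree by two.
\<close>

lemma h_d:
  assumes "f \<in> mor U"
  shows "h (d f) \<oplus>\<^sub>U (- 1) \<cdot>\<^sub>U d (h f) = 2 \<cdot>\<^sub>U d f"
proof (rule derivation_KLR_eqI[OF U.derivation_commutator[OF derivations(3,1)] U.derivation_scale[OF derivations(1)] _ _ assms])
  fix i assume i: "i \<in> V"
  show "h (d (dot i)) \<oplus>\<^sub>U (- 1) \<cdot>\<^sub>U d (h (dot i)) = 2 \<cdot>\<^sub>U d (dot i)"
    using i by (simp add: d_dot h_dot h_simps d_simps U.comp_scale_arr scale_add_same)
  fix j assume j: "j \<in> V"
  have loop: "\<not> adjacent E i i" using S.edge_distinct by (auto simp: adjacent_def)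
  consider "i = j" | "i \<noteq> j" "adjacent E i j" | "i \<noteq> j" "\<not> adjacent E i j" by blast
  then show "h (d (cross i j)) \<oplus>\<^sub>U (- 1) \<cdot>\<^sub>U d (h (cross i j)) = 2 \<cdot>\<^sub>U d (cross i j)"
    using i j loop
    by cases (simp_all add: d_cross h_cross h_dot pairing_def h_simps d_simps U.comp_scale_arr U.tensor_scale_arr
      U.scale_add_arr U.add_assoc_arr scale_add_same U.scale_zero_arr)
qed

text \<open>
  Both sides are derivations, so generators suffice; there \<open>z\<close> lowers the degree by two.
\<close>

lemma h_z:
  assumes "f \<in> mor U"
  shows "h (z f) \<oplus>\<^sub>U (- 1) \<cdot>\<^sub>U z (h f) = (- 2) \<cdot>\<^sub>U z f"
proof (rule derivation_KLR_eqI[OF U.derivation_commutator[OF derivations(3,2)] U.derivation_scale[OF derivations(2)] _ _ assms])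
  fix i assume i: "i \<in> V"
  show "h (z (dot i)) \<oplus>\<^sub>U (- 1) \<cdot>\<^sub>U z (h (dot i)) = (- 2) \<cdot>\<^sub>U z (dot i)"
    using i by (simp add: z_generators h_dot h_simps z_simps)
  fix j assume j: "j \<in> V"
  show "h (z (cross i j)) \<oplus>\<^sub>U (- 1) \<cdot>\<^sub>U z (h (cross i j)) = (- 2) \<cdot>\<^sub>U z (cross i j)"
    using i j by (simp add: z_generators h_cross h_simps z_simps)
qed

lemma sl2_action: "sl2_action_by_derivations U d h (\<lambda>f. (- 1) \<cdot>\<^sub>U z f)"
proof -
  have "sl2_triple U d h (\<lambda>f. (- 1) \<cdot>\<^sub>U z f)"
    unfolding sl2_triple_def
  proof (intro ballI conjI)
    fix m assume m: "m \<in> mor U"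
    then have a: "U.arr m" by (simp add: U.arr_def)
    show "d ((- 1) \<cdot>\<^sub>U z m) \<oplus>\<^sub>U (- 1) \<cdot>\<^sub>U (- 1) \<cdot>\<^sub>U z (d m) = h m"
      using a by (simp add: d_simps z_simps h_def U.add_comm_arr)
    show "h (d m) \<oplus>\<^sub>U (- 1) \<cdot>\<^sub>U d (h m) = 2 \<cdot>\<^sub>U d m"
      using m by (rule h_d)
    have "h ((- 1) \<cdot>\<^sub>U z m) \<oplus>\<^sub>U (- 1) \<cdot>\<^sub>U (- 1) \<cdot>\<^sub>U z (h m) =
        (- 1) \<cdot>\<^sub>U (h (z m) \<oplus>\<^sub>U (- 1) \<cdot>\<^sub>U z (h m))"
      using a by (simp add: h_simps z_simps U.scale_add_arr)
    also have "\<dots> = (- 2) \<cdot>\<^sub>U (- 1) \<cdot>\<^sub>U z m"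
      unfolding h_z[OF m] using a by (simp add: z_simps)
    finally show "h ((- 1) \<cdot>\<^sub>U z m) \<oplus>\<^sub>U (- 1) \<cdot>\<^sub>U (- 1) \<cdot>\<^sub>U z (h m) = (- 2) \<cdot>\<^sub>U (- 1) \<cdot>\<^sub>U z m" .
  qed
  then show ?thesis
    by (simp add: sl2_action_by_derivations_def derivations U.derivation_scale)
qed

lemma d_on_generators_d: "d_on_generators V E d"
  by (simp add: d_on_generators_def Let_def klr_dot1_def klr_dot2_def d_dot d_cross)

lemma z_on_generators_z: "z_on_generators V E z"
  by (simp add: z_on_generators_def z_generators)

lemma d_unique:
  assumes "derivation U d'" "d_on_generators V E d'" "f \<in> mor U"
  shows "d' f = d f"
proof (rule derivation_KLR_eqI[OF assms(1) derivations(1) _ _ assms(3)])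
  fix i assume i: "i \<in> V"
  then show "d' (dot i) = d (dot i)"
    using assms(2) d_on_generators_d by (simp add: d_on_generators_def Let_def)
  fix j assume j: "j \<in> V"
  show "d' (cross i j) = d (cross i j)"
    using i j assms(2) d_on_generators_d
    by (cases "i = j"; cases "adjacent E i j") (simp_all add: d_on_generators_def Let_def)
qed

lemma z_unique:
  assumes "derivation U z'" "z_on_generators V E z'" "f \<in> mor U"
  shows "z' f = z f"
  using assms(2) z_on_generators_z
  by (intro derivation_KLR_eqI[OF assms(1) derivations(2) _ _ assms(3)]) (simp_all add: z_on_generators_def)

lemma divided_powers_sl2: "divided_powers_sl2_algebra U d h z"
  using sl2_action d.divided_powers_of_P[OF d_law] z.divided_powers_of_P[OF z_law]
  unfolding divided_powers_sl2_algebra_def divided_powers_integral_def by blast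

end

theorem theorem4p4:
  fixes V :: "'v set" and E :: "('v \<times> 'v) set"
  assumes "oriented_simply_laced_graph V E"
  shows "\<exists>d h z.
    (derivation (KLR V E) d \<and> d_on_generators V E d) \<and>
    degree_operator (KLR V E) h \<and>
    (derivation (KLR V E) z \<and> z_on_generators V E z) \<and>
    (\<forall>d'. derivation (KLR V E) d' \<and> d_on_generators V E d' \<longrightarrow> (\<forall>f \<in> mor (KLR V E). d' f = d f)) \<and>
    (\<forall>h'. degree_operator (KLR V E) h' \<longrightarrow> (\<forall>f \<in> mor (KLR V E). h' f = h f)) \<and>
    (\<forall>z'. derivation (KLR V E) z' \<and> z_on_generators V E z' \<longrightarrow> (\<forall>f \<in> mor (KLR V E). z' f = z f)) \<and>
    sl2_action_by_derivations (KLR V E) d h (\<lambda>f. (- 1) \<cdot>\<^bsub>KLR V E\<^esub> z f) \<and>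
    divided_powers_sl2_algebra (KLR V E) d h z"
proof -
  interpret klr_graph V E by (rule klr_graph.intro) (rule assms)
  show ?thesis
    by (intro exI[of _ d] exI[of _ h] exI[of _ z] conjI allI impI ballI; (elim conjE)?)
      (fact derivations d_on_generators_d degree_operator_h z_on_generators_z sl2_action divided_powers_sl2
        | rule d_unique degree_operator_unique z_unique, assumption+)+
qed

end
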